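(* Consider the deconvolution model $y=G(u)+\frac1{\sqrt n}\eta$ with white noise $\eta$ and Gaussian prior $\mu_n=\mathcal N(0,\mathcal C_n)$ diagonal in the Meyer wavelet basis, as described in the context, with parameters $\alpha,\delta>0$ and scales $R_n>0$. Then the model is well-posed. Further, let $\gamma>0$ and let the true solution satisfy $u_0\in\mathcal H_1^\gamma(\mathcal C_n)$. Then $\xi_n$ is a contraction rate at $u_0$, i.e. there is $M>0$ with $\mu_n^y(u:\|u-u_0\|_1>M\xi_n)\to0$ in $\mathbb Q_{u_0,n}$-probability as $n\to\infty$, where $$\xi_n=\begin{cases}n^{-\frac{\gamma}{1+2\alpha+2\gamma}}, & \text{if } 2\gamma\le1+2\delta \text{ and } R_n=n^{\frac{\gamma-\delta}{1+2\alpha+2\gamma}},\\[4pt] n^{-\frac{2\delta+1}{4(1+\alpha+\delta)}}, & \text{if } 2\gamma>1+2\delta \text{ and } R_n=n^{\frac{1}{4(1+\alpha+\delta)}}.\end{cases}$$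
   Context: $\mathcal H_1,\mathcal H_2$ are infinite-dimensional separable Hilbert spaces ($\mathcal H_1$ a space of periodic square-integrable functions), $G:\mathcal H_1\to\mathcal H_2$ is an injective linear operator, and $\{e_k\}_{k\ge1}$, the standard Fourier basis, is an orthonormal basis of $\mathcal H_1$ with $G^TGe_k=\rho_k^2e_k$, where (mild ill-posedness of order $\alpha$) $c_1(1+k^2)^{-\alpha/2}\le\rho_k\le c_2(1+k^2)^{-\alpha/2}$ for constants $c_1,c_2>0$. $\{\varphi_j\}_{j\ge1}$ is the (periodic) Meyer wavelet basis, an orthonormal basis of $\mathcal H_1$ enumerated so that $\langle\varphi_j,e_k\rangle_1=0$ whenever $k\notin[j/3-1,2j]$. The noise $\eta$ is white noise on $\mathcal H_2$: $\langle\eta,x\rangle_2$ are centered jointly Gaussian with covariance $\langle x,x'\rangle_2$; it is realised on a larger space $\prod_i\mathbb R b_i$, $\{b_i\}$ an orthonormal basis of $\mathcal H_2$. The prior $\mu_n$ is the law of $u$ (independent of $\eta$), a centered Gaussian measure on $\mathcal H_1$ whose covariance $\mathcal C_n$ satisfies $\mathcal C_n\varphi_j=R_n^{-2}j^{-1-2\delta}\varphi_j$. $\mathcal H_1^\gamma(\mathcal C_n)=\{u:\sum_i i^{2\gamma}\langle u,\varphi_i\rangle_1^2<\infty\}$ (independent of $n$). $\mathbb Q_{u_0,n}$ is the law of $G(u_0)+\eta/\sqrt n$. The posterior $\mu_n^y$ is the conditional law of $u$ given $y$: $d\mu_n^y/d\mu_n(u)\propto\exp(-\frac n2\|G(u)\|_2^2+n\langle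 y,G(u)\rangle_2)$. Well-posed: (for each $n$) there is a Banach space $(Y,\|\cdot\|_Y)$ with $y\in Y$ almost surely such that $y\mapsto\mu_n^y$ is continuous from $Y$ to probability measures with the Hellinger distance $d_H(\mu,\mu')=\big(\frac12\int(\sqrt{d\mu/dm}-\sqrt{d\mu'/dm})^2dm\big)^{1/2}$ ($m$ any common dominating measure). *)

theory Defs
  imports "HOL-Probability.Probability"
begin

section \<open>Orthonormal bases and smoothness spaces\<close>

definition orthonormal_basis_on :: "'i set \<Rightarrow> ('i \<Rightarrow> 'a::real_inner) \<Rightarrow> bool" where
  "orthonormal_basis_on I e \<longleftrightarrow>
     (\<forall>i\<in>I. \<forall>k\<in>I. e i \<bullet> e k = (if i = k then 1 else 0)) \<and>
     closure (span (e ` I)) = UNIV"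

definition smoothness_space :: "(nat \<Rightarrow> 'a::real_inner) \<Rightarrow> real \<Rightarrow> 'a set" where
  "smoothness_space \<phi> \<gamma> =
     {u. (\<lambda>i. real i powr (2 * \<gamma>) * (u \<bullet> \<phi> i)\<^sup>2) summable_on {1..}}"

section \<open>Gaussian processes, Gaussian measures and white noise\<close>

text \<open>Point masses count as (degenerate) Gaussian laws.\<close>

definition gaussian_rv :: "'w measure \<Rightarrow> ('w \<Rightarrow> real) \<Rightarrow> bool" where
  "gaussian_rv P X \<longleftrightarrow>
     X \<in> borel_measurable P \<and>
     (\<exists>m. (AE \<omega> in P. X \<omega> = m) \<or>
          (\<exists>\<sigma>>0. distributed P lborel X (normal_density m \<sigma>)))"

definition jointly_gaussian :: "'w measure \<Rightarrow> ('i \<Rightarrow> 'w \<Rightarrow> real) \<Rightarrow> bool" where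
  "jointly_gaussian P X \<longleftrightarrow>
     (\<forall>J c. finite J \<longrightarrow> gaussian_rv P (\<lambda>\<omega>. \<Sum>i\<in>J. c i * X i \<omega>))"

definition centered_gaussian_process ::
    "'w measure \<Rightarrow> ('i \<Rightarrow> 'w \<Rightarrow> real) \<Rightarrow> ('i \<Rightarrow> 'i \<Rightarrow> real) \<Rightarrow> bool" where
  "centered_gaussian_process P X K \<longleftrightarrow>
     prob_space P \<and> jointly_gaussian P X \<and>
     (\<forall>i. (\<integral>\<omega>. X i \<omega> \<partial>P) = 0) \<and>
     (\<forall>i k. (\<integral>\<omega>. X i \<omega> * X k \<omega> \<partial>P) = K i k)"

definition centered_gaussian_measure ::
    "'a::{real_inner, complete_space, second_countable_topology} measure \<Rightarrow> ('a \<Rightarrow> 'a) \<Rightarrow> bool" where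
  "centered_gaussian_measure \<mu> C \<longleftrightarrow>
     sets \<mu> = sets borel \<and> bounded_linear C \<and>
     centered_gaussian_process \<mu> (\<lambda>h u. u \<bullet> h) (\<lambda>h h'. C h \<bullet> h')"

text \<open>White noise is not an element of the Hilbert space: \<open>\<eta> x\<close> is the random variable
  written \<open>\<langle>\<eta>, x\<rangle>\<close> in the literature.\<close>

definition white_noise ::
    "'w measure \<Rightarrow> ('b::{real_inner, complete_space, second_countable_topology} \<Rightarrow> 'w \<Rightarrow> real) \<Rightarrow> bool" where
  "white_noise P \<eta> \<longleftrightarrow> centered_gaussian_process P \<eta> (\<bullet>)"

section \<open>Observation and posterior\<close>

text \<open>The observation \<open>y = G u + \<eta> / \<surd>n\<close> takes values in the space \<open>\<Prod>i. \<real> b\<^sub>i\<close> of all formal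
  series in the orthonormal basis \<open>b\<close>, represented by coordinate sequences.\<close>

definition observation ::
    "('a \<Rightarrow> 'b::real_inner) \<Rightarrow> (nat \<Rightarrow> 'b) \<Rightarrow> ('b \<Rightarrow> 'w \<Rightarrow> real) \<Rightarrow> nat \<Rightarrow> 'a \<Rightarrow> 'w \<Rightarrow> (nat \<Rightarrow> real)" where
  "observation G b \<eta> n u \<omega> = (\<lambda>i. G u \<bullet> b i + \<eta> (b i) \<omega> / sqrt (real n))"

definition observation_law ::
    "'w measure \<Rightarrow> ('a \<Rightarrow> 'b::real_inner) \<Rightarrow> (nat \<Rightarrow> 'b) \<Rightarrow> ('b \<Rightarrow> 'w \<Rightarrow> real) \<Rightarrow>
     'a \<Rightarrow> nat \<Rightarrow> (nat \<Rightarrow> real) measure" where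
  "observation_law P G b \<eta> u n =
     distr P (\<Pi>\<^sub>M i\<in>UNIV. borel) (observation G b \<eta> n u)"

text \<open>\<open>\<langle>y, x\<rangle>\<close> for a formal series \<open>y\<close> and a vector \<open>x\<close>; only meaningful when the series converges.\<close>

definition pairing :: "(nat \<Rightarrow> 'b::real_inner) \<Rightarrow> (nat \<Rightarrow> real) \<Rightarrow> 'b \<Rightarrow> real" where
  "pairing b y x = (\<Sum>i. y i * (x \<bullet> b i))"

definition likelihood ::
    "('a \<Rightarrow> 'b::real_inner) \<Rightarrow> (nat \<Rightarrow> 'b) \<Rightarrow> nat \<Rightarrow> (nat \<Rightarrow> real) \<Rightarrow> 'a \<Rightarrow> real" where
  "likelihood G b n y u = exp (- (real n / 2) * (norm (G u))\<^sup>2 + real n * pairing b y (G u))"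

definition posterior ::
    "('a \<Rightarrow> 'b::real_inner) \<Rightarrow> (nat \<Rightarrow> 'b) \<Rightarrow> (nat \<Rightarrow> 'a measure) \<Rightarrow> nat \<Rightarrow> (nat \<Rightarrow> real) \<Rightarrow> 'a measure" where
  "posterior G b \<mu> n y =
     density (\<mu> n) (\<lambda>u. ennreal (likelihood G b n y u / (\<integral>v. likelihood G b n y v \<partial>\<mu> n)))"

section \<open>Well-posedness\<close>

text \<open>The value does not depend on the choice of the dominating measure \<open>m\<close>.\<close>

definition hellinger_dist :: "'a measure \<Rightarrow> 'a measure \<Rightarrow> 'a measure \<Rightarrow> real" where
  "hellinger_dist m \<mu> \<nu> =
     sqrt (1/2 * (\<integral>x. (sqrt (enn2real (RN_deriv m \<mu> x)) - sqrt (enn2real (RN_deriv m \<nu> x)))\<^sup>2 \<partial>m))"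

text \<open>Types cannot be quantified existentially, so a Banach space of observations is a linear
  subspace \<open>Y\<close> of the sequence space together with a complete norm \<open>N\<close> on \<open>Y\<close>.\<close>

definition banach_sequence_space :: "(nat \<Rightarrow> real) set \<Rightarrow> ((nat \<Rightarrow> real) \<Rightarrow> real) \<Rightarrow> bool" where
  "banach_sequence_space Y N \<longleftrightarrow>
     (\<lambda>i. 0) \<in> Y \<and>
     (\<forall>x\<in>Y. \<forall>y\<in>Y. (\<lambda>i. x i + y i) \<in> Y \<and> N (\<lambda>i. x i + y i) \<le> N x + N y) \<and>
     (\<forall>a. \<forall>x\<in>Y. (\<lambda>i. a * x i) \<in> Y \<and> N (\<lambda>i. a * x i) = \<bar>a\<bar> * N x) \<and>
     (\<forall>x\<in>Y. N x \<ge> 0 \<and> (N x = 0 \<longleftrightarrow> x = (\<lambda>i. 0))) \<and>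
     Metric_space.mcomplete Y (\<lambda>x y. N (\<lambda>i. x i - y i))"

text \<open>``Almost surely'' refers to the joint law of \<open>(u, \<eta>)\<close>, with \<open>u\<close> drawn from the prior
  independently of the noise. Convergence of the pairing and \<open>prob_space\<close> make sure that the
  formula for the posterior is meaningful at every single \<open>y \<in> Y\<close>. The prior is the
  dominating measure in the Hellinger distance.\<close>

definition well_posed ::
    "'w measure \<Rightarrow> ('a::real_inner \<Rightarrow> 'b::real_inner) \<Rightarrow> (nat \<Rightarrow> 'b) \<Rightarrow> ('b \<Rightarrow> 'w \<Rightarrow> real) \<Rightarrow>
     (nat \<Rightarrow> 'a measure) \<Rightarrow> bool" where
  "well_posed P G b \<eta> \<mu> \<longleftrightarrow>
     (\<forall>n\<ge>1. \<exists>Y N.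
        banach_sequence_space Y N \<and>
        (AE z in \<mu> n \<Otimes>\<^sub>M P. observation G b \<eta> n (fst z) (snd z) \<in> Y) \<and>
        (\<forall>y\<in>Y. (AE u in \<mu> n. summable (\<lambda>i. y i * (G u \<bullet> b i))) \<and>
               prob_space (posterior G b \<mu> n y)) \<and>
        (\<forall>y\<in>Y. \<forall>\<epsilon>>0. \<exists>d>0. \<forall>y'\<in>Y. N (\<lambda>i. y' i - y i) < d \<longrightarrow>
           hellinger_dist (\<mu> n) (posterior G b \<mu> n y') (posterior G b \<mu> n y) < \<epsilon>))"

section \<open>Contraction rates\<close>

definition contraction_rate ::
    "'w measure \<Rightarrow> ('a::real_inner \<Rightarrow> 'b::real_inner) \<Rightarrow> (nat \<Rightarrow> 'b) \<Rightarrow> ('b \<Rightarrow> 'w \<Rightarrow> real) \<Rightarrow>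
     (nat \<Rightarrow> 'a measure) \<Rightarrow> 'a \<Rightarrow> (nat \<Rightarrow> real) \<Rightarrow> bool" where
  "contraction_rate P G b \<eta> \<mu> u0 \<xi> \<longleftrightarrow>
     (\<exists>M>0. \<forall>\<epsilon>>0.
        (\<lambda>n. measure (observation_law P G b \<eta> u0 n)
               {y. measure (posterior G b \<mu> n y) {u. norm (u - u0) > M * \<xi> n} > \<epsilon>})
        \<longlonglongrightarrow> 0)"

end

theory Submission
  imports Defs
begin

text \<open>Well-posedness: for a suitable Banach space take the sequences \<open>y\<close> for which the series
  \<open>\<langle>y, G u\<rangle>\<close> converges for almost every \<open>u\<close> under the prior, normed by the prior expectation of the
  largest partial sum. Kolmogorov's maximal inequality shows that it contains almost every
  observation. As \<open>\<langle>y, G u\<rangle>\<close> is a limit of centered Gaussians, the norm controls its variance and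
  hence all its exponential moments, which makes the likelihood continuous from the space to \<open>L\<^sup>1\<close>.

  Contraction: put \<open>J = n\<close> to the power \<open>1 / (1 + 2 \<alpha> + 2 \<gamma>)\<close>, so that \<open>\<xi>\<^sub>n\<close> is \<open>J\<close> to the power
  \<open>-\<gamma>\<close>; the second regime is the first one with \<open>\<gamma> = \<delta> + 1/2\<close>. Split \<open>h = u - u\<^sub>0\<close> into its Fourier
  frequencies below and above \<open>J\<close>. Since \<open>G\<close> keeps the two parts orthogonal, the likelihood ratio
  factorises. If the low part is large, its factor is at most \<open>exp (- c J)\<close> as soon as the \<open>J\<close> first
  coordinates of the noise have squared norm of order \<open>J\<close>, while the other factor has mean one. The
  high part is controlled by wavelets with index above \<open>J / 2\<close> and is large only with prior
  probability \<open>exp (- c J)\<close>. Finally the prior puts mass at least \<open>exp (- C J)\<close> on the set where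
  \<open>n \<parallel>G h\<parallel>\<^sup>2 \<le> C J\<close>, which bounds the normalising constant from below.\<close>

section \<open>Centered Gaussian random variables\<close>

text \<open>All exponents are tuned to the single quantity \<open>J\<close>. A deviation of size J
  powr -\<gamma> at frequency J is damped by \<open>G\<close> to J powr (-\<alpha> - \<gamma>), so
  its signal strength is n * J powr (-2\<alpha> - 2\<gamma>) = J. Of the same order J are the noise
  energy in the first J coordinates, minus the log prior mass of a neighbourhood of the truth, and
  the exponent of the prior tail at the rate. Every comparison is thus one of exp (-c M^2 J) with
  exp (-C J), settled by one large constant \<open>M\<close>. The obstacle is that prior and
  operator are diagonal in different bases, so the posterior does not factor over coordinates. Of
  the wavelets only the frequency localisation is used: low blocks of the two bases control each
  other up to a constant factor in the cut-off. A second obstacle is that the noise is given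
  direction by direction, so its linearity holds only almost surely and has to be extracted from
  covariances. The rate saturates at \<gamma> = \<delta> + 1/2 because there the weights j powr
  (2\<gamma>) of the smoothness space meet the Cameron-Martin weights j powr (1 + 2\<delta>) of the
  prior.\<close>

definition centered_normal :: "'w measure \<Rightarrow> ('w \<Rightarrow> real) \<Rightarrow> real \<Rightarrow> bool" where
  "centered_normal P X v \<longleftrightarrow>
     prob_space P \<and> X \<in> borel_measurable P \<and>
     ((v = 0 \<and> (AE \<omega> in P. X \<omega> = 0)) \<or>
      (v > 0 \<and> distributed P lborel X (normal_density 0 (sqrt v))))"

lemma centered_normal_measurable: "centered_normal P X v \<Longrightarrow> X \<in> borel_measurable P"
  by (simp add: centered_normal_def)

lemma centered_normal_nonneg: "centered_normal P X v \<Longrightarrow> 0 \<le> v"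
  by (auto simp: centered_normal_def)

text \<open>In the degenerate case of \<open>gaussian_rv\<close> the mean forces the constant to be
  0 and with it \<open>v = 0\<close>; since there is no density then, \<open>centered_normal\<close>
  has a clause of its own for zero variance.\<close>

lemma gaussian_rv_centered_normal:
  assumes "prob_space P" "gaussian_rv P X" "(\<integral>\<omega>. X \<omega> \<partial>P) = 0" "(\<integral>\<omega>. (X \<omega>)\<^sup>2 \<partial>P) = v"
  shows "centered_normal P X v"
proof -
  interpret prob_space P by fact
  have [measurable]: "X \<in> borel_measurable P" using assms(2) by (simp add: gaussian_rv_def)
  from assms(2) consider m where "AE \<omega> in P. X \<omega> = m"
    | m \<sigma> where "\<sigma> > 0" "distributed P lborel X (normal_density m \<sigma>)"
    by (auto simp: gaussian_rv_def)
  then show ?thesis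
  proof cases
    case 1
    have "(\<integral>\<omega>. X \<omega> \<partial>P) = (\<integral>\<omega>. m \<partial>P)"
      by (rule integral_cong_AE) (use 1 in auto)
    then have m: "m = 0" using assms(3) by (simp add: prob_space)
    have "(\<integral>\<omega>. (X \<omega>)\<^sup>2 \<partial>P) = (\<integral>\<omega>. 0 \<partial>P)"
      by (rule integral_cong_AE) (use 1 m in auto)
    then have "v = 0" using assms(4) by simp
    then show ?thesis using 1 m assms(1) by (simp add: centered_normal_def)
  next
    case 2
    have m: "m = 0" using normal_distributed_expectation[OF 2] assms(3) by simp
    have "variance X = \<sigma>\<^sup>2" using normal_distributed_variance[OF 2] .
    then have "v = \<sigma>\<^sup>2" using assms(3,4) by simp
    then have "v > 0" "sqrt v = \<sigma>" using 2(1) by auto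
    then show ?thesis using 2(2) m assms(1) by (simp add: centered_normal_def)
  qed
qed

lemma centered_normal_nn_integral:
  assumes X: "centered_normal P X v" and v: "v > 0" and g: "g \<in> borel_measurable borel"
  shows "(\<integral>\<^sup>+\<omega>. g (X \<omega>) \<partial>P) = (\<integral>\<^sup>+x. ennreal (normal_density 0 (sqrt v) x) * g x \<partial>lborel)"
  using X v g by (subst distributed_nn_integral[of P lborel X]) (auto simp: centered_normal_def)

lemma centered_normal_zero_nn_integral:
  assumes "centered_normal P X 0"
  shows "(\<integral>\<^sup>+\<omega>. g (X \<omega>) \<partial>P) = g 0"
proof -
  interpret prob_space P using assms by (simp add: centered_normal_def)
  have "(\<integral>\<^sup>+\<omega>. g (X \<omega>) \<partial>P) = (\<integral>\<^sup>+\<omega>. g 0 \<partial>P)"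
    by (rule nn_integral_cong_AE) (use assms in \<open>auto simp: centered_normal_def\<close>)
  then show ?thesis by (simp add: emeasure_space_1)
qed

lemma nn_integral_normal_density:
  assumes "0 < \<sigma>"
  shows "(\<integral>\<^sup>+x. ennreal (normal_density m \<sigma> x) \<partial>lborel) = 1"
  using assms by (subst nn_integral_eq_integral) auto

lemma normal_density_eq_exp:
  assumes "0 < v"
  shows "normal_density m (sqrt v) x = exp (- (x - m)\<^sup>2 / (2 * v)) / sqrt (2 * pi * v)"
  using assms by (simp add: normal_density_def)

text \<open>Completing the square: an exponential weight moves the mean to \<open>t * v\<close> and
  leaves the variance alone.\<close>

lemma normal_density_tilt:
  assumes "0 < v"
  shows "normal_density 0 (sqrt v) x * exp (t * x)
    = exp (t\<^sup>2 * v / 2) * normal_density (t * v) (sqrt v) x"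
proof -
  have "- x\<^sup>2 / (2 * v) + t * x = t\<^sup>2 * v / 2 + - (x - t * v)\<^sup>2 / (2 * v)"
    using assms by (simp add: field_simps power2_eq_square)
  then show ?thesis
    using assms by (simp add: normal_density_eq_exp mult_exp_exp)
qed

lemma centered_normal_mgf:
  assumes X: "centered_normal P X v"
  shows "(\<integral>\<^sup>+\<omega>. ennreal (exp (t * X \<omega>)) \<partial>P) = ennreal (exp (t\<^sup>2 * v / 2))"
proof (cases "v = 0")
  case True
  then show ?thesis using X centered_normal_zero_nn_integral[of P X "\<lambda>x. ennreal (exp (t * x))"] by simp
next
  case False
  then have v: "v > 0" using centered_normal_nonneg[OF X] by simp
  have "(\<integral>\<^sup>+\<omega>. ennreal (exp (t * X \<omega>)) \<partial>P)
      = (\<integral>\<^sup>+x. ennreal (normal_density 0 (sqrt v) x) * ennreal (exp (t * x)) \<partial>lborel)"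
    by (rule centered_normal_nn_integral[OF X v]) measurable
  also have "\<dots> = (\<integral>\<^sup>+x. ennreal (exp (t\<^sup>2 * v / 2)) * ennreal (normal_density (t * v) (sqrt v) x) \<partial>lborel)"
    using v by (simp add: ennreal_mult'[symmetric] normal_density_tilt)
  also have "\<dots> = ennreal (exp (t\<^sup>2 * v / 2))"
    using v by (simp add: nn_integral_cmult nn_integral_normal_density)
  finally show ?thesis .
qed

text \<open>The exact value is (1 - s) to the power -1/2 with s = 2 t v. The condition keeps s at
  most 1/2, where 1 \<le> (1 + s)^2 (1 - s) bounds it by exp s. This moment bound is behind the
  tails of both the noise and the prior.\<close>

lemma centered_normal_exp_square:
  assumes X: "centered_normal P X v" and t: "0 \<le> t" "4 * t * v \<le> 1"
  shows "(\<integral>\<^sup>+\<omega>. ennreal (exp (t * (X \<omega>)\<^sup>2)) \<partial>P) \<le> ennreal (exp (2 * t * v))"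
proof (cases "v = 0")
  case True
  then show ?thesis using X centered_normal_zero_nn_integral[of P X "\<lambda>x. ennreal (exp (t * x\<^sup>2))"] by simp
next
  case False
  then have v: "v > 0" using centered_normal_nonneg[OF X] by simp
  define s where "s = 2 * t * v"
  have s: "0 \<le> s" "s \<le> 1/2" using t v by (auto simp: s_def)
  \<comment> \<open>The weight exp (t x^2) turns the density of variance \<open>v\<close> into a
    multiple of the density of variance \<open>w\<close>.\<close>
  define w where "w = v / (1 - s)"
  have w: "w > 0" using v s by (simp add: w_def)
  have eq: "normal_density 0 (sqrt v) x * exp (t * x\<^sup>2) = (1 / sqrt (1 - s)) * normal_density 0 (sqrt w) x" for x
  proof -
    have "- x\<^sup>2 / (2 * v) + t * x\<^sup>2 = - x\<^sup>2 / (2 * w)"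
      using v s unfolding w_def s_def by (simp add: field_simps)
    moreover have "sqrt (2 * pi * v) = sqrt (1 - s) * sqrt (2 * pi * w)"
      using v s by (simp add: w_def real_sqrt_mult[symmetric])
    ultimately show ?thesis
      using v w by (simp add: normal_density_eq_exp mult_exp_exp)
  qed
  have "(\<integral>\<^sup>+\<omega>. ennreal (exp (t * (X \<omega>)\<^sup>2)) \<partial>P)
      = (\<integral>\<^sup>+x. ennreal (normal_density 0 (sqrt v) x) * ennreal (exp (t * x\<^sup>2)) \<partial>lborel)"
    by (rule centered_normal_nn_integral[OF X v]) measurable
  also have "\<dots> = (\<integral>\<^sup>+x. ennreal (1 / sqrt (1 - s)) * ennreal (normal_density 0 (sqrt w) x) \<partial>lborel)"
    using s by (simp add: ennreal_mult'[symmetric] eq)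
  also have "\<dots> = ennreal (1 / sqrt (1 - s))"
    using w by (simp add: nn_integral_cmult nn_integral_normal_density)
  also have "\<dots> \<le> ennreal (exp s)"
  proof (rule ennreal_leI)
    have "1 \<le> (1 + s) * (1 + s) * (1 - s)"
    proof -
      have "0 \<le> s * (1 - s - s\<^sup>2)"
        using s mult_mono[of s "1/2" s "1/2"] by (intro mult_nonneg_nonneg) (auto simp: power2_eq_square)
      then show ?thesis by (simp add: algebra_simps power2_eq_square)
    qed
    also have "\<dots> \<le> exp s * exp s * (1 - s)"
      using s exp_ge_add_one_self[of s] by (intro mult_right_mono mult_mono) auto
    finally have "1 \<le> (exp s * sqrt (1 - s))\<^sup>2"
      using s by (simp add: power_mult_distrib) (simp add: power2_eq_square)
    then have "1 \<le> exp s * sqrt (1 - s)"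
      using s power2_le_imp_le[of 1 "exp s * sqrt (1 - s)"] by simp
    then show "1 / sqrt (1 - s) \<le> exp s"
      using s by (simp add: divide_le_eq)
  qed
  finally show ?thesis by (simp add: s_def)
qed

lemma centered_normal_second_moment:
  assumes X: "centered_normal P X v"
  shows "(\<integral>\<^sup>+\<omega>. ennreal ((X \<omega>)\<^sup>2) \<partial>P) = ennreal v"
proof (cases "v = 0")
  case True
  then show ?thesis using X centered_normal_zero_nn_integral[of P X "\<lambda>x. ennreal (x\<^sup>2)"] by simp
next
  case False
  then have v: "v > 0" using centered_normal_nonneg[OF X] by simp
  have m: "has_bochner_integral lborel (\<lambda>x. normal_density 0 (sqrt v) x * x\<^sup>2) v"
    using normal_moment_even[of "sqrt v" 0 1] v by simp
  have "(\<integral>\<^sup>+\<omega>. ennreal ((X \<omega>)\<^sup>2) \<partial>P)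
      = (\<integral>\<^sup>+x. ennreal (normal_density 0 (sqrt v) x) * ennreal (x\<^sup>2) \<partial>lborel)"
    by (rule centered_normal_nn_integral[OF X v]) measurable
  also have "\<dots> = (\<integral>\<^sup>+x. ennreal (normal_density 0 (sqrt v) x * x\<^sup>2) \<partial>lborel)"
    by (simp add: ennreal_mult)
  also have "\<dots> = ennreal v"
    using m by (subst nn_integral_eq_integral) (auto simp: has_bochner_integral_iff)
  finally show ?thesis .
qed

text \<open>The first absolute moment of a centered Gaussian determines its variance; this is how a
  norm of \<open>L^1\<close> type will come to control exponential moments.\<close>

lemma centered_normal_abs_moment:
  assumes X: "centered_normal P X v"
  shows "(\<integral>\<^sup>+\<omega>. ennreal \<bar>X \<omega>\<bar> \<partial>P) = ennreal (sqrt (2 * v / pi))"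
proof (cases "v = 0")
  case True
  then show ?thesis using X centered_normal_zero_nn_integral[of P X "\<lambda>x. ennreal \<bar>x\<bar>"] by simp
next
  case False
  then have v: "v > 0" using centered_normal_nonneg[OF X] by simp
  have m: "has_bochner_integral lborel (\<lambda>x. normal_density 0 (sqrt v) x * \<bar>x\<bar>) (sqrt (2 * v / pi))"
    using normal_moment_abs_odd[of "sqrt v" 0 0] v
    by (simp add: real_sqrt_mult[symmetric] mult.commute)
  have "(\<integral>\<^sup>+\<omega>. ennreal \<bar>X \<omega>\<bar> \<partial>P)
      = (\<integral>\<^sup>+x. ennreal (normal_density 0 (sqrt v) x) * ennreal \<bar>x\<bar> \<partial>lborel)"
    by (rule centered_normal_nn_integral[OF X v]) measurable
  also have "\<dots> = (\<integral>\<^sup>+x. ennreal (normal_density 0 (sqrt v) x * \<bar>x\<bar>) \<partial>lborel)"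
    by (simp add: ennreal_mult)
  also have "\<dots> = ennreal (sqrt (2 * v / pi))"
    using m by (subst nn_integral_eq_integral) (auto simp: has_bochner_integral_iff)
  finally show ?thesis .
qed

lemma centered_normal_char:
  assumes X: "centered_normal P X v"
  shows "(\<integral>\<omega>. iexp (t * X \<omega>) \<partial>P) = complex_of_real (exp (- (t\<^sup>2 * v) / 2))"
proof -
  interpret prob_space P using X by (simp add: centered_normal_def)
  have [measurable]: "X \<in> borel_measurable P" by (rule centered_normal_measurable[OF X])
  show ?thesis
  proof (cases "v = 0")
    case True
    have "(\<integral>\<omega>. iexp (t * X \<omega>) \<partial>P) = (\<integral>\<omega>. 1 \<partial>P)"
      by (rule integral_cong_AE) (use X True in \<open>auto simp: centered_normal_def\<close>)
    then show ?thesis using True by (simp add: prob_space)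
  next
    case False
    then have v: "v > 0" using centered_normal_nonneg[OF X] by simp
    have "distributed P lborel X (normal_density 0 (sqrt v))"
      using X v by (simp add: centered_normal_def)
    then have d: "distributed P lborel (\<lambda>\<omega>. X \<omega> / sqrt v) std_normal_density"
      using normal_standard_normal_convert[of "sqrt v" X 0] v by simp
    then have dd: "distr P borel (\<lambda>\<omega>. X \<omega> / sqrt v) = std_normal_distribution"
      using distributed_distr_eq_density[OF d] by (metis distr_cong sets_lborel)
    have "(\<integral>\<omega>. iexp (t * X \<omega>) \<partial>P) = (\<integral>\<omega>. iexp ((t * sqrt v) * (X \<omega> / sqrt v)) \<partial>P)"
      using v by simp
    also have "\<dots> = (\<integral>x. iexp ((t * sqrt v) * x) \<partial>distr P borel (\<lambda>\<omega>. X \<omega> / sqrt v))"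
      by (subst integral_distr) auto
    also have "\<dots> = char std_normal_distribution (t * sqrt v)"
      by (simp add: dd char_def)
    also have "\<dots> = complex_of_real (exp (- (t\<^sup>2 * v) / 2))"
      using v by (simp add: char_std_normal_distribution power_mult_distrib)
    finally show ?thesis .
  qed
qed

text \<open>Within distance \<open>r \<le> sqrt v\<close> of \<open>a\<close> one has x^2 \<le> 2 v
  + 2 a^2, so the density is at least the constant \<open>c\<close> there, on an interval of length
  2 r. The factor with \<open>a\<^sup>2 / v\<close> is the price for a centre away from 0.\<close>

lemma centered_normal_small_interval:
  assumes X: "centered_normal P X v" and v: "v > 0" and r: "0 < r" "r \<le> sqrt v"
  shows "measure P {\<omega> \<in> space P. \<bar>X \<omega> - a\<bar> \<le> r} \<ge> exp (- 1 - a\<^sup>2 / v) * sqrt (2 / pi) * (r / sqrt v)"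
proof -
  interpret prob_space P using X by (simp add: centered_normal_def)
  have [measurable]: "X \<in> borel_measurable P" by (rule centered_normal_measurable[OF X])
  define c where "c = exp (- 1 - a\<^sup>2 / v) / sqrt (2 * pi * v)"
  have c: "c \<le> normal_density 0 (sqrt v) x" if "x \<in> {a - r .. a + r}" for x
  proof -
    have "(x - a)\<^sup>2 \<le> r\<^sup>2" using that by (intro abs_le_square_iff[THEN iffD1]) auto
    also have "\<dots> \<le> v" using r v by (metis abs_of_nonneg less_imp_le real_sqrt_le_mono real_sqrt_abs real_sqrt_le_iff)
    finally have "(x - a)\<^sup>2 \<le> v" .
    moreover have "x\<^sup>2 \<le> 2 * (x - a)\<^sup>2 + 2 * a\<^sup>2"
      using zero_le_power2[of "x - 2 * a"] by (simp add: power2_eq_square algebra_simps)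
    ultimately have "x\<^sup>2 \<le> 2 * v + 2 * a\<^sup>2" by linarith
    then have "x\<^sup>2 / (2 * v) \<le> 1 + a\<^sup>2 / v" using v by (simp add: field_simps)
    then show ?thesis using v by (simp add: normal_density_eq_exp c_def divide_right_mono)
  qed
  have "ennreal (c * (2 * r)) = (\<integral>\<^sup>+x. ennreal c * indicator {a - r .. a + r} x \<partial>lborel)"
  proof -
    have "emeasure lborel {a - r .. a + r} = ennreal (2 * r)"
      using r by (subst emeasure_lborel_Icc) auto
    moreover have "ennreal (c * (2 * r)) = ennreal c * ennreal (2 * r)"
      using r v by (intro ennreal_mult) (auto simp: c_def)
    ultimately show ?thesis
      by (subst nn_integral_cmult_indicator) simp_all
  qed
  also have "\<dots> \<le> (\<integral>\<^sup>+x. ennreal (normal_density 0 (sqrt v) x) * indicator {a - r .. a + r} x \<partial>lborel)"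
    using c by (intro nn_integral_mono) (auto split: split_indicator intro!: ennreal_leI)
  also have "\<dots> = (\<integral>\<^sup>+\<omega>. indicator {a - r .. a + r} (X \<omega>) \<partial>P)"
    by (rule centered_normal_nn_integral[OF X v, symmetric]) measurable
  also have "\<dots> = (\<integral>\<^sup>+\<omega>. indicator {\<omega> \<in> space P. \<bar>X \<omega> - a\<bar> \<le> r} \<omega> \<partial>P)"
    by (intro nn_integral_cong) (auto split: split_indicator simp: abs_le_iff)
  also have "\<dots> = ennreal (measure P {\<omega> \<in> space P. \<bar>X \<omega> - a\<bar> \<le> r})"
    by (subst nn_integral_indicator) (auto simp: emeasure_eq_measure)
  finally have "c * (2 * r) \<le> measure P {\<omega> \<in> space P. \<bar>X \<omega> - a\<bar> \<le> r}"
    by (simp add: ennreal_le_iff)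
  moreover have "c * (2 * r) = exp (- 1 - a\<^sup>2 / v) * sqrt (2 / pi) * (r / sqrt v)"
  proof -
    have "sqrt (2 * pi * v) = sqrt 2 * sqrt pi * sqrt v" by (simp add: real_sqrt_mult)
    moreover have "2 = sqrt 2 * sqrt 2" by simp
    ultimately show ?thesis using v
      by (simp add: c_def real_sqrt_divide field_simps)
  qed
  ultimately show ?thesis by simp
qed

lemma centered_normal_square_integrable:
  assumes X: "centered_normal P X v"
  shows "integrable P (\<lambda>\<omega>. (X \<omega>)\<^sup>2)" "(\<integral>\<omega>. (X \<omega>)\<^sup>2 \<partial>P) = v" "integrable P X"
proof -
  interpret prob_space P using X by (simp add: centered_normal_def)
  have [measurable]: "X \<in> borel_measurable P" by (rule centered_normal_measurable[OF X])
  show 1: "integrable P (\<lambda>\<omega>. (X \<omega>)\<^sup>2)"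
    by (rule integrableI_nonneg) (auto simp: centered_normal_second_moment[OF X])
  show "(\<integral>\<omega>. (X \<omega>)\<^sup>2 \<partial>P) = v"
    by (subst integral_eq_nn_integral) (auto simp: centered_normal_second_moment[OF X] centered_normal_nonneg[OF X])
  show "integrable P X" using square_integrable_imp_integrable[OF _ 1] by simp
qed

section \<open>Centered Gaussian processes\<close>

lemma centered_gaussian_process_component:
  assumes "centered_gaussian_process P X K"
  shows "centered_normal P (X i) (K i i)"
proof -
  have "gaussian_rv P (\<lambda>\<omega>. \<Sum>i\<in>{i}. 1 * X i \<omega>)"
    using assms unfolding centered_gaussian_process_def jointly_gaussian_def
    by (elim conjE allE[where x="{i}"] allE[where x="\<lambda>_. 1"]) simp
  then have "gaussian_rv P (X i)" by simp
  then show ?thesis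
    using assms by (intro gaussian_rv_centered_normal) (auto simp: centered_gaussian_process_def power2_eq_square)
qed

lemma centered_gaussian_process_linear_combination:
  assumes X: "centered_gaussian_process P X K" and J: "finite J"
  shows "centered_normal P (\<lambda>\<omega>. \<Sum>i\<in>J. c i * X i \<omega>) (\<Sum>i\<in>J. \<Sum>k\<in>J. c i * c k * K i k)"
proof -
  interpret prob_space P using X by (simp add: centered_gaussian_process_def)
  note comp = centered_gaussian_process_component[OF X]
  have [measurable]: "X i \<in> borel_measurable P" for i by (rule centered_normal_measurable[OF comp])
  have int: "integrable P (X i)" for i by (rule centered_normal_square_integrable(3)[OF comp])
  have int2: "integrable P (\<lambda>\<omega>. X i \<omega> * X k \<omega>)" for i k
  proof (rule Bochner_Integration.integrable_bound)
    show "integrable P (\<lambda>\<omega>. (X i \<omega>)\<^sup>2 + (X k \<omega>)\<^sup>2)"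
      by (intro Bochner_Integration.integrable_add centered_normal_square_integrable(1)[OF comp])
    have "\<bar>x * y\<bar> \<le> x\<^sup>2 + y\<^sup>2" for x y :: real
    proof -
      have "0 \<le> \<bar>x\<bar> * \<bar>y\<bar>" by simp
      then show ?thesis
        using sum_squares_bound[of "\<bar>x\<bar>" "\<bar>y\<bar>"] unfolding abs_mult power2_abs by linarith
    qed
    then show "AE \<omega> in P. norm (X i \<omega> * X k \<omega>) \<le> norm ((X i \<omega>)\<^sup>2 + (X k \<omega>)\<^sup>2)"
      by (intro AE_I2) auto
  qed auto
  show ?thesis
  proof (rule gaussian_rv_centered_normal)
    show "gaussian_rv P (\<lambda>\<omega>. \<Sum>i\<in>J. c i * X i \<omega>)"
      using X J by (simp add: centered_gaussian_process_def jointly_gaussian_def)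
    show "(\<integral>\<omega>. (\<Sum>i\<in>J. c i * X i \<omega>) \<partial>P) = 0"
      using X int by (simp add: centered_gaussian_process_def)
    have "(\<integral>\<omega>. (\<Sum>i\<in>J. c i * X i \<omega>)\<^sup>2 \<partial>P) = (\<integral>\<omega>. (\<Sum>i\<in>J. \<Sum>k\<in>J. (c i * c k) * (X i \<omega> * X k \<omega>)) \<partial>P)"
      by (simp add: power2_eq_square sum_product mult_ac)
    also have "\<dots> = (\<Sum>i\<in>J. \<Sum>k\<in>J. c i * c k * K i k)"
      using X int2 by (simp add: centered_gaussian_process_def)
    finally show "(\<integral>\<omega>. (\<Sum>i\<in>J. c i * X i \<omega>)\<^sup>2 \<partial>P) = (\<Sum>i\<in>J. \<Sum>k\<in>J. c i * c k * K i k)" .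
  qed unfold_locales
qed

text \<open>As \<open>f\<close> may fail to be injective, coefficients that land on the same index
  are added up before joint Gaussianity is applied.\<close>

lemma centered_gaussian_process_reindex:
  assumes X: "centered_gaussian_process P X K"
  shows "centered_gaussian_process P (\<lambda>i. X (f i)) (\<lambda>i k. K (f i) (f k))"
proof -
  have "gaussian_rv P (\<lambda>\<omega>. \<Sum>i\<in>J. c i * X (f i) \<omega>)" if J: "finite J" for J c
  proof -
    have "(\<Sum>i\<in>J. c i * X (f i) \<omega>) = (\<Sum>j\<in>f ` J. (\<Sum>i\<in>{i\<in>J. f i = j}. c i) * X j \<omega>)" for \<omega>
      using sum.image_gen[OF J, of "\<lambda>i. c i * X (f i) \<omega>" f] by (simp add: sum_distrib_right)
    then show ?thesis
      using X J by (simp add: centered_gaussian_process_def jointly_gaussian_def)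
  qed
  then show ?thesis
    using X by (auto simp: centered_gaussian_process_def jointly_gaussian_def)
qed

section \<open>Uncorrelated jointly Gaussian variables are independent\<close>

lemma (in prob_space) iexp_integrable:
  assumes [measurable]: "X \<in> borel_measurable M"
  shows "integrable M (\<lambda>\<omega>. iexp (X \<omega>))"
  by (rule integrable_const_bound[where B=1]) auto

text \<open>The weight is made into a probability density \<open>V / c\<close> with
  \<open>V = W + 2\<close>, positive even where \<open>W\<close> changes sign. By \<open>fac\<close>
  the variable \<open>X\<close> has the same characteristic function under this density as under
  \<open>M\<close>, hence by Levy's one-dimensional uniqueness theorem the same law. The
  contribution of the added 2 cancels at the end.\<close>

lemma (in prob_space) real_factor_through_char:
  fixes W X :: "'a \<Rightarrow> real"
  assumes [measurable]: "W \<in> borel_measurable M" "X \<in> borel_measurable M"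
    and bd: "\<And>\<omega>. \<bar>W \<omega>\<bar> \<le> 1"
    and fac: "\<And>s. (\<integral>\<omega>. W \<omega> *\<^sub>R iexp (s * X \<omega>) \<partial>M) = (\<integral>\<omega>. W \<omega> \<partial>M) *\<^sub>R (\<integral>\<omega>. iexp (s * X \<omega>) \<partial>M)"
    and A[measurable]: "A \<in> sets borel"
  shows "(\<integral>\<omega>. W \<omega> * indicator A (X \<omega>) \<partial>M) = (\<integral>\<omega>. W \<omega> \<partial>M) * prob (X -` A \<inter> space M)"
proof -
  have intW: "integrable M W" by (rule integrable_const_bound[where B=1]) (use bd in auto)
  define V where "V \<omega> = W \<omega> + 2" for \<omega>
  have V1: "1 \<le> V \<omega>" "V \<omega> \<le> 3" for \<omega> using bd[of \<omega>] by (auto simp: V_def)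
  have [measurable]: "V \<in> borel_measurable M" by (simp add: V_def[abs_def])
  have intV: "integrable M V" using intW by (simp add: V_def[abs_def])
  define c where "c = (\<integral>\<omega>. V \<omega> \<partial>M)"
  have cW: "c = (\<integral>\<omega>. W \<omega> \<partial>M) + 2" using intW by (simp add: c_def V_def[abs_def] prob_space)
  have "c \<ge> (\<integral>\<omega>. 1 \<partial>M)" unfolding c_def using V1 intV by (intro integral_mono) auto
  then have c: "c \<ge> 1" by (simp add: prob_space)
  define Q where "Q = density M (\<lambda>\<omega>. ennreal (V \<omega> / c))"
  have Vc: "V \<omega> / c \<ge> 0" for \<omega> using V1(1)[of \<omega>] c by simp
  have "emeasure Q (space Q) = (\<integral>\<^sup>+\<omega>. ennreal (V \<omega> / c) \<partial>M)"
    unfolding Q_def by (subst emeasure_density) (auto intro!: nn_integral_cong)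
  also have "\<dots> = ennreal (\<integral>\<omega>. V \<omega> / c \<partial>M)"
    using intV Vc by (intro nn_integral_eq_integral) auto
  also have "\<dots> = 1" using c by (simp add: c_def[symmetric])
  finally have Q: "prob_space Q" by (rule prob_spaceI)
  have QX[measurable]: "X \<in> borel_measurable Q" by (simp add: Q_def)
  have charQ: "(\<integral>\<omega>. iexp (s * X \<omega>) \<partial>Q) = (\<integral>\<omega>. iexp (s * X \<omega>) \<partial>M)" for s
  proof -
    have i1: "integrable M (\<lambda>\<omega>. W \<omega> *\<^sub>R iexp (s * X \<omega>))"
      by (rule integrable_const_bound[where B=1]) (use bd in auto)
    have i2: "integrable M (\<lambda>\<omega>. 2 *\<^sub>R iexp (s * X \<omega>))"
      by (intro integrable_scaleR_right iexp_integrable) measurable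
    have "(\<integral>\<omega>. iexp (s * X \<omega>) \<partial>Q) = (\<integral>\<omega>. (V \<omega> / c) *\<^sub>R iexp (s * X \<omega>) \<partial>M)"
      unfolding Q_def using Vc by (intro integral_density) auto
    also have "\<dots> = (\<integral>\<omega>. (1 / c) *\<^sub>R (W \<omega> *\<^sub>R iexp (s * X \<omega>) + 2 *\<^sub>R iexp (s * X \<omega>)) \<partial>M)"
      by (intro Bochner_Integration.integral_cong) (auto simp: V_def scaleR_add_left[symmetric])
    also have "\<dots> = (1 / c) *\<^sub>R ((\<integral>\<omega>. W \<omega> \<partial>M) *\<^sub>R (\<integral>\<omega>. iexp (s * X \<omega>) \<partial>M) + 2 *\<^sub>R (\<integral>\<omega>. iexp (s * X \<omega>) \<partial>M))"
      using i1 i2 by (simp only: integral_scaleR_right Bochner_Integration.integral_add fac)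
    also have "\<dots> = (\<integral>\<omega>. iexp (s * X \<omega>) \<partial>M)"
      using c by (simp add: scaleR_add_left[symmetric] cW[symmetric])
    finally show ?thesis .
  qed
  have "distr Q borel X = distr M borel X"
  proof (rule Levy_uniqueness)
    show "real_distribution (distr Q borel X)"
      by (rule prob_space.real_distribution_distr[OF Q]) simp
    show "real_distribution (distr M borel X)" by simp
    show "char (distr Q borel X) = char (distr M borel X)"
    proof (rule ext)
      fix s
      show "char (distr Q borel X) s = char (distr M borel X) s"
        using charQ[of s] by (simp add: char_def integral_distr del: of_real_mult)
    qed
  qed
  then have "measure (distr Q borel X) A = measure (distr M borel X) A" by simp
  then have "measure Q (X -` A \<inter> space M) = prob (X -` A \<inter> space M)"
    by (simp add: measure_distr) (simp add: Q_def)
  moreover have "measure Q (X -` A \<inter> space M) = (\<integral>\<omega>. indicator (X -` A \<inter> space M) \<omega> \<partial>Q)"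
    by (simp add: Q_def)
  moreover have "\<dots> = (\<integral>\<omega>. (V \<omega> / c) *\<^sub>R indicator (X -` A \<inter> space M) \<omega> \<partial>M)"
    unfolding Q_def using Vc by (intro integral_density) auto
  moreover have "\<dots> = (\<integral>\<omega>. (1 / c) *\<^sub>R (W \<omega> * indicator A (X \<omega>) + 2 * indicator (X -` A \<inter> space M) \<omega>) \<partial>M)"
    by (intro Bochner_Integration.integral_cong) (auto simp: V_def split: split_indicator)
  moreover have "\<dots> = (1 / c) * ((\<integral>\<omega>. W \<omega> * indicator A (X \<omega>) \<partial>M) + 2 * prob (X -` A \<inter> space M))"
  proof -
    have "integrable M (\<lambda>\<omega>. W \<omega> * indicator A (X \<omega>))"
      by (rule integrable_const_bound[where B=1]) (use bd in \<open>auto split: split_indicator\<close>)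
    then show ?thesis by (simp add: emeasure_eq_measure)
  qed
  ultimately have "(\<integral>\<omega>. W \<omega> * indicator A (X \<omega>) \<partial>M) + 2 * prob (X -` A \<inter> space M) = c * prob (X -` A \<inter> space M)"
    using c by (simp add: field_simps)
  then show ?thesis by (simp add: cW algebra_simps)
qed

text \<open>Stands in for uniqueness of multivariate characteristic functions: exponentials are
  traded for indicators one coordinate at a time, and each trade uses only the one-dimensional
  theorem. \<open>J\<close> and \<open>t\<close> stay arbitrary because the induction step calls the
  hypothesis with \<open>insert i J\<close>.\<close>

lemma (in prob_space) indicator_prod_iexp_expectation:
  fixes X :: "'i \<Rightarrow> 'a \<Rightarrow> real"
  assumes rv[measurable]: "\<And>i. X i \<in> borel_measurable M"
    and char: "\<And>J t. finite J \<Longrightarrow>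
      (\<integral>\<omega>. iexp (\<Sum>j\<in>J. t j * X j \<omega>) \<partial>M) = (\<Prod>j\<in>J. \<integral>\<omega>. iexp (t j * X j \<omega>) \<partial>M)"
    and A[measurable]: "\<And>i. A i \<in> sets borel"
    and "finite I" "finite J" "I \<inter> J = {}"
  shows "(\<integral>\<omega>. (\<Prod>i\<in>I. indicator (A i) (X i \<omega>)) *\<^sub>R iexp (\<Sum>j\<in>J. t j * X j \<omega>) \<partial>M)
    = (\<Prod>i\<in>I. prob (X i -` A i \<inter> space M)) *\<^sub>R (\<Prod>j\<in>J. \<integral>\<omega>. iexp (t j * X j \<omega>) \<partial>M)"
  using assms(4-)
proof (induction I arbitrary: J t rule: finite_induct)
  case empty
  then show ?case using char[of J t] by simp
next
  case (insert i I)
  define HI :: "'a \<Rightarrow> real" where "HI \<omega> = (\<Prod>i\<in>I. indicator (A i) (X i \<omega>))" for \<omega>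
  define T where "T \<omega> = (\<Sum>j\<in>J. t j * X j \<omega>)" for \<omega>
  define PI where "PI = (\<Prod>i\<in>I. prob (X i -` A i \<inter> space M))"
  define \<phi> where "\<phi> s = (\<integral>\<omega>. iexp (s * X i \<omega>) \<partial>M)" for s
  define F where "F = (\<Prod>j\<in>J. \<integral>\<omega>. iexp (t j * X j \<omega>) \<partial>M)"
  define F' where "F' = (\<Prod>j\<in>J. \<integral>\<omega>. iexp (- t j * X j \<omega>) \<partial>M)"
  have HI_m[measurable]: "HI \<in> borel_measurable M" unfolding HI_def[abs_def] by measurable
  have T_m[measurable]: "T \<in> borel_measurable M" unfolding T_def[abs_def] by measurable
  have HIb: "0 \<le> HI \<omega>" "HI \<omega> \<le> 1" for \<omega>
    by (auto simp: HI_def intro!: prod_nonneg prod_le_1 split: split_indicator)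
  have iJ: "i \<notin> J" "I \<inter> J = {}" "finite J" using insert by auto
  have IH: "(\<integral>\<omega>. HI \<omega> *\<^sub>R iexp (T \<omega>) \<partial>M) = PI *\<^sub>R F"
    using insert.IH[of J t] iJ by (simp add: HI_def T_def PI_def F_def)
  have IH': "(\<integral>\<omega>. HI \<omega> *\<^sub>R iexp (- T \<omega>) \<partial>M) = PI *\<^sub>R F'"
    using insert.IH[of J "\<lambda>j. - t j"] iJ by (simp add: HI_def T_def PI_def F'_def sum_negf)
  \<comment> \<open>Giving the new index a frequency \<open>s\<close> puts it among the exponentials
    of the induction hypothesis; letting \<open>s\<close> vary produces the premise
    \<open>fac\<close> of \<open>real_factor_through_char\<close>.\<close>
  have upd: "(\<Sum>j\<in>insert i J. (g(i := s)) j * X j \<omega>) = s * X i \<omega> + (\<Sum>j\<in>J. g j * X j \<omega>)" for g s \<omega>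
    using iJ by (auto intro!: sum.cong)
  have upd': "(\<Prod>j\<in>insert i J. \<integral>\<omega>. iexp ((g(i := s)) j * X j \<omega>) \<partial>M)
      = \<phi> s * (\<Prod>j\<in>J. \<integral>\<omega>. iexp (g j * X j \<omega>) \<partial>M)" for g s
    using iJ by (simp add: \<phi>_def del: of_real_mult) (auto intro!: prod.cong)
  have IH2: "(\<integral>\<omega>. HI \<omega> *\<^sub>R iexp (s * X i \<omega> + T \<omega>) \<partial>M) = PI *\<^sub>R (\<phi> s * F)" for s
    using insert.IH[of "insert i J" "t(i := s)"] iJ insert.hyps unfolding upd upd'
    by (simp add: HI_def T_def PI_def F_def)
  have IH2': "(\<integral>\<omega>. HI \<omega> *\<^sub>R iexp (s * X i \<omega> + - T \<omega>) \<partial>M) = PI *\<^sub>R (\<phi> s * F')" for s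
    using insert.IH[of "insert i J" "(\<lambda>j. - t j)(i := s)"] iJ insert.hyps unfolding upd upd'
    by (simp add: HI_def T_def PI_def F'_def sum_negf)
  have int: "integrable M (\<lambda>\<omega>. HI \<omega> *\<^sub>R iexp (g \<omega>))" if [measurable]: "g \<in> borel_measurable M" for g
    by (rule integrable_const_bound[where B=1]) (use HIb in auto)
  \<comment> \<open>\<open>real_factor_through_char\<close> wants a real weight, so the phase is
    split into cosine and sine, which combine the hypothesis at \<open>t\<close> with the one at
    \<open>- t\<close>.\<close>
  have cos_iexp: "complex_of_real (cos x) = (iexp x + iexp (- x)) / 2" for x
    by (simp add: cos_of_real[symmetric] cos_exp_eq)
  have sin_iexp: "complex_of_real (sin x) = (iexp x - iexp (- x)) / (2 * \<i>)" for x
    by (simp add: sin_of_real[symmetric] sin_exp_eq)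
  have intr: "integrable M (\<lambda>\<omega>. HI \<omega> * f (T \<omega>))"
    if [measurable]: "f \<in> borel_measurable borel" and "\<And>x. \<bar>f x\<bar> \<le> 1" for f :: "real \<Rightarrow> real"
    by (rule integrable_const_bound[where B=1]) (use HIb that in \<open>auto simp: abs_mult intro!: AE_I2 mult_le_one\<close>)
  have Wc: "complex_of_real (\<integral>\<omega>. HI \<omega> * cos (T \<omega>) \<partial>M) = PI *\<^sub>R ((F + F') / 2)"
  proof -
    have "complex_of_real (\<integral>\<omega>. HI \<omega> * cos (T \<omega>) \<partial>M)
        = (\<integral>\<omega>. (HI \<omega> *\<^sub>R iexp (T \<omega>) + HI \<omega> *\<^sub>R iexp (- T \<omega>)) / 2 \<partial>M)"
      unfolding integral_complex_of_real[symmetric]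
      by (intro Bochner_Integration.integral_cong) (simp_all add: cos_iexp scaleR_conv_of_real algebra_simps add_divide_distrib)
    also have "\<dots> = (PI *\<^sub>R F + PI *\<^sub>R F') / 2"
      using int[OF T_m] int[of "\<lambda>\<omega>. - T \<omega>"] by (simp only: integral_divide_zero Bochner_Integration.integral_add IH IH' borel_measurable_uminus T_m)
    finally show ?thesis by (simp add: scaleR_conv_of_real algebra_simps)
  qed
  have Ws: "complex_of_real (\<integral>\<omega>. HI \<omega> * sin (T \<omega>) \<partial>M) = PI *\<^sub>R ((F - F') / (2 * \<i>))"
  proof -
    have "complex_of_real (\<integral>\<omega>. HI \<omega> * sin (T \<omega>) \<partial>M)
        = (\<integral>\<omega>. (HI \<omega> *\<^sub>R iexp (T \<omega>) - HI \<omega> *\<^sub>R iexp (- T \<omega>)) / (2 * \<i>) \<partial>M)"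
      unfolding integral_complex_of_real[symmetric]
      by (intro Bochner_Integration.integral_cong) (simp_all add: sin_iexp scaleR_conv_of_real algebra_simps diff_divide_distrib)
    also have "\<dots> = (PI *\<^sub>R F - PI *\<^sub>R F') / (2 * \<i>)"
      using int[OF T_m] int[of "\<lambda>\<omega>. - T \<omega>"] by (simp only: integral_divide_zero Bochner_Integration.integral_diff IH IH' borel_measurable_uminus T_m)
    finally show ?thesis by (simp add: scaleR_conv_of_real algebra_simps)
  qed
  have Wc2: "(\<integral>\<omega>. (HI \<omega> * cos (T \<omega>)) *\<^sub>R iexp (s * X i \<omega>) \<partial>M) = PI *\<^sub>R (\<phi> s * (F + F') / 2)" for s
  proof -
    have "(\<integral>\<omega>. (HI \<omega> * cos (T \<omega>)) *\<^sub>R iexp (s * X i \<omega>) \<partial>M)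
        = (\<integral>\<omega>. (HI \<omega> *\<^sub>R iexp (s * X i \<omega> + T \<omega>) + HI \<omega> *\<^sub>R iexp (s * X i \<omega> + - T \<omega>)) / 2 \<partial>M)"
      by (intro Bochner_Integration.integral_cong)
        (simp_all add: cos_iexp scaleR_conv_of_real exp_add distrib_left right_diff_distrib exp_diff exp_minus field_simps)
    also have "\<dots> = (PI *\<^sub>R (\<phi> s * F) + PI *\<^sub>R (\<phi> s * F')) / 2"
      by (subst integral_divide_zero, subst Bochner_Integration.integral_add[OF int int], measurable)
        (simp only: IH2 IH2')
    finally show ?thesis by (simp add: scaleR_conv_of_real algebra_simps)
  qed
  have Ws2: "(\<integral>\<omega>. (HI \<omega> * sin (T \<omega>)) *\<^sub>R iexp (s * X i \<omega>) \<partial>M) = PI *\<^sub>R (\<phi> s * (F - F') / (2 * \<i>))" for s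
  proof -
    have "(\<integral>\<omega>. (HI \<omega> * sin (T \<omega>)) *\<^sub>R iexp (s * X i \<omega>) \<partial>M)
        = (\<integral>\<omega>. (HI \<omega> *\<^sub>R iexp (s * X i \<omega> + T \<omega>) - HI \<omega> *\<^sub>R iexp (s * X i \<omega> + - T \<omega>)) / (2 * \<i>) \<partial>M)"
      by (intro Bochner_Integration.integral_cong)
        (simp_all add: sin_iexp scaleR_conv_of_real exp_add distrib_left right_diff_distrib exp_diff exp_minus field_simps)
    also have "\<dots> = (PI *\<^sub>R (\<phi> s * F) - PI *\<^sub>R (\<phi> s * F')) / (2 * \<i>)"
      by (subst integral_divide_zero, subst Bochner_Integration.integral_diff[OF int int], measurable)
        (simp only: IH2 IH2')
    finally show ?thesis by (simp add: scaleR_conv_of_real algebra_simps)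
  qed
  have bound: "\<bar>HI \<omega> * cos (T \<omega>)\<bar> \<le> 1" "\<bar>HI \<omega> * sin (T \<omega>)\<bar> \<le> 1" for \<omega>
    using HIb[of \<omega>] by (auto simp: abs_mult intro!: mult_le_one)
  have facc: "(\<integral>\<omega>. HI \<omega> * cos (T \<omega>) * indicator (A i) (X i \<omega>) \<partial>M)
      = (\<integral>\<omega>. HI \<omega> * cos (T \<omega>) \<partial>M) * prob (X i -` A i \<inter> space M)"
  proof (rule real_factor_through_char)
    fix s
    show "(\<integral>\<omega>. (HI \<omega> * cos (T \<omega>)) *\<^sub>R iexp (s * X i \<omega>) \<partial>M)
        = (\<integral>\<omega>. HI \<omega> * cos (T \<omega>) \<partial>M) *\<^sub>R (\<integral>\<omega>. iexp (s * X i \<omega>) \<partial>M)"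
      unfolding Wc2 \<phi>_def[symmetric]
      by (subst scaleR_conv_of_real, subst Wc) (simp add: scaleR_conv_of_real)
  qed (use bound in auto)
  have facs: "(\<integral>\<omega>. HI \<omega> * sin (T \<omega>) * indicator (A i) (X i \<omega>) \<partial>M)
      = (\<integral>\<omega>. HI \<omega> * sin (T \<omega>) \<partial>M) * prob (X i -` A i \<inter> space M)"
  proof (rule real_factor_through_char)
    fix s
    show "(\<integral>\<omega>. (HI \<omega> * sin (T \<omega>)) *\<^sub>R iexp (s * X i \<omega>) \<partial>M)
        = (\<integral>\<omega>. HI \<omega> * sin (T \<omega>) \<partial>M) *\<^sub>R (\<integral>\<omega>. iexp (s * X i \<omega>) \<partial>M)"
      unfolding Ws2 \<phi>_def[symmetric]
      by (subst scaleR_conv_of_real, subst Ws) (simp add: scaleR_conv_of_real)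
  qed (use bound in auto)
  have intc: "integrable M (\<lambda>\<omega>. HI \<omega> * cos (T \<omega>) * indicator (A i) (X i \<omega>))"
    by (rule integrable_const_bound[where B=1]) (use bound in \<open>auto split: split_indicator\<close>)
  have ints: "integrable M (\<lambda>\<omega>. HI \<omega> * sin (T \<omega>) * indicator (A i) (X i \<omega>))"
    by (rule integrable_const_bound[where B=1]) (use bound in \<open>auto split: split_indicator\<close>)
  have intC: "integrable M (\<lambda>\<omega>. complex_of_real (HI \<omega> * cos (T \<omega>) * indicator (A i) (X i \<omega>)))"
    by (rule integrable_of_real[OF intc])
  have intS: "integrable M (\<lambda>\<omega>. complex_of_real (HI \<omega> * sin (T \<omega>) * indicator (A i) (X i \<omega>)))"
    by (rule integrable_of_real[OF ints])
  have "(\<integral>\<omega>. (\<Prod>i\<in>insert i I. indicator (A i) (X i \<omega>)) *\<^sub>R iexp (\<Sum>j\<in>J. t j * X j \<omega>) \<partial>M)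
      = (\<integral>\<omega>. complex_of_real (HI \<omega> * cos (T \<omega>) * indicator (A i) (X i \<omega>))
          + \<i> * complex_of_real (HI \<omega> * sin (T \<omega>) * indicator (A i) (X i \<omega>)) \<partial>M)"
    using insert.hyps
    by (intro Bochner_Integration.integral_cong)
      (simp_all add: HI_def[symmetric] T_def[symmetric] scaleR_conv_of_real cis_conv_exp[symmetric] cis.ctr Complex_eq algebra_simps)
  also have "\<dots> = complex_of_real (\<integral>\<omega>. HI \<omega> * cos (T \<omega>) \<partial>M) * prob (X i -` A i \<inter> space M)
      + \<i> * (complex_of_real (\<integral>\<omega>. HI \<omega> * sin (T \<omega>) \<partial>M) * prob (X i -` A i \<inter> space M))"
    using intC intS
    by (simp only: Bochner_Integration.integral_add integrable_mult_right integral_mult_right_zero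
        integral_complex_of_real facc facs) simp
  also have "\<dots> = (prob (X i -` A i \<inter> space M) * PI) *\<^sub>R F"
    unfolding Wc Ws by (simp add: scaleR_conv_of_real field_simps)
  finally show ?case using insert.hyps by (simp add: PI_def F_def)
qed

text \<open>For a diagonal covariance the variance of a linear combination is a sum over its
  coordinates, so the Gaussian characteristic function factorises.\<close>

lemma centered_gaussian_process_indep:
  assumes X: "centered_gaussian_process P X K" and K: "\<And>i k. i \<noteq> k \<Longrightarrow> K i k = 0"
  shows "prob_space.indep_vars P (\<lambda>_. borel) X UNIV"
proof -
  interpret prob_space P using X by (simp add: centered_gaussian_process_def)
  note comp = centered_gaussian_process_component[OF X]
  have rv[measurable]: "X i \<in> borel_measurable P" for i by (rule centered_normal_measurable[OF comp])
  have char: "(\<integral>\<omega>. iexp (\<Sum>j\<in>J. t j * X j \<omega>) \<partial>P) = (\<Prod>j\<in>J. \<integral>\<omega>. iexp (t j * X j \<omega>) \<partial>P)"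
    if J: "finite J" for J t
  proof -
    have "(\<Sum>i\<in>J. \<Sum>k\<in>J. t i * t k * K i k) = (\<Sum>i\<in>J. (t i)\<^sup>2 * K i i)"
    proof (rule sum.cong)
      fix i assume i: "i \<in> J"
      have "(\<Sum>k\<in>J. t i * t k * K i k) = (\<Sum>k\<in>J. if k = i then t i * t i * K i i else 0)"
        by (intro sum.cong) (auto simp: K)
      then show "(\<Sum>k\<in>J. t i * t k * K i k) = (t i)\<^sup>2 * K i i"
        using i J by (simp add: power2_eq_square)
    qed simp
    then have "(\<integral>\<omega>. iexp (1 * (\<Sum>j\<in>J. t j * X j \<omega>)) \<partial>P) = complex_of_real (exp (- (\<Sum>i\<in>J. (t i)\<^sup>2 * K i i) / 2))"
      using centered_normal_char[OF centered_gaussian_process_linear_combination[OF X J, of t], of 1] by simp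
    also have "\<dots> = (\<Prod>i\<in>J. complex_of_real (exp (- ((t i)\<^sup>2 * K i i) / 2)))"
      using J by (simp only: exp_sum[symmetric] of_real_prod[symmetric] sum_divide_distrib[symmetric] sum_negf)
    also have "\<dots> = (\<Prod>j\<in>J. \<integral>\<omega>. iexp (t j * X j \<omega>) \<partial>P)"
      by (simp only: centered_normal_char[OF comp])
    finally show ?thesis by simp
  qed
  have fin: "prob (\<Inter>j\<in>J. X j -` B j \<inter> space P) = (\<Prod>j\<in>J. prob (X j -` B j \<inter> space P))"
    if J: "finite J" "J \<noteq> {}" and B: "\<And>j. B j \<in> sets borel" for J B
  proof -
    have m: "(\<Inter>j\<in>J. X j -` B j \<inter> space P) \<in> sets P"
      using J B by (intro sets.finite_INT) (auto intro: measurable_sets[OF rv])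
    have ind: "(\<Prod>i\<in>J. indicator (B i) (X i \<omega>)) = (indicator (\<Inter>j\<in>J. X j -` B j \<inter> space P) \<omega> :: real)"
      if "\<omega> \<in> space P" for \<omega>
      using J that by (auto simp: indicator_def prod_zero_iff)
    have "complex_of_real (prob (\<Inter>j\<in>J. X j -` B j \<inter> space P))
        = (\<integral>\<omega>. complex_of_real (indicator (\<Inter>j\<in>J. X j -` B j \<inter> space P) \<omega>) \<partial>P)"
      using m by (simp add: Int_absorb1 sets.sets_into_space)
    also have "\<dots> = (\<integral>\<omega>. (\<Prod>i\<in>J. indicator (B i) (X i \<omega>)) *\<^sub>R iexp (\<Sum>j\<in>{}. 0 * X j \<omega>) \<partial>P)"
      by (intro Bochner_Integration.integral_cong) (simp_all add: ind scaleR_conv_of_real)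
    also have "\<dots> = complex_of_real (\<Prod>j\<in>J. prob (X j -` B j \<inter> space P))"
      using indicator_prod_iexp_expectation[of X B J "{}" "\<lambda>_. 0", OF rv char B J(1)]
      by (simp add: scaleR_conv_of_real)
    finally show ?thesis by (simp only: of_real_eq_iff)
  qed
  show ?thesis
    unfolding indep_vars_def2
  proof (intro conjI ballI indep_setsI)
    fix A J assume J: "J \<noteq> {}" "J \<subseteq> UNIV" "finite J"
      and A: "\<forall>j\<in>J. A j \<in> {X j -` A \<inter> space P |A. A \<in> sets borel}"
    have "\<exists>B. \<forall>j. B j \<in> sets borel \<and> (j \<in> J \<longrightarrow> A j = X j -` B j \<inter> space P)"
    proof (rule choice, rule allI)
      fix j show "\<exists>B. B \<in> sets borel \<and> (j \<in> J \<longrightarrow> A j = X j -` B \<inter> space P)"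
        using A by (cases "j \<in> J") auto
    qed
    then obtain B where B: "\<And>j. B j \<in> sets borel" "\<And>j. j \<in> J \<Longrightarrow> A j = X j -` B j \<inter> space P" by blast
    show "prob (\<Inter> (A ` J)) = (\<Prod>j\<in>J. prob (A j))"
      using fin[OF J(3,1) B(1)] B(2) by simp
  qed (auto intro: measurable_sets[OF rv])
qed

section \<open>Orthonormal bases\<close>

lemma orthonormal_basis_on_inner:
  "orthonormal_basis_on I e \<Longrightarrow> i \<in> I \<Longrightarrow> k \<in> I \<Longrightarrow> e i \<bullet> e k = (if i = k then 1 else 0)"
  by (auto simp: orthonormal_basis_on_def)

lemma orthonormal_basis_on_Suc:
  assumes "orthonormal_basis_on {1..} e"
  shows "orthonormal_basis_on UNIV (\<lambda>k. e (Suc k))"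
proof -
  have "range (\<lambda>k. e (Suc k)) = e ` {1..}"
    by (auto simp: image_iff) (metis Suc_le_D atLeast_iff)
  then show ?thesis using assms by (auto simp: orthonormal_basis_on_def)
qed

context
  fixes e :: "nat \<Rightarrow> 'a::real_inner"
  assumes e: "orthonormal_basis_on UNIV e"
begin

lemma onb_inner: "e i \<bullet> e k = (if i = k then 1 else 0)"
  by (rule orthonormal_basis_on_inner[OF e]) auto

lemma onb_inner_sum: "finite F \<Longrightarrow> (\<Sum>i\<in>F. c i *\<^sub>R e i) \<bullet> e k = (if k \<in> F then c k else 0)"
  by (simp add: inner_sum_left onb_inner if_distrib cong: if_cong)

lemma onb_sum_inner_sum:
  "finite F \<Longrightarrow> (\<Sum>i\<in>F. c i *\<^sub>R e i) \<bullet> (\<Sum>i\<in>F. c' i *\<^sub>R e i) = (\<Sum>i\<in>F. c i * c' i)"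
  by (subst inner_sum_right) (simp add: onb_inner_sum mult.commute)

lemma onb_norm_sum: "finite F \<Longrightarrow> (norm (\<Sum>i\<in>F. c i *\<^sub>R e i))\<^sup>2 = (\<Sum>i\<in>F. (c i)\<^sup>2)"
  by (simp add: power2_norm_eq_inner onb_sum_inner_sum) (simp add: power2_eq_square)

lemma onb_dist_projection:
  assumes "finite F"
  shows "(norm (u - (\<Sum>i\<in>F. (u \<bullet> e i) *\<^sub>R e i)))\<^sup>2 = (norm u)\<^sup>2 - (\<Sum>i\<in>F. (u \<bullet> e i)\<^sup>2)"
proof -
  have "u \<bullet> (\<Sum>i\<in>F. (u \<bullet> e i) *\<^sub>R e i) = (\<Sum>i\<in>F. (u \<bullet> e i)\<^sup>2)"
    by (simp add: inner_sum_right power2_eq_square)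
  then show ?thesis
    using onb_norm_sum[OF assms, of "\<lambda>i. u \<bullet> e i"]
    by (simp add: power2_norm_eq_inner inner_diff_left inner_diff_right inner_commute)
qed

lemma onb_bessel: "finite F \<Longrightarrow> (\<Sum>i\<in>F. (u \<bullet> e i)\<^sup>2) \<le> (norm u)\<^sup>2"
  using onb_dist_projection[of F u] by (smt (verit) zero_le_power2)

lemma onb_best_approximation:
  assumes F: "finite F" and v: "v \<in> span (e ` F)"
  shows "norm (u - (\<Sum>i\<in>F. (u \<bullet> e i) *\<^sub>R e i)) \<le> norm (u - v)"
proof -
  define p where "p = (\<Sum>i\<in>F. (u \<bullet> e i) *\<^sub>R e i)"
  have "(u - p) \<bullet> x = 0" if "x \<in> span (e ` F)" for x
    using that
  proof (induction rule: span_induct_alt)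
    case (step c x y)
    then obtain k where "k \<in> F" "x = e k" by auto
    then have "(u - p) \<bullet> x = 0" using F by (simp add: p_def inner_diff_left onb_inner_sum)
    then show ?case using step by (simp add: inner_add_right)
  qed simp
  moreover have "p - v \<in> span (e ` F)"
    unfolding p_def by (intro span_diff v span_sum span_scale span_base) auto
  ultimately have 0: "(u - p) \<bullet> (p - v) = 0" by blast
  have "u - v = (u - p) + (p - v)" by simp
  then have "(norm (u - v))\<^sup>2 = (norm (u - p))\<^sup>2 + (norm (p - v))\<^sup>2"
    using 0 by (simp only: norm_add_Pythagorean orthogonal_def)
  then have "(norm (u - p))\<^sup>2 \<le> (norm (u - v))\<^sup>2" by simp
  then show ?thesis unfolding p_def by (rule power2_le_imp_le) simp
qed

text \<open>Density of the span provides a finite combination close to \<open>u\<close>; projecting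
  onto any initial block that contains its indices does at least as well.\<close>

lemma onb_expansion: "(\<lambda>i. (u \<bullet> e i) *\<^sub>R e i) sums u"
  unfolding sums_def
proof (rule LIMSEQ_I)
  fix r :: real assume r: "0 < r"
  have "u \<in> closure (span (range e))" using e by (simp add: orthonormal_basis_on_def)
  then obtain v where v: "v \<in> span (range e)" "dist v u < r"
    using r by (auto simp: closure_approachable)
  from v(1) obtain t c where t: "finite t" "t \<subseteq> range e" "v = (\<Sum>a\<in>t. c a *\<^sub>R a)"
    by (auto simp: span_explicit)
  then obtain F where F: "finite F" "t = e ` F"
    by (meson finite_subset_image)
  then obtain N where N: "F \<subseteq> {..<N}"
    by (metis finite_nat_iff_bounded)
  show "\<exists>no. \<forall>n\<ge>no. norm ((\<Sum>i<n. (u \<bullet> e i) *\<^sub>R e i) - u) < r"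
  proof (intro exI allI impI)
    fix n assume "N \<le> n"
    then have "t \<subseteq> e ` {..<n}" using N F by force
    then have "v \<in> span (e ` {..<n})"
      using t by (auto intro!: span_sum span_scale intro: span_base)
    from onb_best_approximation[OF finite_lessThan this, of u] v(2)
    show "norm ((\<Sum>i<n. (u \<bullet> e i) *\<^sub>R e i) - u) < r"
      by (simp add: dist_norm norm_minus_commute)
  qed
qed

lemma onb_parseval: "(\<lambda>i. (u \<bullet> e i) * (v \<bullet> e i)) sums (u \<bullet> v)"
  using bounded_linear.sums[OF bounded_linear_inner_left onb_expansion[of u], of v]
  by (simp add: inner_commute)

lemma onb_parseval_norm: "(\<lambda>i. (u \<bullet> e i)\<^sup>2) sums ((norm u)\<^sup>2)"
  using onb_parseval[of u u] by (simp add: power2_eq_square power2_norm_eq_inner[symmetric] flip: power2_norm_eq_inner)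

end

text \<open>Used in both directions: the low-frequency wavelets lie in the span of the low-frequency
  Fourier vectors and conversely, with comparable cut-offs.\<close>

lemma onb_block_inequality:
  fixes u v :: "nat \<Rightarrow> 'a::real_inner"
  assumes u: "orthonormal_basis_on UNIV u" and v: "orthonormal_basis_on UNIV v"
    and F: "finite F" and E: "finite E"
    and supp: "\<And>j k. j \<in> F \<Longrightarrow> k \<notin> E \<Longrightarrow> u j \<bullet> v k = 0"
  shows "(\<Sum>j\<in>F. (h \<bullet> u j)\<^sup>2) \<le> (\<Sum>k\<in>E. (h \<bullet> v k)\<^sup>2)"
proof -
  define h' where "h' = (\<Sum>k\<in>E. (h \<bullet> v k) *\<^sub>R v k)"
  have "h \<bullet> u j = h' \<bullet> u j" if j: "j \<in> F" for j
  proof -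
    have "(\<lambda>k. (h \<bullet> v k) * (u j \<bullet> v k)) sums (\<Sum>k\<in>E. (h \<bullet> v k) * (u j \<bullet> v k))"
      using E supp[OF j] by (intro sums_finite) auto
    then have "h \<bullet> u j = (\<Sum>k\<in>E. (h \<bullet> v k) * (u j \<bullet> v k))"
      using onb_parseval[OF v] sums_unique2 by blast
    then show ?thesis by (simp add: h'_def inner_sum_left inner_commute[of "v _" "u j"])
  qed
  then have "(\<Sum>j\<in>F. (h \<bullet> u j)\<^sup>2) = (\<Sum>j\<in>F. (h' \<bullet> u j)\<^sup>2)" by simp
  also have "\<dots> \<le> (norm h')\<^sup>2" by (rule onb_bessel[OF u F])
  also have "\<dots> = (\<Sum>k\<in>E. (h \<bullet> v k)\<^sup>2)" unfolding h'_def by (rule onb_norm_sum[OF v E])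
  finally show ?thesis .
qed

lemma onb_series_convergent:
  fixes e :: "nat \<Rightarrow> 'a::{real_inner, complete_space}"
  assumes e: "orthonormal_basis_on UNIV e" and c: "summable (\<lambda>i. (c i)\<^sup>2)"
  shows "convergent (\<lambda>n. \<Sum>i<n. c i *\<^sub>R e i)"
proof (rule Cauchy_convergent, rule CauchyI)
  fix r :: real assume r: "0 < r"
  from c have "\<exists>N. \<forall>m\<ge>N. \<forall>n. norm (\<Sum>i=m..<n. (c i)\<^sup>2) < r\<^sup>2"
    using r unfolding summable_Cauchy by (auto simp: zero_less_power)
  then obtain N where N': "\<forall>m\<ge>N. \<forall>n. norm (\<Sum>i=m..<n. (c i)\<^sup>2) < r\<^sup>2" by blast
  have N: "(\<Sum>i=m..<n. (c i)\<^sup>2) < r\<^sup>2" if "m \<ge> N" for m n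
    using N'[rule_format, OF that, of n] by (simp add: sum_nonneg)
  have *: "norm ((\<Sum>i<m. c i *\<^sub>R e i) - (\<Sum>i<n. c i *\<^sub>R e i)) < r" if "N \<le> n" "n \<le> m" for m n
  proof -
    have "(\<Sum>i<m. c i *\<^sub>R e i) - (\<Sum>i<n. c i *\<^sub>R e i) = (\<Sum>i=n..<m. c i *\<^sub>R e i)"
      using that sum_diff_nat_ivl[of 0 n m "\<lambda>i. c i *\<^sub>R e i"] by (simp add: atLeast0LessThan)
    then have "(norm ((\<Sum>i<m. c i *\<^sub>R e i) - (\<Sum>i<n. c i *\<^sub>R e i)))\<^sup>2 = (\<Sum>i=n..<m. (c i)\<^sup>2)"
      by (simp add: onb_norm_sum[OF e])
    then have "(norm ((\<Sum>i<m. c i *\<^sub>R e i) - (\<Sum>i<n. c i *\<^sub>R e i)))\<^sup>2 < r\<^sup>2"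
      using N[OF that(1), of m] by simp
    then show ?thesis using r by (simp add: power_less_imp_less_base)
  qed
  show "\<exists>M. \<forall>m\<ge>M. \<forall>n\<ge>M. norm ((\<Sum>i<m. c i *\<^sub>R e i) - (\<Sum>i<n. c i *\<^sub>R e i)) < r"
  proof (intro exI allI impI)
    fix m n assume "N \<le> m" "N \<le> n"
    then show "norm ((\<Sum>i<m. c i *\<^sub>R e i) - (\<Sum>i<n. c i *\<^sub>R e i)) < r"
      using *[of n m] *[of m n] by (cases "n \<le> m") (auto simp: norm_minus_commute)
  qed
qed

text \<open>\<open>adjoint\<close> is a choice operator, so an adjoint has to be exhibited before
  anything is known about it. For fixed \<open>y\<close> the Riesz vector is the series with
  coefficients \<open>c i = G (e i) \<bullet> y\<close>.\<close>

lemma adjoint_inner: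
  fixes e :: "nat \<Rightarrow> 'a::{real_inner, complete_space}" and G :: "'a \<Rightarrow> 'b::real_inner"
  assumes e: "orthonormal_basis_on UNIV e" and G: "bounded_linear G"
  shows "G x \<bullet> y = x \<bullet> adjoint G y"
proof -
  interpret G: bounded_linear G by fact
  have "\<exists>A. \<forall>x y. G x \<bullet> y = x \<bullet> A y"
  proof -
    have "\<exists>a. \<forall>x. G x \<bullet> y = x \<bullet> a" for y
    proof -
      define c where "c i = G (e i) \<bullet> y" for i
      obtain K where K: "K > 0" "\<And>x. norm (G x) \<le> norm x * K" using G.pos_bounded by blast
      have "(\<Sum>i<n. (c i)\<^sup>2) \<le> (K * norm y)\<^sup>2" for n
      proof -
        \<comment> \<open>Testing the functional on the truncation \<open>z\<close> of the desired
          vector itself returns the squared norm of \<open>z\<close>, which bounds that norm by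
          \<open>K * norm y\<close>.\<close>
        define z where "z = (\<Sum>i<n. c i *\<^sub>R e i)"
        define s where "s = (\<Sum>i<n. (c i)\<^sup>2)"
        have "s = G z \<bullet> y"
          by (simp add: s_def z_def G.sum G.scaleR inner_sum_left c_def power2_eq_square)
        also have "\<dots> \<le> norm (G z) * norm y" by (rule norm_cauchy_schwarz)
        also have "\<dots> \<le> (norm z * K) * norm y" by (intro mult_right_mono K) simp
        finally have le: "s \<le> norm z * (K * norm y)" by simp
        have z: "(norm z)\<^sup>2 = s" unfolding z_def s_def by (rule onb_norm_sum[OF e]) simp
        have "norm z \<le> K * norm y"
        proof (cases "norm z = 0")
          case False
          then have "norm z * norm z \<le> norm z * (K * norm y)" using le z by (simp add: power2_eq_square)
          then show ?thesis using False by simp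
        qed (use K in simp)
        then have "(norm z)\<^sup>2 \<le> (K * norm y)\<^sup>2" by (intro power_mono) auto
        then show ?thesis using z by (simp add: s_def)
      qed
      then have "summable (\<lambda>i. (c i)\<^sup>2)"
        by (intro summableI_nonneg_bounded[of _ "(K * norm y)\<^sup>2"]) auto
      then obtain a where a: "(\<lambda>n. \<Sum>i<n. c i *\<^sub>R e i) \<longlonglongrightarrow> a"
        using onb_series_convergent[OF e] by (auto simp: convergent_def)
      have "G x \<bullet> y = x \<bullet> a" for x
      proof -
        have "(\<lambda>n. G (\<Sum>i<n. (x \<bullet> e i) *\<^sub>R e i) \<bullet> y) \<longlonglongrightarrow> G x \<bullet> y"
          using onb_expansion[OF e, of x] unfolding sums_def
          by (intro tendsto_inner tendsto_const G.tendsto)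
        moreover have "G (\<Sum>i<n. (x \<bullet> e i) *\<^sub>R e i) \<bullet> y = x \<bullet> (\<Sum>i<n. c i *\<^sub>R e i)" for n
          by (simp add: G.sum G.scaleR inner_sum_left inner_sum_right c_def mult.commute)
        moreover have "(\<lambda>n. x \<bullet> (\<Sum>i<n. c i *\<^sub>R e i)) \<longlonglongrightarrow> x \<bullet> a"
          by (intro tendsto_inner tendsto_const a)
        ultimately show ?thesis using LIMSEQ_unique by simp
      qed
      then show ?thesis by blast
    qed
    then show ?thesis by metis
  qed
  then have "\<forall>x y. G x \<bullet> y = x \<bullet> adjoint G y"
    unfolding adjoint_def by (rule someI_ex)
  then show ?thesis by blast
qed

section \<open>Operators that are diagonal in an orthonormal basis up to the adjoint\<close>

text \<open>In particular the images \<open>G (e k)\<close> are orthogonal with squared length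
  \<open>(\<rho> k)\<^sup>2\<close>: splitting \<open>h\<close> by Fourier index splits
  \<open>G h\<close> into orthogonal parts.\<close>

lemma gram_eigenbasis_inner:
  fixes e :: "nat \<Rightarrow> 'a::{real_inner, complete_space}" and G :: "'a \<Rightarrow> 'b::real_inner"
  assumes e: "orthonormal_basis_on UNIV e" and G: "bounded_linear G"
    and eig: "adjoint G (G (e k)) = (\<rho> k)\<^sup>2 *\<^sub>R e k"
  shows "G v \<bullet> G (e k) = (\<rho> k)\<^sup>2 * (v \<bullet> e k)"
  using adjoint_inner[OF e G, of v "G (e k)"] by (simp add: eig)

lemma gram_eigenbasis_norm_sum:
  fixes e :: "nat \<Rightarrow> 'a::{real_inner, complete_space}" and G :: "'a \<Rightarrow> 'b::real_inner"
  assumes e: "orthonormal_basis_on UNIV e" and G: "bounded_linear G"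
    and eig: "\<And>k. adjoint G (G (e k)) = (\<rho> k)\<^sup>2 *\<^sub>R e k" and F: "finite F"
  shows "(norm (G (\<Sum>i\<in>F. c i *\<^sub>R e i)))\<^sup>2 = (\<Sum>i\<in>F. (\<rho> i)\<^sup>2 * (c i)\<^sup>2)"
proof -
  interpret G: bounded_linear G by fact
  define z where "z = (\<Sum>i\<in>F. c i *\<^sub>R e i)"
  have "(norm (G z))\<^sup>2 = (\<Sum>i\<in>F. c i * (G z \<bullet> G (e i)))"
    unfolding power2_norm_eq_inner by (subst (2) z_def) (simp add: G.sum G.scaleR inner_sum_right)
  also have "\<dots> = (\<Sum>i\<in>F. (\<rho> i)\<^sup>2 * (c i)\<^sup>2)"
    using F by (intro sum.cong) (simp_all add: gram_eigenbasis_inner[OF e G, where \<rho>=\<rho>, OF eig] z_def onb_inner_sum[OF e] power2_eq_square)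
  finally show ?thesis by (simp add: z_def)
qed

lemma gram_eigenbasis_norm_sums:
  fixes e :: "nat \<Rightarrow> 'a::{real_inner, complete_space}" and G :: "'a \<Rightarrow> 'b::real_inner"
  assumes e: "orthonormal_basis_on UNIV e" and G: "bounded_linear G"
    and eig: "\<And>k. adjoint G (G (e k)) = (\<rho> k)\<^sup>2 *\<^sub>R e k"
  shows "(\<lambda>k. (\<rho> k)\<^sup>2 * (h \<bullet> e k)\<^sup>2) sums ((norm (G h))\<^sup>2)"
proof -
  interpret G: bounded_linear G by fact
  have "(\<lambda>n. (norm (G (\<Sum>i<n. (h \<bullet> e i) *\<^sub>R e i)))\<^sup>2) \<longlonglongrightarrow> (norm (G h))\<^sup>2"
    using onb_expansion[OF e, of h] unfolding sums_def
    by (intro tendsto_power tendsto_norm G.tendsto)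
  then show ?thesis
    unfolding sums_def by (simp add: gram_eigenbasis_norm_sum[OF e G eig])
qed

text \<open>Summation by parts: with \<open>D\<close> the nonnegative partial sums of
  \<open>y - x\<close>, the induction carries the stronger bound that the weighted difference is at
  least \<open>w m * D m\<close>.\<close>

lemma antimono_weighted_sum_mono:
  fixes w x y :: "nat \<Rightarrow> real"
  assumes w: "antimono w" "\<And>k. 0 \<le> w k"
    and le: "\<And>m. (\<Sum>k\<le>m. x k) \<le> (\<Sum>k\<le>m. y k)"
  shows "(\<Sum>k\<le>m. w k * x k) \<le> (\<Sum>k\<le>m. w k * y k)"
proof -
  define D where "D m = (\<Sum>k\<le>m. y k - x k)" for m
  have D: "0 \<le> D m" for m using le[of m] by (simp add: D_def sum_subtractf)
  have "w m * D m \<le> (\<Sum>k\<le>m. w k * (y k - x k))" for m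
  proof (induction m)
    case (Suc m)
    have "w (Suc m) * D (Suc m) = w (Suc m) * D m + w (Suc m) * (y (Suc m) - x (Suc m))"
      by (simp add: D_def algebra_simps)
    also have "\<dots> \<le> w m * D m + w (Suc m) * (y (Suc m) - x (Suc m))"
      using antimonoD[OF w(1), of m "Suc m"] D[of m] by (simp add: mult_right_mono)
    finally show ?case using Suc by simp
  qed (simp add: D_def)
  moreover have "0 \<le> w m * D m" by (intro mult_nonneg_nonneg w D)
  ultimately have "0 \<le> (\<Sum>k\<le>m. w k * (y k - x k))" by (meson order_trans)
  then show ?thesis by (simp add: right_diff_distrib sum_subtractf)
qed

text \<open>Brings \<open>norm (G h)\<close> into the basis of the prior. The Fourier weights
  decrease, so by summation by parts it is enough to compare the energies of initial blocks, and the
  first m + 1 Fourier vectors see only the first 3 m + 6 wavelets.\<close>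

lemma smoothing_norm_upper_bound:
  fixes e \<phi> :: "nat \<Rightarrow> 'a::{real_inner, complete_space}" and G :: "'a \<Rightarrow> 'b::real_inner"
  assumes e: "orthonormal_basis_on UNIV e" and \<phi>: "orthonormal_basis_on UNIV \<phi>"
    and G: "bounded_linear G" and \<alpha>: "\<alpha> > 0" and c2: "c2 > 0"
    and eig: "\<And>k. adjoint G (G (e k)) = (\<rho> k)\<^sup>2 *\<^sub>R e k"
    and \<rho>: "\<And>k. 0 \<le> \<rho> k" "\<And>k. \<rho> k \<le> c2 * (1 + (real (Suc k))\<^sup>2) powr (- \<alpha> / 2)"
    and supp: "\<And>j k. j > 3 * k + 5 \<Longrightarrow> \<phi> j \<bullet> e k = 0"
  shows "(norm (G h))\<^sup>2 \<le> c2\<^sup>2 * 6 powr (2 * \<alpha>) * (\<Sum>j. real (Suc j) powr (- 2 * \<alpha>) * (h \<bullet> \<phi> j)\<^sup>2)"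
proof -
  define v where "v j = real (Suc j) powr (- 2 * \<alpha>)" for j
  define w where "w k = real (Suc k) powr (- 2 * \<alpha>)" for k
  define x where "x k = (h \<bullet> e k)\<^sup>2" for k
  define y where "y j = (h \<bullet> \<phi> j)\<^sup>2" for j
  \<comment> \<open>Wavelet energies are grouped by frequency, six indices for frequency 0 and three
    for each further one, so that initial sums end exactly at \<open>3 * m + 5\<close>. The weighted
    version is \<open>z'\<close>.\<close>
  define z where "z k = (if k = 0 then (\<Sum>j\<le>5. y j) else (\<Sum>j\<in>{3 * k + 3 .. 3 * k + 5}. y j))" for k
  define z' where "z' k = (if k = 0 then (\<Sum>j\<le>5. v j * y j) else (\<Sum>j\<in>{3 * k + 3 .. 3 * k + 5}. v j * y j))" for k
  have split: "{..3 * Suc m + 5} = {..3 * m + 5} \<union> {3 * Suc m + 3..3 * Suc m + 5}" for m :: nat by auto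
  have zsum: "(\<Sum>k\<le>m. z k) = (\<Sum>j\<le>3 * m + 5. y j)" for m
  proof (induction m)
    case (Suc m)
    show ?case unfolding split by (subst sum.union_disjoint) (use Suc in \<open>auto simp: z_def\<close>)
  qed (simp add: z_def)
  have zsum': "(\<Sum>k\<le>m. z' k) = (\<Sum>j\<le>3 * m + 5. v j * y j)" for m
  proof (induction m)
    case (Suc m)
    show ?case unfolding split by (subst sum.union_disjoint) (use Suc in \<open>auto simp: z'_def\<close>)
  qed (simp add: z'_def)
  \<comment> \<open>The constant 6 comes from
    \<open>Suc j \<le> 3 * k + 6 \<le> 6 * Suc k\<close>.\<close>
  have block: "w k * y j \<le> 6 powr (2 * \<alpha>) * (v j * y j)" if "j \<le> 3 * k + 5" for j k
  proof -
    have "w k = (6 * real (Suc k)) powr (- 2 * \<alpha>) * 6 powr (2 * \<alpha>)"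
    proof -
      have "(6 * real (Suc k)) powr (- 2 * \<alpha>) * 6 powr (2 * \<alpha>)
          = (6 powr (- 2 * \<alpha>) * 6 powr (2 * \<alpha>)) * real (Suc k) powr (- 2 * \<alpha>)"
        by (subst powr_mult) auto
      then show ?thesis by (simp add: w_def flip: powr_add)
    qed
    also have "\<dots> \<le> real (Suc j) powr (- 2 * \<alpha>) * 6 powr (2 * \<alpha>)"
      using that \<alpha> by (intro mult_right_mono powr_mono2') auto
    finally have "w k * y j \<le> (real (Suc j) powr (- 2 * \<alpha>) * 6 powr (2 * \<alpha>)) * y j"
      by (rule mult_right_mono) (simp add: y_def)
    then show ?thesis by (simp add: v_def mult_ac)
  qed
  have wz: "w k * z k \<le> 6 powr (2 * \<alpha>) * z' k" for k
    using block by (auto simp: z_def z'_def sum_distrib_left intro!: sum_mono)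
  have sumv: "summable (\<lambda>j. v j * y j)"
  proof (rule summable_comparison_test'[of y 0])
    show "summable y" using onb_parseval_norm[OF \<phi>, of h] by (auto simp: y_def[abs_def] sums_iff)
    have "v j \<le> 1" for j using \<alpha> powr_mono2'[of "- 2 * \<alpha>" 1 "real (Suc j)"] by (simp add: v_def)
    then show "norm (v j * y j) \<le> y j" for j
      by (simp add: y_def v_def abs_mult mult_left_le_one_le)
  qed
  have part: "(\<Sum>k\<le>m. (\<rho> k)\<^sup>2 * x k) \<le> c2\<^sup>2 * 6 powr (2 * \<alpha>) * (\<Sum>j. v j * y j)" for m
  proof -
    have \<rho>w: "(\<rho> k)\<^sup>2 \<le> c2\<^sup>2 * w k" for k
    proof -
      have "(1 + (real (Suc k))\<^sup>2) powr (- \<alpha> / 2) \<le> ((real (Suc k))\<^sup>2) powr (- \<alpha> / 2)"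
        using \<alpha> by (intro powr_mono2') auto
      also have "\<dots> = real (Suc k) powr (- \<alpha>)" by (simp add: powr_powr flip: powr_numeral)
      finally have "\<rho> k \<le> c2 * real (Suc k) powr (- \<alpha>)"
        using \<rho>(2)[of k] c2 by (meson mult_left_mono less_imp_le order_trans)
      then have "(\<rho> k)\<^sup>2 \<le> (c2 * real (Suc k) powr (- \<alpha>))\<^sup>2" using \<rho>(1) by (intro power_mono)
      also have "\<dots> = c2\<^sup>2 * w k" by (simp add: w_def power_mult_distrib power2_eq_square flip: powr_add)
      finally show ?thesis .
    qed
    have "(\<Sum>k\<le>m. (\<rho> k)\<^sup>2 * x k) \<le> (\<Sum>k\<le>m. c2\<^sup>2 * (w k * x k))"
      using mult_right_mono[OF \<rho>w] by (intro sum_mono) (simp add: x_def mult.assoc)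
    also have "\<dots> = c2\<^sup>2 * (\<Sum>k\<le>m. w k * x k)" by (simp add: sum_distrib_left)
    also have "(\<Sum>k\<le>m. w k * x k) \<le> (\<Sum>k\<le>m. w k * z k)"
    proof (rule antimono_weighted_sum_mono)
      show "antimono w" using \<alpha> by (intro antimonoI) (auto simp: w_def intro!: powr_mono2')
      show "(\<Sum>k\<le>m. x k) \<le> (\<Sum>k\<le>m. z k)" for m
        unfolding zsum x_def y_def
        by (rule onb_block_inequality[OF e \<phi>]) (auto simp: inner_commute intro: supp)
    qed (simp add: w_def)
    also have "\<dots> \<le> (\<Sum>k\<le>m. 6 powr (2 * \<alpha>) * z' k)" by (intro sum_mono wz)
    also have "\<dots> = 6 powr (2 * \<alpha>) * (\<Sum>j\<le>3 * m + 5. v j * y j)"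
      by (simp only: sum_distrib_left[symmetric] zsum')
    also have "(\<Sum>j\<le>3 * m + 5. v j * y j) \<le> (\<Sum>j. v j * y j)"
      by (rule sum_le_suminf[OF sumv]) (auto simp: v_def y_def)
    finally show ?thesis by (simp add: mult.assoc mult_left_mono)
  qed
  have "(\<lambda>n. \<Sum>k\<le>n. (\<rho> k)\<^sup>2 * x k) \<longlonglongrightarrow> (norm (G h))\<^sup>2"
    using gram_eigenbasis_norm_sums[OF e G eig, of h] unfolding sums_def_le by (simp add: x_def)
  then show ?thesis
    using part by (intro LIMSEQ_le_const2) (auto simp: v_def y_def)
qed

section \<open>Kolmogorov's maximal inequality\<close>

text \<open>The partial sum, frozen as soon as it has reached \<open>t\<close> in absolute value. It
  acts on a plain sequence, and the switch in front of \<open>x m\<close> reads only earlier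
  entries, so for independent variables it will be independent of the increment.\<close>

fun stopped_sum :: "real \<Rightarrow> nat \<Rightarrow> (nat \<Rightarrow> real) \<Rightarrow> real" where
  "stopped_sum t 0 x = 0"
| "stopped_sum t (Suc m) x =
     stopped_sum t m x + (if \<forall>k\<le>m. \<bar>\<Sum>i<k. x i\<bar> < t then 1 else 0) * x m"

lemma stopped_sum_cases:
  assumes "t > 0"
  shows "((\<forall>k\<le>m. \<bar>\<Sum>i<k. x i\<bar> < t) \<longrightarrow> stopped_sum t m x = (\<Sum>i<m. x i))
    \<and> ((\<exists>k\<le>m. t \<le> \<bar>\<Sum>i<k. x i\<bar>) \<longrightarrow> t \<le> \<bar>stopped_sum t m x\<bar>)"
proof (induction m)
  case (Suc m)
  show ?case
  proof (cases "\<forall>k\<le>m. \<bar>\<Sum>i<k. x i\<bar> < t")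
    case True
    then have "stopped_sum t (Suc m) x = (\<Sum>i<Suc m. x i)" using Suc by simp
    moreover have "t \<le> \<bar>\<Sum>i<Suc m. x i\<bar>" if "\<exists>k\<le>Suc m. t \<le> \<bar>\<Sum>i<k. x i\<bar>"
      using that True by (metis le_SucE not_le)
    ultimately show ?thesis by presburger
  next
    case False
    then have eq: "stopped_sum t (Suc m) x = stopped_sum t m x" by auto
    from False have "\<exists>k\<le>m. t \<le> \<bar>\<Sum>i<k. x i\<bar>" by (simp add: not_less)
    then have "t \<le> \<bar>stopped_sum t m x\<bar>" using Suc by blast
    moreover have "\<not> (\<forall>k\<le>Suc m. \<bar>\<Sum>i<k. x i\<bar> < t)" using False le_Suc_eq by blast
    ultimately show ?thesis unfolding eq by blast
  qed
qed (use assms in auto)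

lemma stopped_sum_cong: "(\<And>i. i < m \<Longrightarrow> x i = y i) \<Longrightarrow> stopped_sum t m x = stopped_sum t m y"
proof (induction m)
  case (Suc m)
  have "(\<Sum>i<k. x i) = (\<Sum>i<k. y i)" if "k \<le> m" for k
    using Suc.prems that by (intro sum.cong) auto
  then show ?case using Suc by simp
qed simp

text \<open>Stated on a finite product, since independence is applied to the vector of the first
  \<open>m\<close> variables and the next one.\<close>

lemma measurable_stopped_sum [measurable]:
  assumes "k \<le> m"
  shows "stopped_sum t k \<in> borel_measurable (PiM {..<m} (\<lambda>_. borel))"
  using assms
proof (induction k)
  case (Suc k)
  have [measurable]: "stopped_sum t k \<in> borel_measurable (PiM {..<m} (\<lambda>_. borel))" using Suc by simp
  have [measurable]: "(\<lambda>x. \<Sum>i<j. x i) \<in> borel_measurable (PiM {..<m} (\<lambda>_. borel :: real measure))" if "j \<le> k" for j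
    using Suc.prems that by (intro borel_measurable_sum measurable_component_singleton) auto
  have [measurable]: "(\<lambda>x. x k) \<in> borel_measurable (PiM {..<m} (\<lambda>_. borel :: real measure))"
    using Suc.prems by (intro measurable_component_singleton) auto
  have "Measurable.pred (PiM {..<m} (\<lambda>_. borel)) (\<lambda>x. \<forall>j\<in>{..k}. \<bar>\<Sum>i<j. x i\<bar> < t)"
    by (intro pred_intros_finite) auto
  then have [measurable]: "Measurable.pred (PiM {..<m} (\<lambda>_. borel)) (\<lambda>x. \<forall>j\<le>k. \<bar>\<Sum>i<j. x i\<bar> < t)"
    by (simp add: Ball_def)
  show ?case by simp
next
  case 0
  have "stopped_sum t 0 = (\<lambda>_. 0)" by auto
  then show ?case by simp
qed

text \<open>The cross term has mean 0: \<open>S * I\<close> is a function of the first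
  \<open>m\<close> variables, and \<open>X m\<close> is centered and independent of them. The square
  of the increment can only shrink under the switch.\<close>

lemma (in prob_space) stopped_sum_second_moment:
  fixes X :: "nat \<Rightarrow> 'a \<Rightarrow> real"
  assumes ind: "indep_vars (\<lambda>_. borel) X UNIV"
    and sq: "\<And>i. integrable M (\<lambda>\<omega>. (X i \<omega>)\<^sup>2)" and mean: "\<And>i. (\<integral>\<omega>. X i \<omega> \<partial>M) = 0"
  shows "integrable M (\<lambda>\<omega>. (stopped_sum t m (\<lambda>i. X i \<omega>))\<^sup>2) \<and>
    (\<integral>\<omega>. (stopped_sum t m (\<lambda>i. X i \<omega>))\<^sup>2 \<partial>M) \<le> (\<Sum>i<m. \<integral>\<omega>. (X i \<omega>)\<^sup>2 \<partial>M)"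
proof (induction m)
  case (Suc m)
  have rv[measurable]: "X i \<in> borel_measurable M" for i using ind by (simp add: indep_vars_def)
  define I where "I x = (if \<forall>k\<le>m. \<bar>\<Sum>i<k. x i\<bar> < t then 1 else 0 :: real)" for x :: "nat \<Rightarrow> real"
  define S where "S \<omega> = stopped_sum t m (\<lambda>i. X i \<omega>)" for \<omega>
  define f where "f x = stopped_sum t m x * I x" for x
  have Im: "I \<in> borel_measurable (PiM {..<m} (\<lambda>_. borel))"
  proof -
    have [measurable]: "(\<lambda>x. \<Sum>i<j. x i) \<in> borel_measurable (PiM {..<m} (\<lambda>_. borel :: real measure))" if "j \<le> m" for j
      using that by (intro borel_measurable_sum measurable_component_singleton) auto
    have "Measurable.pred (PiM {..<m} (\<lambda>_. borel)) (\<lambda>x. \<forall>j\<in>{..m}. \<bar>\<Sum>i<j. x i\<bar> < t)"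
      by (intro pred_intros_finite) auto
    then have [measurable]: "Measurable.pred (PiM {..<m} (\<lambda>_. borel)) (\<lambda>x. \<forall>j\<le>m. \<bar>\<Sum>i<j. x i\<bar> < t)"
      by (simp add: Ball_def)
    show ?thesis unfolding I_def[abs_def] by measurable
  qed
  have fm: "f \<in> borel_measurable (PiM {..<m} (\<lambda>_. borel))"
    unfolding f_def[abs_def] by (intro borel_measurable_times measurable_stopped_sum Im) simp
  have restr: "(\<lambda>\<omega>. restrict (\<lambda>i. X i \<omega>) A) \<in> measurable M (PiM A (\<lambda>_. borel))" for A
    by (intro measurable_restrict) simp
  have I_restr: "I (restrict x {..<m}) = I x" for x
  proof -
    have "(\<Sum>i<k. restrict x {..<m} i) = (\<Sum>i<k. x i)" if "k \<le> m" for k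
      using that by (intro sum.cong) auto
    then show ?thesis by (simp add: I_def cong: conj_cong)
  qed
  have S_restr: "stopped_sum t m (restrict x {..<m}) = stopped_sum t m x" for x
    by (rule stopped_sum_cong) simp
  have f_restr: "f (restrict (\<lambda>i. X i \<omega>) {..<m}) = S \<omega> * I (\<lambda>i. X i \<omega>)" for \<omega>
    by (simp add: f_def S_def S_restr I_restr)
  have Sm[measurable]: "S \<in> borel_measurable M"
    using measurable_compose[OF restr measurable_stopped_sum[OF order_refl, of t m]] by (simp add: S_restr S_def[abs_def])
  have IXm[measurable]: "(\<lambda>\<omega>. I (\<lambda>i. X i \<omega>)) \<in> borel_measurable M"
    using measurable_compose[OF restr Im] by (simp add: I_restr)
  have I01: "0 \<le> I x" "I x \<le> 1" "I x * I x = I x" for x by (auto simp: I_def)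
  have S2: "integrable M (\<lambda>\<omega>. (S \<omega>)\<^sup>2)" using Suc by (simp add: S_def)
  have S1: "integrable M S" by (rule square_integrable_imp_integrable[OF _ S2]) simp
  have X1: "integrable M (X m)" by (rule square_integrable_imp_integrable[OF _ sq]) simp
  have SI: "integrable M (\<lambda>\<omega>. S \<omega> * I (\<lambda>i. X i \<omega>))"
    by (rule Bochner_Integration.integrable_bound[OF S1])
      (use I01 in \<open>auto intro!: AE_I2 mult_left_le simp: abs_mult\<close>)
  have "indep_var borel (f \<circ> (\<lambda>\<omega>. restrict (\<lambda>i. X i \<omega>) {..<m}))
      borel ((\<lambda>x. x m) \<circ> (\<lambda>\<omega>. restrict (\<lambda>i. X i \<omega>) {m}))"
    by (rule indep_var_compose[OF indep_var_restrict[OF ind]]) (auto intro: fm measurable_component_singleton)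
  then have iv: "indep_var borel (\<lambda>\<omega>. S \<omega> * I (\<lambda>i. X i \<omega>)) borel (X m)"
    by (simp add: comp_def f_restr)
  have cross: "(\<integral>\<omega>. (S \<omega> * I (\<lambda>i. X i \<omega>)) * X m \<omega> \<partial>M) = 0"
    using indep_var_lebesgue_integral[OF iv SI X1] mean by simp
  have crossi: "integrable M (\<lambda>\<omega>. (S \<omega> * I (\<lambda>i. X i \<omega>)) * X m \<omega>)"
    by (rule indep_var_integrable[OF iv SI X1])
  have IX2: "integrable M (\<lambda>\<omega>. I (\<lambda>i. X i \<omega>) * (X m \<omega>)\<^sup>2)"
    by (rule Bochner_Integration.integrable_bound[OF sq[of m]])
      (use I01 in \<open>auto intro!: AE_I2 mult_left_le_one_le simp: abs_mult\<close>)
  have eq: "(stopped_sum t (Suc m) (\<lambda>i. X i \<omega>))\<^sup>2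
      = (S \<omega>)\<^sup>2 + 2 * ((S \<omega> * I (\<lambda>i. X i \<omega>)) * X m \<omega>) + I (\<lambda>i. X i \<omega>) * (X m \<omega>)\<^sup>2" for \<omega>
  proof -
    have "stopped_sum t (Suc m) (\<lambda>i. X i \<omega>) = S \<omega> + I (\<lambda>i. X i \<omega>) * X m \<omega>"
      by (simp add: S_def I_def)
    then have "(stopped_sum t (Suc m) (\<lambda>i. X i \<omega>))\<^sup>2
      = (S \<omega>)\<^sup>2 + 2 * ((S \<omega> * I (\<lambda>i. X i \<omega>)) * X m \<omega>) + (I (\<lambda>i. X i \<omega>) * I (\<lambda>i. X i \<omega>)) * (X m \<omega>)\<^sup>2"
      by (simp add: power2_eq_square algebra_simps)
    then show ?thesis by (simp only: I01)
  qed
  have "(\<integral>\<omega>. (stopped_sum t (Suc m) (\<lambda>i. X i \<omega>))\<^sup>2 \<partial>M)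
      = (\<integral>\<omega>. (S \<omega>)\<^sup>2 \<partial>M) + (\<integral>\<omega>. I (\<lambda>i. X i \<omega>) * (X m \<omega>)\<^sup>2 \<partial>M)"
    unfolding eq using S2 crossi IX2 cross by simp
  also have "(\<integral>\<omega>. I (\<lambda>i. X i \<omega>) * (X m \<omega>)\<^sup>2 \<partial>M) \<le> (\<integral>\<omega>. (X m \<omega>)\<^sup>2 \<partial>M)"
    by (intro integral_mono IX2 sq mult_left_le_one_le) (auto simp: I01)
  finally show ?case
    unfolding eq using S2 crossi IX2 Suc by (simp add: S_def[symmetric])
qed simp

lemma (in prob_space) kolmogorov_maximal_inequality:
  fixes X :: "nat \<Rightarrow> 'a \<Rightarrow> real"
  assumes ind: "indep_vars (\<lambda>_. borel) X UNIV"
    and sq: "\<And>i. integrable M (\<lambda>\<omega>. (X i \<omega>)\<^sup>2)" and mean: "\<And>i. (\<integral>\<omega>. X i \<omega> \<partial>M) = 0"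
    and t: "t > 0" and V: "\<And>m. (\<Sum>i<m. \<integral>\<omega>. (X i \<omega>)\<^sup>2 \<partial>M) \<le> V"
  shows "emeasure M {\<omega> \<in> space M. \<exists>k. t \<le> \<bar>\<Sum>i<k. X i \<omega>\<bar>} \<le> ennreal (V / t\<^sup>2)"
proof -
  have [measurable]: "X i \<in> borel_measurable M" for i using ind by (simp add: indep_vars_def)
  define B where "B m = {\<omega> \<in> space M. \<exists>k\<in>{..m}. t \<le> \<bar>\<Sum>i<k. X i \<omega>\<bar>}" for m
  have Bm[measurable]: "B m \<in> sets M" for m unfolding B_def by measurable
  have Bb: "emeasure M (B m) \<le> ennreal (V / t\<^sup>2)" for m
  proof -
    let ?S = "\<lambda>\<omega>. stopped_sum t m (\<lambda>i. X i \<omega>)"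
    note sm = stopped_sum_second_moment[OF ind sq mean, of t m]
    have "B m \<subseteq> {\<omega> \<in> space M. t\<^sup>2 \<le> (?S \<omega>)\<^sup>2}"
    proof
      fix \<omega> assume "\<omega> \<in> B m"
      then have "\<omega> \<in> space M" "t \<le> \<bar>?S \<omega>\<bar>"
        using stopped_sum_cases[OF t, of m "\<lambda>i. X i \<omega>"] by (auto simp: B_def)
      moreover from this have "t\<^sup>2 \<le> \<bar>?S \<omega>\<bar>\<^sup>2" using t by (intro power_mono) auto
      ultimately show "\<omega> \<in> {\<omega> \<in> space M. t\<^sup>2 \<le> (?S \<omega>)\<^sup>2}" by simp
    qed
    moreover have "{\<omega> \<in> space M. t\<^sup>2 \<le> (?S \<omega>)\<^sup>2} \<in> sets M"
    proof -
      have "(\<lambda>\<omega>. (?S \<omega>)\<^sup>2) \<in> borel_measurable M" using sm by blast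
      then show ?thesis by measurable
    qed
    ultimately have "measure M (B m) \<le> measure M {\<omega> \<in> space M. t\<^sup>2 \<le> (?S \<omega>)\<^sup>2}"
      by (rule finite_measure_mono)
    also have "\<dots> \<le> (\<integral>\<omega>. (?S \<omega>)\<^sup>2 \<partial>M) / t\<^sup>2"
      using sm t by (intro integral_Markov_inequality_measure[where A="space M"]) auto
    also have "\<dots> \<le> V / t\<^sup>2"
      using order_trans[OF conjunct2[OF sm] V[of m]] t by (intro divide_right_mono) auto
    finally show ?thesis by (simp add: emeasure_eq_measure ennreal_leI)
  qed
  have "incseq B" by (auto simp: incseq_def B_def intro: le_trans)
  then have "(\<lambda>m. emeasure M (B m)) \<longlonglongrightarrow> emeasure M (\<Union>m. B m)"
    by (intro Lim_emeasure_incseq) auto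
  then have "emeasure M (\<Union>m. B m) \<le> ennreal (V / t\<^sup>2)"
    by (rule LIMSEQ_le_const2) (use Bb in auto)
  moreover have "(\<Union>m. B m) = {\<omega> \<in> space M. \<exists>k. t \<le> \<bar>\<Sum>i<k. X i \<omega>\<bar>}"
    by (auto simp: B_def)
  ultimately show ?thesis by simp
qed

section \<open>Random series with independent Gaussian terms\<close>

text \<open>The pointwise form of the layer-cake bound E S \<le> \<Sum> P(S > l) over integers l
  \<ge> 0: the sum counts the integers below \<open>x\<close>, of which there are at least
  \<open>x\<close>.\<close>

lemma ennreal_le_suminf_indicator: "(x::ennreal) \<le> (\<Sum>l. indicator {l::nat. of_nat l < x} l)"
proof -
  have *: "of_nat n \<le> (\<Sum>l. indicator {l::nat. of_nat l < x} l :: ennreal)" if "\<And>l. l < n \<Longrightarrow> of_nat l < x" for n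
  proof -
    have "of_nat n = (\<Sum>l<n. indicator {l::nat. of_nat l < x} l :: ennreal)"
      using that by simp
    also have "\<dots> \<le> (\<Sum>l. indicator {l::nat. of_nat l < x} l)" by (intro sum_le_suminf) auto
    finally show ?thesis .
  qed
  show ?thesis
  proof (cases x)
    case (real r)
    have "of_nat l < x" if "l < nat \<lceil>r\<rceil>" for l
      using that real by (simp add: ennreal_of_nat_eq_real_of_nat ennreal_less_iff) linarith
    then have "of_nat (nat \<lceil>r\<rceil>) \<le> (\<Sum>l. indicator {l::nat. of_nat l < x} l :: ennreal)" by (rule *)
    moreover have "x \<le> of_nat (nat \<lceil>r\<rceil>)"
      using real by (simp add: ennreal_of_nat_eq_real_of_nat ennreal_leI)
    ultimately show ?thesis by (rule order_trans[rotated])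
  next
    case top
    then have "of_nat n \<le> (\<Sum>l. indicator {l::nat. of_nat l < x} l :: ennreal)" for n
      by (intro *) (simp add: of_nat_less_top)
    then have "(\<Sum>l. indicator {l::nat. of_nat l < x} l :: ennreal) = top"
      by (metis ennreal_Ex_less_of_nat linorder_not_less top.not_eq_extremum)
    then show ?thesis by simp
  qed
qed

lemma centered_gaussian_process_scale:
  assumes X: "centered_gaussian_process P X K"
  shows "centered_gaussian_process P (\<lambda>i \<omega>. a i * X i \<omega>) (\<lambda>i k. a i * a k * K i k)"
proof -
  have "gaussian_rv P (\<lambda>\<omega>. \<Sum>i\<in>J. c i * (a i * X i \<omega>))" if "finite J" for J c
  proof -
    have "gaussian_rv P (\<lambda>\<omega>. \<Sum>i\<in>J. (c i * a i) * X i \<omega>)"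
      using X that by (simp add: centered_gaussian_process_def jointly_gaussian_def)
    then show ?thesis by (simp add: mult.assoc)
  qed
  moreover have "(\<integral>\<omega>. a i * X i \<omega> * (a k * X k \<omega>) \<partial>P) = a i * a k * K i k" for i k
  proof -
    have "(\<integral>\<omega>. a i * X i \<omega> * (a k * X k \<omega>) \<partial>P) = (\<integral>\<omega>. (a i * a k) * (X i \<omega> * X k \<omega>) \<partial>P)"
      by (simp add: mult_ac)
    then show ?thesis using X by (simp add: centered_gaussian_process_def)
  qed
  ultimately show ?thesis
    using X by (simp add: centered_gaussian_process_def jointly_gaussian_def)
qed

context
  fixes P :: "'w measure" and X :: "nat \<Rightarrow> 'w \<Rightarrow> real" and K :: "nat \<Rightarrow> nat \<Rightarrow> real"
  assumes X: "centered_gaussian_process P X K"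
    and K: "\<And>i k. i \<noteq> k \<Longrightarrow> K i k = 0"
begin

lemma gaussian_maximal_inequality:
  assumes t: "t > 0" and V: "\<And>m. (\<Sum>i<m. K i i) \<le> V"
  shows "emeasure P {\<omega> \<in> space P. \<exists>k. t \<le> \<bar>\<Sum>i<k. X i \<omega>\<bar>} \<le> ennreal (V / t\<^sup>2)"
proof -
  interpret prob_space P using X by (simp add: centered_gaussian_process_def)
  note comp = centered_gaussian_process_component[OF X]
  show ?thesis
  proof (rule kolmogorov_maximal_inequality[OF centered_gaussian_process_indep[OF X K]])
    show "(\<integral>\<omega>. X i \<omega> \<partial>P) = 0" for i using X by (simp add: centered_gaussian_process_def)
  qed (use t V centered_normal_square_integrable[OF comp] in auto)
qed

text \<open>Kolmogorov's one-series theorem. Started at \<open>N\<close>, the series ever reaches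
  \<open>t\<close> with probability at most the variance tail over t^2, which tends to 0; hence
  almost surely some \<open>N\<close> is good for \<open>t\<close>. Taking t = 1 / (j + 1) for all
  \<open>j\<close> gives the Cauchy property.\<close>

lemma gaussian_series_convergent:
  assumes "summable (\<lambda>i. K i i)"
  shows "AE \<omega> in P. summable (\<lambda>i. X i \<omega>)"
proof -
  interpret prob_space P using X by (simp add: centered_gaussian_process_def)
  note comp = centered_gaussian_process_component[OF X]
  have [measurable]: "X i \<in> borel_measurable P" for i by (rule centered_normal_measurable[OF comp])
  have K0: "0 \<le> K i i" for i by (rule centered_normal_nonneg[OF comp])
  have "AE \<omega> in P. \<exists>N. \<forall>k. \<bar>\<Sum>i<k. X (i + N) \<omega>\<bar> < t" if t: "t > 0" for t :: real
  proof -
    define B where "B N = {\<omega> \<in> space P. \<exists>k. t \<le> \<bar>\<Sum>i<k. X (i + N) \<omega>\<bar>}" for N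
    have [measurable]: "B N \<in> sets P" for N unfolding B_def by measurable
    have Bb: "emeasure P (B N) \<le> ennreal ((\<Sum>i. K (i + N) (i + N)) / t\<^sup>2)" for N
      unfolding B_def
    proof (rule kolmogorov_maximal_inequality[OF _ _ _ t])
      show "indep_vars (\<lambda>_. borel) (\<lambda>i. X (i + N)) UNIV"
        by (rule centered_gaussian_process_indep[OF centered_gaussian_process_reindex[OF X]]) (simp add: K)
      show "(\<integral>\<omega>. X (i + N) \<omega> \<partial>P) = 0" for i using X by (simp add: centered_gaussian_process_def)
      show "(\<Sum>i<m. \<integral>\<omega>. (X (i + N) \<omega>)\<^sup>2 \<partial>P) \<le> (\<Sum>i. K (i + N) (i + N))" for m
        unfolding centered_normal_square_integrable(2)[OF comp]
        using summable_ignore_initial_segment[OF assms, of N] by (intro sum_le_suminf) (auto simp: K0)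
    qed (use centered_normal_square_integrable[OF comp] in auto)
    have lim: "(\<lambda>N. ennreal ((\<Sum>i. K (i + N) (i + N)) / t\<^sup>2)) \<longlonglongrightarrow> ennreal (0 / t\<^sup>2)"
      using suminf_exist_split2[OF assms] t by (intro tendsto_ennrealI tendsto_divide tendsto_const) auto
    have "emeasure P (\<Inter>N. B N) \<le> ennreal (0 / t\<^sup>2)"
    proof (rule LIMSEQ_le_const[OF lim], intro exI allI impI)
      fix N
      have "emeasure P (\<Inter>N. B N) \<le> emeasure P (B N)" by (intro emeasure_mono) auto
      then show "emeasure P (\<Inter>N. B N) \<le> ennreal ((\<Sum>i. K (i + N) (i + N)) / t\<^sup>2)"
        using Bb[of N] by (rule order_trans)
    qed
    then have "(\<Inter>N. B N) \<in> null_sets P" by (intro null_setsI) auto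
    then show ?thesis
      by (rule AE_I') (auto simp: B_def not_less)
  qed
  then have "AE \<omega> in P. \<forall>j. \<exists>N. \<forall>k. \<bar>\<Sum>i<k. X (i + N) \<omega>\<bar> < inverse (real (Suc j))"
    unfolding AE_all_countable by auto
  then show ?thesis
  proof (rule AE_mp, intro AE_I2 impI)
    fix \<omega> assume *: "\<forall>j. \<exists>N. \<forall>k. \<bar>\<Sum>i<k. X (i + N) \<omega>\<bar> < inverse (real (Suc j))"
    show "summable (\<lambda>i. X i \<omega>)"
      unfolding summable_Cauchy
    proof (intro allI impI)
      fix e :: real assume "0 < e"
      then obtain j where j: "inverse (real (Suc j)) < e / 2" using reals_Archimedean[of "e / 2"] by auto
      from * obtain N where N: "\<And>k. \<bar>\<Sum>i<k. X (i + N) \<omega>\<bar> < inverse (real (Suc j))" by blast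
      have sh: "(\<Sum>i=N..<N + k. X i \<omega>) = (\<Sum>i<k. X (i + N) \<omega>)" for k
        by (simp add: sum.atLeastLessThan_shift_0[of _ N "N + k"] atLeast0LessThan comp_def add.commute)
      show "\<exists>N. \<forall>m\<ge>N. \<forall>n. norm (\<Sum>i=m..<n. X i \<omega>) < e"
      proof (intro exI allI impI)
        fix m n assume m: "N \<le> m"
        show "norm (\<Sum>i=m..<n. X i \<omega>) < e"
        proof (cases "m \<le> n")
          case True
          have "(\<Sum>i=m..<n. X i \<omega>) = (\<Sum>i<n - N. X (i + N) \<omega>) - (\<Sum>i<m - N. X (i + N) \<omega>)"
            using sh[of "n - N"] sh[of "m - N"] m True sum_diff_nat_ivl[of N m n "\<lambda>i. X i \<omega>"] by simp
          then show ?thesis using N[of "n - N"] N[of "m - N"] j by (simp add: abs_if split: if_splits)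
        qed (use \<open>0 < e\<close> in simp)
      qed
    qed
  qed
qed

text \<open>By the maximal inequality the supremum exceeds an integer l \<ge> 1 with probability at
  most V / l^2. Summing over l, with the trivial bound 1 at l = 0, bounds the mean.\<close>

lemma gaussian_series_expected_supremum:
  assumes V: "\<And>m. (\<Sum>i<m. K i i) \<le> V"
  shows "(\<integral>\<^sup>+\<omega>. (SUP m. ennreal \<bar>\<Sum>i<m. X i \<omega>\<bar>) \<partial>P)
    \<le> ennreal (1 + V * (\<Sum>l. 1 / (real (Suc l))\<^sup>2))"
proof -
  interpret prob_space P using X by (simp add: centered_gaussian_process_def)
  note comp = centered_gaussian_process_component[OF X]
  have [measurable]: "X i \<in> borel_measurable P" for i by (rule centered_normal_measurable[OF comp])
  have V0: "0 \<le> V" using V[of 0] by simp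
  define S where "S \<omega> = (SUP m. ennreal \<bar>\<Sum>i<m. X i \<omega>\<bar>)" for \<omega>
  have [measurable]: "S \<in> borel_measurable P" unfolding S_def[abs_def] by measurable
  define B where "B l = {\<omega> \<in> space P. of_nat l < S \<omega>}" for l :: nat
  have [measurable]: "B l \<in> sets P" for l unfolding B_def by measurable
  have Bb: "emeasure P (B (Suc l)) \<le> ennreal (V * (1 / (real (Suc l))\<^sup>2))" for l
  proof -
    have "B (Suc l) \<subseteq> {\<omega> \<in> space P. \<exists>k. real (Suc l) \<le> \<bar>\<Sum>i<k. X i \<omega>\<bar>}"
    proof
      fix \<omega> assume "\<omega> \<in> B (Suc l)"
      then have "\<omega> \<in> space P" "of_nat (Suc l) < S \<omega>" unfolding B_def by blast+
      moreover from this(2) obtain k where "of_nat (Suc l) < ennreal \<bar>\<Sum>i<k. X i \<omega>\<bar>"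
        unfolding S_def less_SUP_iff by blast
      then have "real (Suc l) \<le> \<bar>\<Sum>i<k. X i \<omega>\<bar>"
        unfolding ennreal_of_nat_eq_real_of_nat by (subst (asm) ennreal_less_iff) auto
      ultimately show "\<omega> \<in> {\<omega> \<in> space P. \<exists>k. real (Suc l) \<le> \<bar>\<Sum>i<k. X i \<omega>\<bar>}" by blast
    qed
    then have "emeasure P (B (Suc l)) \<le> emeasure P {\<omega> \<in> space P. \<exists>k. real (Suc l) \<le> \<bar>\<Sum>i<k. X i \<omega>\<bar>}"
      by (intro emeasure_mono) measurable
    also have "\<dots> \<le> ennreal (V / (real (Suc l))\<^sup>2)" by (rule gaussian_maximal_inequality) (use V in auto)
    finally show ?thesis by simp
  qed
  have sm: "summable (\<lambda>l. V * (1 / (real (Suc l))\<^sup>2))"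
    by (intro summable_mult) (use inverse_power_summable[of 2, where 'a=real, THEN summable_Suc_iff[THEN iffD2]] in \<open>simp add: inverse_eq_divide\<close>)
  have "(\<integral>\<^sup>+\<omega>. S \<omega> \<partial>P) \<le> (\<integral>\<^sup>+\<omega>. (\<Sum>l. indicator (B l) \<omega>) \<partial>P)"
  proof (intro nn_integral_mono)
    fix \<omega> assume "\<omega> \<in> space P"
    then show "S \<omega> \<le> (\<Sum>l. indicator (B l) \<omega>)"
      using ennreal_le_suminf_indicator[of "S \<omega>"] by (simp add: B_def indicator_def)
  qed
  also have "\<dots> = (\<Sum>l. emeasure P (B l))" by (simp add: nn_integral_suminf)
  also have "\<dots> = emeasure P (B 0) + (\<Sum>l. emeasure P (B (Suc l)))"
    using suminf_offset[of "\<lambda>l. emeasure P (B l)" 1] by (simp add: summableI add.commute)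
  also have "\<dots> \<le> 1 + (\<Sum>l. ennreal (V * (1 / (real (Suc l))\<^sup>2)))"
    by (intro add_mono suminf_le Bb summableI) (simp_all add: emeasure_le_1)
  also have "(\<Sum>l. ennreal (V * (1 / (real (Suc l))\<^sup>2))) = ennreal (\<Sum>l. V * (1 / (real (Suc l))\<^sup>2))"
    using V0 sm by (intro suminf_ennreal_eq) auto
  also have "(\<Sum>l. V * (1 / (real (Suc l))\<^sup>2)) = V * (\<Sum>l. 1 / (real (Suc l))\<^sup>2)"
    using inverse_power_summable[of 2, where 'a=real, THEN summable_Suc_iff[THEN iffD2]]
    by (intro suminf_mult) (simp add: inverse_eq_divide)
  also have "1 + ennreal (V * (\<Sum>l. 1 / (real (Suc l))\<^sup>2)) = ennreal (1 + V * (\<Sum>l. 1 / (real (Suc l))\<^sup>2))"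
  proof -
    have "0 \<le> (\<Sum>l. 1 / (real (Suc l))\<^sup>2)"
      using inverse_power_summable[of 2, where 'a=real, THEN summable_Suc_iff[THEN iffD2]]
      by (intro suminf_nonneg) (simp_all add: inverse_eq_divide)
    then show ?thesis using V0 by simp
  qed
  finally show ?thesis by (simp add: S_def)
qed

text \<open>Independence factorises the exponential moment; the range of \<open>t\<close> is limited
  by the largest variance in the block.\<close>

lemma gaussian_exp_square_sum:
  assumes F: "finite F" and t: "0 \<le> t" "\<And>i. i \<in> F \<Longrightarrow> 4 * t * K i i \<le> 1"
  shows "(\<integral>\<^sup>+\<omega>. ennreal (exp (t * (\<Sum>i\<in>F. (X i \<omega>)\<^sup>2))) \<partial>P) \<le> ennreal (exp (2 * t * (\<Sum>i\<in>F. K i i)))"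
proof -
  interpret prob_space P using X by (simp add: centered_gaussian_process_def)
  note comp = centered_gaussian_process_component[OF X]
  have "indep_vars (\<lambda>_. borel) (\<lambda>i \<omega>. ennreal (exp (t * (X i \<omega>)\<^sup>2))) F"
    by (rule indep_vars_compose2[OF indep_vars_subset[OF centered_gaussian_process_indep[OF X K]]]) auto
  then have "(\<integral>\<^sup>+\<omega>. (\<Prod>i\<in>F. ennreal (exp (t * (X i \<omega>)\<^sup>2))) \<partial>P) = (\<Prod>i\<in>F. \<integral>\<^sup>+\<omega>. ennreal (exp (t * (X i \<omega>)\<^sup>2)) \<partial>P)"
    using F by (intro indep_vars_nn_integral) auto
  also have "\<dots> \<le> (\<Prod>i\<in>F. ennreal (exp (2 * t * K i i)))"
    using F t(2)
  proof (induction F rule: finite_induct)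
    case (insert i F)
    then show ?case
      using centered_normal_exp_square[OF comp t(1), of i] by (simp add: mult_mono)
  qed simp
  also have "\<dots> = ennreal (exp (2 * t * (\<Sum>i\<in>F. K i i)))"
    using F by (simp add: prod_ennreal exp_sum sum_distrib_left)
  finally show ?thesis
    using F by (simp add: prod_ennreal exp_sum sum_distrib_left)
qed

end

text \<open>Fatou's lemma gives the upper bound directly, without identifying the law of the
  limit.\<close>

lemma nn_integral_exp_convergent_gaussian_le:
  assumes S: "\<And>m. centered_normal P (S m) (v m)" and v: "\<And>m. v m \<le> V"
    and lim: "AE \<omega> in P. (\<lambda>m. S m \<omega>) \<longlonglongrightarrow> X \<omega>"
  shows "(\<integral>\<^sup>+\<omega>. ennreal (exp (t * X \<omega>)) \<partial>P) \<le> ennreal (exp (t\<^sup>2 * V / 2))"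
proof -
  have [measurable]: "S m \<in> borel_measurable P" for m by (rule centered_normal_measurable[OF S])
  have "(\<integral>\<^sup>+\<omega>. ennreal (exp (t * X \<omega>)) \<partial>P) = (\<integral>\<^sup>+\<omega>. liminf (\<lambda>m. ennreal (exp (t * S m \<omega>))) \<partial>P)"
  proof (rule nn_integral_cong_AE, use lim in eventually_elim)
    fix \<omega> assume "(\<lambda>m. S m \<omega>) \<longlonglongrightarrow> X \<omega>"
    then have "(\<lambda>m. ennreal (exp (t * S m \<omega>))) \<longlonglongrightarrow> ennreal (exp (t * X \<omega>))"
      by (intro tendsto_ennrealI tendsto_exp tendsto_mult tendsto_const)
    then show "ennreal (exp (t * X \<omega>)) = liminf (\<lambda>m. ennreal (exp (t * S m \<omega>)))"
      by (intro lim_imp_Liminf[symmetric]) simp_all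
  qed
  also have "\<dots> \<le> liminf (\<lambda>m. \<integral>\<^sup>+\<omega>. ennreal (exp (t * S m \<omega>)) \<partial>P)"
    by (rule nn_integral_liminf) measurable
  also have "\<dots> \<le> ennreal (exp (t\<^sup>2 * V / 2))"
    using v by (intro Liminf_le always_eventually allI)
      (auto simp: centered_normal_mgf[OF S] intro!: ennreal_leI mult_left_mono)
  finally show ?thesis .
qed

lemma ennreal_tendsto_0I:
  fixes f :: "nat \<Rightarrow> ennreal"
  assumes "\<And>\<epsilon>. \<epsilon> > 0 \<Longrightarrow> \<exists>N. \<forall>n\<ge>N. f n \<le> ennreal \<epsilon>"
  shows "f \<longlonglongrightarrow> 0"
proof (rule order_tendstoI)
  fix a :: ennreal assume "0 < a"
  have "\<exists>\<epsilon>>0. ennreal \<epsilon> < a"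
  proof (cases a)
    case (real r)
    then show ?thesis using \<open>0 < a\<close> by (intro exI[of _ "r / 2"]) (auto simp: ennreal_less_iff)
  next
    case top
    then show ?thesis by (intro exI[of _ 1]) simp
  qed
  then obtain \<epsilon> where e: "0 < \<epsilon>" "ennreal \<epsilon> < a" by blast
  from assms[OF e(1)] obtain N where N: "\<forall>n\<ge>N. f n \<le> ennreal \<epsilon>" by blast
  show "\<forall>\<^sub>F n in sequentially. f n < a"
    using eventually_ge_at_top[of N] by eventually_elim (use N e in \<open>auto intro: le_less_trans\<close>)
qed simp

section \<open>Linearity of the formal pairing where its series converge\<close>

lemma pairing_sums:
  "summable (\<lambda>i. y i * (x \<bullet> b i)) \<Longrightarrow> (\<lambda>i. y i * (x \<bullet> b i)) sums pairing b y x"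
  unfolding pairing_def by (rule summable_sums)

lemma pairing_diff_right:
  assumes "summable (\<lambda>i. y i * (x \<bullet> b i))" "summable (\<lambda>i. y i * (x' \<bullet> b i))"
  shows "summable (\<lambda>i. y i * ((x - x') \<bullet> b i))" "pairing b y (x - x') = pairing b y x - pairing b y x'"
  using sums_diff[OF assms[THEN pairing_sums]]
  by (auto simp: inner_diff_left right_diff_distrib sums_iff pairing_def)

lemma pairing_add_left:
  assumes "summable (\<lambda>i. y i * (x \<bullet> b i))" "summable (\<lambda>i. y' i * (x \<bullet> b i))"
  shows "summable (\<lambda>i. (y i + y' i) * (x \<bullet> b i))"
    "pairing b (\<lambda>i. y i + y' i) x = pairing b y x + pairing b y' x"
  using sums_add[OF assms[THEN pairing_sums]] by (auto simp: distrib_right sums_iff pairing_def)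

lemma pairing_scale_left:
  assumes "summable (\<lambda>i. y i * (x \<bullet> b i))"
  shows "summable (\<lambda>i. (a * y i) * (x \<bullet> b i))" "pairing b (\<lambda>i. a * y i) x = a * pairing b y x"
  using sums_mult[OF pairing_sums[OF assms], of a] by (auto simp: mult.assoc sums_iff pairing_def)

lemma pairing_sum_right:
  assumes "finite F" "\<And>k. k \<in> F \<Longrightarrow> summable (\<lambda>i. y i * (x k \<bullet> b i))"
  shows "summable (\<lambda>i. y i * ((\<Sum>k\<in>F. c k *\<^sub>R x k) \<bullet> b i)) \<and>
    pairing b y (\<Sum>k\<in>F. c k *\<^sub>R x k) = (\<Sum>k\<in>F. c k * pairing b y (x k))"
proof -
  have "(\<lambda>i. \<Sum>k\<in>F. c k * (y i * (x k \<bullet> b i))) sums (\<Sum>k\<in>F. c k * pairing b y (x k))"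
    using assms by (intro sums_sum sums_mult pairing_sums) auto
  moreover have "(\<Sum>k\<in>F. c k * (y i * (x k \<bullet> b i))) = y i * ((\<Sum>k\<in>F. c k *\<^sub>R x k) \<bullet> b i)" for i
    by (simp add: inner_sum_left sum_distrib_left mult_ac)
  ultimately show ?thesis by (simp add: sums_iff pairing_def)
qed

lemma measurable_summable [measurable]:
  fixes f :: "nat \<Rightarrow> 'a \<Rightarrow> real"
  assumes [measurable]: "\<And>i. f i \<in> borel_measurable M"
  shows "Measurable.pred M (\<lambda>x. summable (\<lambda>i. f i x))"
  unfolding summable_iff_convergent Cauchy_convergent_iff[symmetric] pred_def by measurable

section \<open>White noise\<close>

locale white_noise_basis =
  fixes P :: "'w measure" and \<eta> :: "'b::{real_inner, complete_space, second_countable_topology} \<Rightarrow> 'w \<Rightarrow> real"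
    and b :: "nat \<Rightarrow> 'b"
  assumes noise: "white_noise P \<eta>" and b: "orthonormal_basis_on UNIV b"
begin

lemma noise_process: "centered_gaussian_process P \<eta> (\<bullet>)"
  using noise by (simp add: white_noise_def)

sublocale P: prob_space P
  using noise_process by (simp add: centered_gaussian_process_def)

lemma noise_measurable [measurable]: "\<eta> x \<in> borel_measurable P"
  by (rule centered_normal_measurable[OF centered_gaussian_process_component[OF noise_process]])

lemma noise_normal: "centered_normal P (\<eta> x) ((norm x)\<^sup>2)"
  using centered_gaussian_process_component[OF noise_process, of x] by (simp add: power2_norm_eq_inner)

lemma noise_linear_combination:
  assumes J: "finite J"
  shows "centered_normal P (\<lambda>\<omega>. \<Sum>i\<in>J. c i * \<eta> (f i) \<omega>) ((norm (\<Sum>i\<in>J. c i *\<^sub>R f i))\<^sup>2)"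
proof -
  have "(norm (\<Sum>i\<in>J. c i *\<^sub>R f i))\<^sup>2 = (\<Sum>i\<in>J. \<Sum>k\<in>J. c i * c k * (f i \<bullet> f k))"
    unfolding power2_norm_eq_inner
    by (subst inner_sum_left, intro sum.cong refl) (simp add: inner_sum_right sum_distrib_left mult_ac)
  then show ?thesis
    using centered_gaussian_process_linear_combination[OF centered_gaussian_process_reindex[OF noise_process, of f] J, of c]
    by simp
qed

abbreviation noise_coords :: "'w \<Rightarrow> nat \<Rightarrow> real" where
  "noise_coords \<omega> \<equiv> \<lambda>i. \<eta> (b i) \<omega>"

lemma noise_terms_process:
  "centered_gaussian_process P (\<lambda>i \<omega>. (x \<bullet> b i) * \<eta> (b i) \<omega>) (\<lambda>i k. (x \<bullet> b i) * (x \<bullet> b k) * (b i \<bullet> b k))"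
  by (rule centered_gaussian_process_scale[OF centered_gaussian_process_reindex[OF noise_process]])

lemma noise_terms_uncorrelated: "i \<noteq> k \<Longrightarrow> (x \<bullet> b i) * (x \<bullet> b k) * (b i \<bullet> b k) = 0"
  by (simp add: onb_inner[OF b])

lemma noise_pairing_summable: "AE \<omega> in P. summable (\<lambda>i. noise_coords \<omega> i * (x \<bullet> b i))"
proof -
  have "summable (\<lambda>i. (x \<bullet> b i) * (x \<bullet> b i) * (b i \<bullet> b i))"
    using onb_parseval_norm[OF b, of x] by (simp add: onb_inner[OF b] sums_iff power2_eq_square)
  from gaussian_series_convergent[OF noise_terms_process noise_terms_uncorrelated this]
  show ?thesis by (simp add: mult.commute)
qed

lemma noise_expected_supremum:
  "(\<integral>\<^sup>+\<omega>. (SUP m. ennreal \<bar>\<Sum>i<m. noise_coords \<omega> i * (x \<bullet> b i)\<bar>) \<partial>P)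
    \<le> ennreal (1 + (norm x)\<^sup>2 * (\<Sum>l. 1 / (real (Suc l))\<^sup>2))"
proof -
  have "(\<Sum>i<m. (x \<bullet> b i) * (x \<bullet> b i) * (b i \<bullet> b i)) \<le> (norm x)\<^sup>2" for m
    using onb_bessel[OF b, of "{..<m}" x] by (simp add: onb_inner[OF b] power2_eq_square)
  from gaussian_series_expected_supremum[OF noise_terms_process noise_terms_uncorrelated this]
  show ?thesis by (simp add: mult.commute)
qed

text \<open>White noise is only a family of random variables, whose linearity is hidden in the
  covariance. It makes \<open>\<eta> x\<close> minus the m-th partial sum a Gaussian with variance
  \<open>(norm (p m))\<^sup>2\<close>; this tends to 0, and Fatou's lemma transfers it to the limit
  of the series.\<close>

lemma noise_pairing_eq: "AE \<omega> in P. pairing b (noise_coords \<omega>) x = \<eta> x \<omega>"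
proof -
  define S where "S m \<omega> = (\<Sum>i<m. noise_coords \<omega> i * (x \<bullet> b i))" for m \<omega>
  have [measurable]: "S m \<in> borel_measurable P" for m unfolding S_def[abs_def] by measurable
  define p where "p m = x - (\<Sum>i<m. (x \<bullet> b i) *\<^sub>R b i)" for m
  have diff: "centered_normal P (\<lambda>\<omega>. \<eta> x \<omega> - S m \<omega>) ((norm (p m))\<^sup>2)" for m
  proof -
    \<comment> \<open>One linear combination of noise variables holds both \<open>\<eta> x\<close>
      and the coordinates: index 0 stands for \<open>x\<close>, index \<open>Suc k\<close> for
      \<open>b k\<close>.\<close>
    let ?c = "\<lambda>i. case i of 0 \<Rightarrow> 1 | Suc k \<Rightarrow> - (x \<bullet> b k)" and ?f = "\<lambda>i. case i of 0 \<Rightarrow> x | Suc k \<Rightarrow> b k"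
    have "(\<Sum>i<Suc m. ?c i * \<eta> (?f i) \<omega>) = \<eta> x \<omega> - S m \<omega>" for \<omega>
      by (subst sum.lessThan_Suc_shift) (simp add: S_def sum_negf mult.commute)
    moreover have "(\<Sum>i<Suc m. ?c i *\<^sub>R ?f i) = p m"
      by (subst sum.lessThan_Suc_shift) (simp add: p_def sum_negf)
    ultimately show ?thesis
      using noise_linear_combination[of "{..<Suc m}" ?c ?f] by simp
  qed
  have "p \<longlonglongrightarrow> x - x"
    using onb_expansion[OF b, of x] unfolding p_def sums_def by (intro tendsto_diff tendsto_const)
  then have "(\<lambda>m. ennreal ((norm (p m))\<^sup>2)) \<longlonglongrightarrow> ennreal ((norm (x - x))\<^sup>2)"
    by (intro tendsto_ennrealI tendsto_power tendsto_norm)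
  then have p0: "(\<lambda>m. ennreal ((norm (p m))\<^sup>2)) \<longlonglongrightarrow> 0" by simp
  have "(\<integral>\<^sup>+\<omega>. ennreal ((\<eta> x \<omega> - pairing b (noise_coords \<omega>) x)\<^sup>2) \<partial>P)
      = (\<integral>\<^sup>+\<omega>. liminf (\<lambda>m. ennreal ((\<eta> x \<omega> - S m \<omega>)\<^sup>2)) \<partial>P)"
  proof (rule nn_integral_cong_AE, use noise_pairing_summable[of x] in eventually_elim)
    fix \<omega> assume "summable (\<lambda>i. noise_coords \<omega> i * (x \<bullet> b i))"
    from pairing_sums[OF this] have "(\<lambda>m. S m \<omega>) \<longlonglongrightarrow> pairing b (noise_coords \<omega>) x"
      by (simp add: sums_def S_def)
    then have "(\<lambda>m. ennreal ((\<eta> x \<omega> - S m \<omega>)\<^sup>2)) \<longlonglongrightarrow> ennreal ((\<eta> x \<omega> - pairing b (noise_coords \<omega>) x)\<^sup>2)"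
      by (intro tendsto_ennrealI tendsto_power tendsto_diff tendsto_const)
    then show "ennreal ((\<eta> x \<omega> - pairing b (noise_coords \<omega>) x)\<^sup>2) = liminf (\<lambda>m. ennreal ((\<eta> x \<omega> - S m \<omega>)\<^sup>2))"
      by (intro lim_imp_Liminf[symmetric]) simp_all
  qed
  also have "\<dots> \<le> liminf (\<lambda>m. \<integral>\<^sup>+\<omega>. ennreal ((\<eta> x \<omega> - S m \<omega>)\<^sup>2) \<partial>P)"
    by (rule nn_integral_liminf) measurable
  also have "\<dots> = 0"
    unfolding centered_normal_second_moment[OF diff] by (rule lim_imp_Liminf[OF _ p0]) simp
  finally have "(\<integral>\<^sup>+\<omega>. ennreal ((\<eta> x \<omega> - pairing b (noise_coords \<omega>) x)\<^sup>2) \<partial>P) = 0" by simp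
  then have "AE \<omega> in P. ennreal ((\<eta> x \<omega> - pairing b (noise_coords \<omega>) x)\<^sup>2) = 0"
    by (subst (asm) nn_integral_0_iff_AE) (auto simp: pairing_def)
  then show ?thesis by eventually_elim auto
qed

lemma noise_pairing_normal: "centered_normal P (\<lambda>\<omega>. pairing b (noise_coords \<omega>) x) ((norm x)\<^sup>2)"
proof -
  have [measurable]: "(\<lambda>\<omega>. pairing b (noise_coords \<omega>) x) \<in> borel_measurable P"
    unfolding pairing_def by measurable
  show ?thesis
  proof (cases "norm x = 0")
    case True
    then show ?thesis using noise_normal[of x] noise_pairing_eq[of x]
      by (auto simp: centered_normal_def pairing_def)
  next
    case False
    then have "distributed P lborel (\<eta> x) (normal_density 0 (sqrt ((norm x)\<^sup>2)))"
      using noise_normal[of x] by (simp add: centered_normal_def)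
    moreover have "distr P lborel (\<lambda>\<omega>. pairing b (noise_coords \<omega>) x) = distr P lborel (\<eta> x)"
      by (rule distr_cong_AE) (use noise_pairing_eq[of x] in auto)
    ultimately show ?thesis using False P.prob_space_axioms
      by (simp add: centered_normal_def distributed_def)
  qed
qed

end

section \<open>Gaussian linear regression and well-posedness\<close>

text \<open>A single sample size is treated at a time; \<open>m0\<close> is its prior.\<close>

locale gaussian_regression = white_noise_basis P \<eta> b
  for P :: "'w measure" and \<eta> :: "'b::{real_inner, complete_space, second_countable_topology} \<Rightarrow> 'w \<Rightarrow> real"
    and b :: "nat \<Rightarrow> 'b" +
  fixes G :: "'a::{real_inner, complete_space, second_countable_topology} \<Rightarrow> 'b"
    and m0 :: "'a measure"
  assumes G: "bounded_linear G"
    and adj: "\<And>x y. G x \<bullet> y = x \<bullet> adjoint G y"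
    and m0_prob: "prob_space m0"
    and m0_sets: "sets m0 = sets borel"
    and m0_gauss: "\<And>h. \<exists>v. centered_normal m0 (\<lambda>u. u \<bullet> h) v"
    and m0_moment: "(\<integral>\<^sup>+u. ennreal ((norm u)\<^sup>2) \<partial>m0) < \<infinity>"
begin

sublocale m0: prob_space m0 by (rule m0_prob)
sublocale G: bounded_linear G by (rule G)
sublocale pair_sigma_finite m0 P ..

declare m0_sets [measurable_cong]

lemma space_m0 [simp]: "space m0 = UNIV"
  using sets_eq_imp_space_eq[OF m0_sets] by simp

lemma emeasure_m0_UNIV [simp]: "emeasure m0 UNIV = 1"
  using m0.emeasure_space_1 by simp

lemma G_measurable [measurable]: "G \<in> borel_measurable borel"
  by (intro borel_measurable_continuous_onI linear_continuous_on G)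

section \<open>A Banach space of data adapted to the prior\<close>

definition partial_pairing :: "(nat \<Rightarrow> real) \<Rightarrow> nat \<Rightarrow> 'a \<Rightarrow> real" where
  "partial_pairing y m u = (\<Sum>i<m. y i * (G u \<bullet> b i))"

lemma partial_pairing_measurable [measurable]: "partial_pairing y m \<in> borel_measurable m0"
  unfolding partial_pairing_def[abs_def] by measurable

text \<open>Moved across by the adjoint, a partial pairing is the inner product of \<open>u\<close>
  with a fixed vector. Its variance is left open because it will be read off from the norm of
  \<open>y\<close>.\<close>

lemma partial_pairing_normal: "\<exists>v. centered_normal m0 (partial_pairing y m) v"
proof -
  have "partial_pairing y m u = u \<bullet> adjoint G (\<Sum>i<m. y i *\<^sub>R b i)" for u
    by (simp add: partial_pairing_def inner_sum_right flip: adj)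
  then have "partial_pairing y m = (\<lambda>u. u \<bullet> adjoint G (\<Sum>i<m. y i *\<^sub>R b i))" by auto
  then show ?thesis using m0_gauss by simp
qed

definition obs_weight :: "nat \<Rightarrow> (nat \<Rightarrow> real) \<Rightarrow> 'a \<Rightarrow> real" where
  "obs_weight m y u = \<bar>partial_pairing y m u\<bar> + (\<Sum>i<m. (1/2)^i * \<bar>y i\<bar>)"

text \<open>The norm of \<open>L\<^sup>1(m0)\<close> with values in the space of convergent sequences under the sup norm;
  the geometric weights only serve to separate points.\<close>

definition obs_norm :: "(nat \<Rightarrow> real) \<Rightarrow> ennreal" where
  "obs_norm y = (\<integral>\<^sup>+u. (SUP m. ennreal (obs_weight m y u)) \<partial>m0)"

text \<open>Finiteness of the norm bounds the partial sums but does not make them converge, hence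
  the second condition. It survives limits in norm, so the space stays complete.\<close>

definition obs_space :: "(nat \<Rightarrow> real) set" where
  "obs_space = {y. obs_norm y < \<infinity> \<and> (AE u in m0. summable (\<lambda>i. y i * (G u \<bullet> b i)))}"

lemma obs_weight_nonneg: "0 \<le> obs_weight m y u"
  by (simp add: obs_weight_def sum_nonneg)

lemma obs_weight_measurable [measurable]: "obs_weight m y \<in> borel_measurable m0"
  unfolding obs_weight_def[abs_def] by measurable

lemma partial_pairing_add: "partial_pairing (\<lambda>i. y i + z i) m u = partial_pairing y m u + partial_pairing z m u"
  by (simp add: partial_pairing_def distrib_right sum.distrib)

lemma partial_pairing_scale: "partial_pairing (\<lambda>i. a * y i) m u = a * partial_pairing y m u"
  by (simp add: partial_pairing_def sum_distrib_left mult.assoc)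

lemma obs_norm_add: "obs_norm (\<lambda>i. y i + z i) \<le> obs_norm y + obs_norm z"
proof -
  have "obs_weight m (\<lambda>i. y i + z i) u \<le> obs_weight m y u + obs_weight m z u" for m u
  proof -
    have "(\<Sum>i<m. (1/2)^i * \<bar>y i + z i\<bar>) \<le> (\<Sum>i<m. (1/2)^i * \<bar>y i\<bar> + (1/2)^i * \<bar>z i\<bar>)"
      by (intro sum_mono) (simp add: distrib_left[symmetric] abs_triangle_ineq)
    then show ?thesis
      unfolding obs_weight_def partial_pairing_add
      using abs_triangle_ineq[of "partial_pairing y m u" "partial_pairing z m u"] by (simp add: sum.distrib)
  qed
  then have "(SUP m. ennreal (obs_weight m (\<lambda>i. y i + z i) u))
      \<le> (SUP m. ennreal (obs_weight m y u)) + (SUP m. ennreal (obs_weight m z u))" for u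
  proof (intro SUP_least)
    fix m
    have "ennreal (obs_weight m (\<lambda>i. y i + z i) u) \<le> ennreal (obs_weight m y u + obs_weight m z u)"
      by (intro ennreal_leI) fact
    also have "\<dots> = ennreal (obs_weight m y u) + ennreal (obs_weight m z u)"
      by (simp add: obs_weight_nonneg)
    also have "\<dots> \<le> (SUP m. ennreal (obs_weight m y u)) + (SUP m. ennreal (obs_weight m z u))"
      by (intro add_mono SUP_upper) auto
    finally show "ennreal (obs_weight m (\<lambda>i. y i + z i) u) \<le> (SUP m. ennreal (obs_weight m y u)) + (SUP m. ennreal (obs_weight m z u))" .
  qed
  then show ?thesis
    unfolding obs_norm_def by (subst nn_integral_add[symmetric]) (auto intro: nn_integral_mono)
qed

lemma obs_norm_scale: "obs_norm (\<lambda>i. a * y i) = ennreal \<bar>a\<bar> * obs_norm y"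
proof -
  have "obs_weight m (\<lambda>i. a * y i) u = \<bar>a\<bar> * obs_weight m y u" for m u
    by (simp add: obs_weight_def partial_pairing_scale abs_mult distrib_left sum_distrib_left mult_ac)
  then show ?thesis
    by (simp add: obs_norm_def ennreal_mult' SUP_mult_left_ennreal[symmetric] nn_integral_cmult)
qed

text \<open>The prior has mass one, so the geometric weights let the norm dominate each coordinate:
  it separates points, and Cauchy sequences converge coordinatewise.\<close>

lemma obs_norm_coordinate: "ennreal ((1/2)^i * \<bar>y i\<bar>) \<le> obs_norm y"
proof -
  have "ennreal ((1/2)^i * \<bar>y i\<bar>) = (\<integral>\<^sup>+u. ennreal ((1/2)^i * \<bar>y i\<bar>) \<partial>m0)"
    by (simp add: m0.emeasure_space_1)
  also have "\<dots> \<le> obs_norm y"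
    unfolding obs_norm_def
  proof (intro nn_integral_mono)
    fix u
    have "(1/2)^i * \<bar>y i\<bar> \<le> (\<Sum>i<Suc i. (1/2)^i * \<bar>y i\<bar>)"
      by (rule member_le_sum[of i "{..<Suc i}"]) auto
    then have "ennreal ((1/2)^i * \<bar>y i\<bar>) \<le> ennreal (obs_weight (Suc i) y u)"
      by (intro ennreal_leI) (simp add: obs_weight_def)
    also have "\<dots> \<le> (SUP m. ennreal (obs_weight m y u))" by (intro SUP_upper) auto
    finally show "ennreal ((1/2)^i * \<bar>y i\<bar>) \<le> (SUP m. ennreal (obs_weight m y u))" .
  qed
  finally show ?thesis .
qed

text \<open>Each \<open>obs_weight m\<close> is continuous in finitely many coordinates, so the
  supremum over \<open>m\<close> is lower semicontinuous, and Fatou's lemma passes this to the prior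
  expectation.\<close>

lemma obs_norm_lsc:
  assumes lim: "\<And>i. (\<lambda>k. z k i) \<longlonglongrightarrow> y i"
  shows "obs_norm y \<le> liminf (\<lambda>k. obs_norm (z k))"
proof -
  have "(SUP m. ennreal (obs_weight m y u)) \<le> liminf (\<lambda>k. SUP m. ennreal (obs_weight m (z k) u))" for u
  proof (intro SUP_least)
    fix m
    have "(\<lambda>k. ennreal (obs_weight m (z k) u)) \<longlonglongrightarrow> ennreal (obs_weight m y u)"
      unfolding obs_weight_def partial_pairing_def
      by (intro tendsto_ennrealI tendsto_add tendsto_rabs tendsto_sum tendsto_mult tendsto_const lim)
    then have "ennreal (obs_weight m y u) = liminf (\<lambda>k. ennreal (obs_weight m (z k) u))"
      by (intro lim_imp_Liminf[symmetric]) simp_all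
    also have "\<dots> \<le> liminf (\<lambda>k. SUP m. ennreal (obs_weight m (z k) u))"
      by (intro Liminf_mono always_eventually allI SUP_upper) auto
    finally show "ennreal (obs_weight m y u) \<le> liminf (\<lambda>k. SUP m. ennreal (obs_weight m (z k) u))" .
  qed
  then have "obs_norm y \<le> (\<integral>\<^sup>+u. liminf (\<lambda>k. SUP m. ennreal (obs_weight m (z k) u)) \<partial>m0)"
    unfolding obs_norm_def by (intro nn_integral_mono)
  also have "\<dots> \<le> liminf (\<lambda>k. obs_norm (z k))"
    unfolding obs_norm_def by (rule nn_integral_liminf) measurable
  finally show ?thesis .
qed

lemma obs_space_add: "y \<in> obs_space \<Longrightarrow> z \<in> obs_space \<Longrightarrow> (\<lambda>i. y i + z i) \<in> obs_space"
proof -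
  assume y: "y \<in> obs_space" and z: "z \<in> obs_space"
  have "obs_norm (\<lambda>i. y i + z i) < \<infinity>"
    using y z by (intro le_less_trans[OF obs_norm_add]) (auto simp: obs_space_def)
  moreover have "AE u in m0. summable (\<lambda>i. y i * (G u \<bullet> b i))" "AE u in m0. summable (\<lambda>i. z i * (G u \<bullet> b i))"
    using y z by (auto simp: obs_space_def)
  then have "AE u in m0. summable (\<lambda>i. (y i + z i) * (G u \<bullet> b i))"
    by eventually_elim (rule pairing_add_left)
  ultimately show ?thesis by (simp add: obs_space_def)
qed

lemma obs_space_scale: "y \<in> obs_space \<Longrightarrow> (\<lambda>i. a * y i) \<in> obs_space"
proof -
  assume y: "y \<in> obs_space"
  have "obs_norm (\<lambda>i. a * y i) < \<infinity>"
    using y by (auto simp: obs_space_def obs_norm_scale ennreal_mult_less_top)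
  moreover have "AE u in m0. summable (\<lambda>i. y i * (G u \<bullet> b i))"
    using y by (auto simp: obs_space_def)
  then have "AE u in m0. summable (\<lambda>i. (a * y i) * (G u \<bullet> b i))"
    by eventually_elim (rule pairing_scale_left)
  ultimately show ?thesis by (simp add: obs_space_def)
qed

lemma obs_space_diff: "y \<in> obs_space \<Longrightarrow> z \<in> obs_space \<Longrightarrow> (\<lambda>i. y i - z i) \<in> obs_space"
  using obs_space_add[OF _ obs_space_scale[of z "-1"], of y] by simp

lemma obs_norm_zero: "obs_norm (\<lambda>i. 0) = 0"
  using obs_norm_scale[of 0 "\<lambda>i. 0"] by simp

lemma obs_space_zero: "(\<lambda>i. 0) \<in> obs_space"
  by (simp add: obs_space_def obs_norm_zero)

lemma obs_norm_minus: "obs_norm (\<lambda>i. y i - z i) = obs_norm (\<lambda>i. z i - y i)"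
  using obs_norm_scale[of "-1" "\<lambda>i. z i - y i"] by simp

lemma obs_norm_eq_0: "obs_norm y = 0 \<longleftrightarrow> y = (\<lambda>i. 0)"
proof
  assume "obs_norm y = 0"
  then have "ennreal ((1/2)^i * \<bar>y i\<bar>) = 0" for i using obs_norm_coordinate[of i y] by simp
  then have "(1/2)^i * \<bar>y i\<bar> = 0" for i by (metis ennreal_eq_0_iff mult_nonneg_nonneg abs_ge_zero antisym zero_le_power zero_le_divide_1_iff zero_le_numeral)
  then show "y = (\<lambda>i. 0)" by auto
qed (simp add: obs_norm_zero)

lemma obs_norm_real: "y \<in> obs_space \<Longrightarrow> ennreal (enn2real (obs_norm y)) = obs_norm y"
  by (auto simp: obs_space_def less_top)

lemma obs_space_metric: "Metric_space obs_space (\<lambda>x y. enn2real (obs_norm (\<lambda>i. x i - y i)))"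
proof
  fix x y z assume x: "x \<in> obs_space" and y: "y \<in> obs_space"
  show "(enn2real (obs_norm (\<lambda>i. x i - y i)) = 0) = (x = y)"
    using obs_space_diff[OF x y] obs_norm_eq_0[of "\<lambda>i. x i - y i"]
    by (auto simp: obs_space_def enn2real_eq_0_iff fun_eq_iff less_top)
  assume z: "z \<in> obs_space"
  have "obs_norm (\<lambda>i. x i - z i) \<le> obs_norm (\<lambda>i. x i - y i) + obs_norm (\<lambda>i. y i - z i)"
    using obs_norm_add[of "\<lambda>i. x i - y i" "\<lambda>i. y i - z i"] by simp
  then show "enn2real (obs_norm (\<lambda>i. x i - z i))
      \<le> enn2real (obs_norm (\<lambda>i. x i - y i)) + enn2real (obs_norm (\<lambda>i. y i - z i))"
    using obs_space_diff[OF x y] obs_space_diff[OF y z] unfolding obs_space_def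
    by (subst enn2real_plus[symmetric]) (auto intro!: enn2real_mono simp: less_top)
next
  fix x y
  show "enn2real (obs_norm (\<lambda>i. x i - y i)) = enn2real (obs_norm (\<lambda>i. y i - x i))"
    by (simp only: obs_norm_minus[of x y])
qed simp

text \<open>The candidate is the coordinatewise limit \<open>z\<close>, and
  \<open>obs_norm_lsc\<close> upgrades the convergence to the norm. The series for \<open>z\<close>
  then has to converge for almost every \<open>u\<close>; it inherits this from the
  \<open>\<sigma> n\<close>, as the norm controls partial sums uniformly in
  \<open>m\<close>.\<close>

lemma obs_space_complete: "Metric_space.mcomplete obs_space (\<lambda>x y. enn2real (obs_norm (\<lambda>i. x i - y i)))"
proof -
  define d where "d = (\<lambda>x y. enn2real (obs_norm (\<lambda>i. x i - y i)))"
  interpret Metric_space obs_space d using obs_space_metric unfolding d_def .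
  have dn: "obs_norm (\<lambda>i. x i - y i) = ennreal (d x y)" if "x \<in> obs_space" "y \<in> obs_space" for x y
    using obs_norm_real[OF obs_space_diff[OF that]] by (simp add: d_def)
  have "\<exists>x. limitin mtopology \<sigma> x sequentially" if \<sigma>: "MCauchy \<sigma>" for \<sigma>
  proof -
    have \<sigma>Y: "\<sigma> n \<in> obs_space" for n using \<sigma> by (auto simp: MCauchy_def)
    have Cau: "\<exists>N. \<forall>n n'. N \<le> n \<longrightarrow> N \<le> n' \<longrightarrow> d (\<sigma> n) (\<sigma> n') < \<epsilon>" if "\<epsilon> > 0" for \<epsilon>
      using \<sigma> that by (auto simp: MCauchy_def)
    have "Cauchy (\<lambda>n. \<sigma> n i)" for i
    proof (rule metric_CauchyI)
      fix e :: real assume "e > 0"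
      then have "(1/2)^i * e > 0" by simp
      from Cau[OF this] obtain N where N: "\<And>n n'. N \<le> n \<Longrightarrow> N \<le> n' \<Longrightarrow> d (\<sigma> n) (\<sigma> n') < (1/2)^i * e" by blast
      have "dist (\<sigma> n i) (\<sigma> n' i) < e" if "N \<le> n" "N \<le> n'" for n n'
      proof -
        have "ennreal ((1/2)^i * \<bar>\<sigma> n i - \<sigma> n' i\<bar>) \<le> ennreal (d (\<sigma> n) (\<sigma> n'))"
          using obs_norm_coordinate[of i "\<lambda>i. \<sigma> n i - \<sigma> n' i"] dn[OF \<sigma>Y \<sigma>Y] by simp
        then have "(1/2)^i * \<bar>\<sigma> n i - \<sigma> n' i\<bar> \<le> d (\<sigma> n) (\<sigma> n')" by (simp add: ennreal_le_iff)
        then have "(1/2)^i * \<bar>\<sigma> n i - \<sigma> n' i\<bar> < (1/2)^i * e" using N[OF that] by linarith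
        then show ?thesis by (simp add: dist_real_def)
      qed
      then show "\<exists>M. \<forall>m\<ge>M. \<forall>n\<ge>M. dist (\<sigma> m i) (\<sigma> n i) < e" by blast
    qed
    then have "\<exists>l. (\<lambda>n. \<sigma> n i) \<longlonglongrightarrow> l" for i by (simp add: Cauchy_convergent_iff convergent_def)
    then obtain z where z: "\<And>i. (\<lambda>n. \<sigma> n i) \<longlonglongrightarrow> z i" by metis
    have close: "\<exists>N. \<forall>n\<ge>N. obs_norm (\<lambda>i. \<sigma> n i - z i) \<le> ennreal \<epsilon>" if e: "\<epsilon> > 0" for \<epsilon>
    proof -
      from Cau[OF e] obtain N where N: "\<And>n n'. N \<le> n \<Longrightarrow> N \<le> n' \<Longrightarrow> d (\<sigma> n) (\<sigma> n') < \<epsilon>" by blast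
      have "obs_norm (\<lambda>i. \<sigma> n i - z i) \<le> ennreal \<epsilon>" if n: "N \<le> n" for n
      proof -
        have "obs_norm (\<lambda>i. \<sigma> n i - z i) \<le> liminf (\<lambda>k. obs_norm (\<lambda>i. \<sigma> n i - \<sigma> k i))"
          by (rule obs_norm_lsc) (intro tendsto_diff tendsto_const z)
        also have "\<dots> \<le> ennreal \<epsilon>"
        proof (rule Liminf_le)
          show "\<forall>\<^sub>F k in sequentially. obs_norm (\<lambda>i. \<sigma> n i - \<sigma> k i) \<le> ennreal \<epsilon>"
            using eventually_ge_at_top[of N]
          proof eventually_elim
            case (elim k)
            then show ?case using N[OF n, of k] dn[OF \<sigma>Y \<sigma>Y, of n k] by (simp add: ennreal_leI)
          qed
        qed simp
        finally show ?thesis .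
      qed
      then show ?thesis by blast
    qed
    have lim0: "(\<lambda>n. obs_norm (\<lambda>i. \<sigma> n i - z i)) \<longlonglongrightarrow> 0"
    proof (rule ennreal_tendsto_0I)
      show "\<exists>N. \<forall>n\<ge>N. obs_norm (\<lambda>i. \<sigma> n i - z i) \<le> ennreal \<epsilon>" if "\<epsilon> > 0" for \<epsilon> by (rule close[OF that])
    qed
    \<comment> \<open>For almost every \<open>u\<close> the uniform distances have lower limit 0. No
      subsequence is extracted: for each tolerance a single close \<open>\<sigma> n\<close>,
      depending on \<open>u\<close>, yields the Cauchy property of the partial sums.\<close>
    have "(\<integral>\<^sup>+u. liminf (\<lambda>n. SUP m. ennreal (obs_weight m (\<lambda>i. \<sigma> n i - z i) u)) \<partial>m0)
        \<le> liminf (\<lambda>n. obs_norm (\<lambda>i. \<sigma> n i - z i))"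
      unfolding obs_norm_def by (rule nn_integral_liminf) measurable
    also have "\<dots> = 0" by (rule lim_imp_Liminf[OF _ lim0]) simp
    finally have "AE u in m0. liminf (\<lambda>n. SUP m. ennreal (obs_weight m (\<lambda>i. \<sigma> n i - z i) u)) = 0"
      by (subst (asm) le_zero_eq, subst (asm) nn_integral_0_iff_AE) auto
    moreover have "AE u in m0. \<forall>n. summable (\<lambda>i. \<sigma> n i * (G u \<bullet> b i))"
      unfolding AE_all_countable using \<sigma>Y by (auto simp: obs_space_def)
    ultimately have "AE u in m0. summable (\<lambda>i. z i * (G u \<bullet> b i))"
    proof eventually_elim
      fix u assume li: "liminf (\<lambda>n. SUP m. ennreal (obs_weight m (\<lambda>i. \<sigma> n i - z i) u)) = 0"
        and s: "\<forall>n. summable (\<lambda>i. \<sigma> n i * (G u \<bullet> b i))"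
      have "Cauchy (\<lambda>m. partial_pairing z m u)"
      proof (rule metric_CauchyI)
        fix e :: real assume e: "e > 0"
        have "\<exists>n. (SUP m. ennreal (obs_weight m (\<lambda>i. \<sigma> n i - z i) u)) < ennreal (e / 3)"
        proof (rule ccontr)
          assume "\<not> ?thesis"
          then have "ennreal (e / 3) \<le> liminf (\<lambda>n. SUP m. ennreal (obs_weight m (\<lambda>i. \<sigma> n i - z i) u))"
            by (intro Liminf_bounded always_eventually) (simp add: not_less)
          then show False using li e by simp
        qed
        then obtain n where n: "(SUP m. ennreal (obs_weight m (\<lambda>i. \<sigma> n i - z i) u)) < ennreal (e / 3)" by blast
        have c: "\<bar>partial_pairing (\<sigma> n) m u - partial_pairing z m u\<bar> < e / 3" for m
        proof -
          have "ennreal (obs_weight m (\<lambda>i. \<sigma> n i - z i) u) < ennreal (e / 3)"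
            using n by (meson SUP_upper UNIV_I le_less_trans)
          then have "obs_weight m (\<lambda>i. \<sigma> n i - z i) u < e / 3"
            by (subst (asm) ennreal_less_iff) (auto simp: obs_weight_nonneg)
          moreover have "0 \<le> (\<Sum>i<m. (1/2)^i * \<bar>\<sigma> n i - z i\<bar>)" by (simp add: sum_nonneg)
          ultimately show ?thesis
            by (simp add: obs_weight_def partial_pairing_def left_diff_distrib sum_subtractf)
        qed
        have "Cauchy (\<lambda>m. partial_pairing (\<sigma> n) m u)"
          using s unfolding partial_pairing_def by (simp add: summable_iff_convergent Cauchy_convergent_iff)
        then obtain M where M: "\<And>p q. M \<le> p \<Longrightarrow> M \<le> q \<Longrightarrow> dist (partial_pairing (\<sigma> n) p u) (partial_pairing (\<sigma> n) q u) < e / 3"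
          using e metric_CauchyD[of "\<lambda>m. partial_pairing (\<sigma> n) m u" "e / 3"] by auto
        have "dist (partial_pairing z p u) (partial_pairing z q u) < e" if "M \<le> p" "M \<le> q" for p q
          using M[OF that] c[of p] c[of q] unfolding dist_real_def by linarith
        then show "\<exists>M. \<forall>p\<ge>M. \<forall>q\<ge>M. dist (partial_pairing z p u) (partial_pairing z q u) < e" by blast
      qed
      then show "summable (\<lambda>i. z i * (G u \<bullet> b i))"
        unfolding partial_pairing_def by (simp add: summable_iff_convergent Cauchy_convergent_iff)
    qed
    moreover have "obs_norm z < \<infinity>"
    proof -
      obtain N where N: "\<And>n. n \<ge> N \<Longrightarrow> obs_norm (\<lambda>i. \<sigma> n i - z i) \<le> ennreal 1" using close[of 1] by auto
      have "obs_norm z \<le> obs_norm (\<lambda>i. z i - \<sigma> N i) + obs_norm (\<sigma> N)"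
        using obs_norm_add[of "\<lambda>i. z i - \<sigma> N i" "\<sigma> N"] by simp
      also have "\<dots> \<le> 1 + obs_norm (\<sigma> N)"
        using N[of N] by (intro add_right_mono) (simp add: obs_norm_minus[of z])
      also have "\<dots> < \<infinity>" using \<sigma>Y[of N] by (simp add: obs_space_def)
      finally show ?thesis .
    qed
    ultimately have zY: "z \<in> obs_space" by (simp add: obs_space_def)
    have "limitin mtopology \<sigma> z sequentially"
      unfolding limitin_metric
    proof (intro conjI zY allI impI)
      fix \<epsilon> :: real assume e: "\<epsilon> > 0"
      from close[of "\<epsilon> / 2"] e obtain N where N: "\<And>n. n \<ge> N \<Longrightarrow> obs_norm (\<lambda>i. \<sigma> n i - z i) \<le> ennreal (\<epsilon> / 2)" by auto
      show "\<forall>\<^sub>F n in sequentially. \<sigma> n \<in> obs_space \<and> d (\<sigma> n) z < \<epsilon>"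
        using eventually_ge_at_top[of N]
      proof eventually_elim
        case (elim n)
        then show ?case using N[of n] dn[OF \<sigma>Y zY, of n] \<sigma>Y[of n] e by (simp add: ennreal_le_iff)
      qed
    qed
    then show ?thesis by blast
  qed
  then have mcomplete unfolding mcomplete_def by blast
  then show ?thesis unfolding d_def .
qed

lemma obs_banach: "banach_sequence_space obs_space (\<lambda>y. enn2real (obs_norm y))"
  unfolding banach_sequence_space_def
proof (intro conjI ballI allI)
  fix x y a assume x: "x \<in> obs_space" 
  show "(\<lambda>i. a * x i) \<in> obs_space" by (rule obs_space_scale[OF x])
  show "enn2real (obs_norm (\<lambda>i. a * x i)) = \<bar>a\<bar> * enn2real (obs_norm x)"
    by (simp add: obs_norm_scale enn2real_mult)
  show "enn2real (obs_norm x) = 0 \<longleftrightarrow> x = (\<lambda>i. 0)"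
    using x obs_norm_eq_0[of x] by (auto simp: obs_space_def enn2real_eq_0_iff less_top)
  assume y: "y \<in> obs_space"
  show "(\<lambda>i. x i + y i) \<in> obs_space" by (rule obs_space_add[OF x y])
  show "enn2real (obs_norm (\<lambda>i. x i + y i)) \<le> enn2real (obs_norm x) + enn2real (obs_norm y)"
    using x y obs_norm_add[of x y] unfolding obs_space_def
    by (subst enn2real_plus[symmetric]) (auto intro!: enn2real_mono simp: less_top)
qed (auto intro: obs_space_zero obs_space_complete)

end

section \<open>Hellinger distance of normalised densities\<close>

text \<open>Rests on (sqrt a - sqrt c)^2 \<le> |a - c|. The Radon-Nikodym derivatives in
  \<open>hellinger_dist\<close> agree with \<open>f\<close> and \<open>g\<close> only almost
  everywhere.\<close>

lemma hellinger_dist_density_le: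
  assumes M: "sigma_finite_measure M"
    and [simp]: "integrable M f" "integrable M g" and nn: "\<And>x. 0 \<le> f x" "\<And>x. 0 \<le> g x"
  shows "(hellinger_dist M (density M (\<lambda>x. ennreal (f x))) (density M (\<lambda>x. ennreal (g x))))\<^sup>2
    \<le> (\<integral>x. \<bar>f x - g x\<bar> \<partial>M) / 2"
proof -
  interpret sigma_finite_measure M by fact
  have [measurable]: "f \<in> borel_measurable M" "g \<in> borel_measurable M" using borel_measurable_integrable[OF assms(2)] borel_measurable_integrable[OF assms(3)] by blast+
  let ?F = "density M (\<lambda>x. ennreal (f x))" and ?G = "density M (\<lambda>x. ennreal (g x))"
  have "AE x in M. ennreal (f x) = RN_deriv M ?F x" "AE x in M. ennreal (g x) = RN_deriv M ?G x"
    by (intro RN_deriv_unique; simp)+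
  then have ae: "AE x in M. (sqrt (enn2real (RN_deriv M ?F x)) - sqrt (enn2real (RN_deriv M ?G x)))\<^sup>2
      = (sqrt (f x) - sqrt (g x))\<^sup>2"
  proof eventually_elim
    case (elim x)
    then show ?case using nn[of x] by (simp flip: elim)
  qed
  have le: "(sqrt a - sqrt c)\<^sup>2 \<le> \<bar>a - c\<bar>" if "0 \<le> a" "0 \<le> c" for a c :: real
  proof -
    have "(sqrt a - sqrt c)\<^sup>2 = \<bar>sqrt a - sqrt c\<bar> * \<bar>sqrt a - sqrt c\<bar>" by (simp add: power2_eq_square)
    also have "\<dots> \<le> \<bar>sqrt a - sqrt c\<bar> * \<bar>sqrt a + sqrt c\<bar>"
      using that by (intro mult_left_mono) (auto simp: abs_le_iff)
    also have "\<dots> = \<bar>(sqrt a - sqrt c) * (sqrt a + sqrt c)\<bar>" by (simp only: abs_mult)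
    also have "(sqrt a - sqrt c) * (sqrt a + sqrt c) = a - c"
      using that by (simp add: algebra_simps)
    finally show ?thesis .
  qed
  have "(\<integral>x. (sqrt (enn2real (RN_deriv M ?F x)) - sqrt (enn2real (RN_deriv M ?G x)))\<^sup>2 \<partial>M)
      = (\<integral>x. (sqrt (f x) - sqrt (g x))\<^sup>2 \<partial>M)"
    by (rule integral_cong_AE) (use ae in auto)
  also have "\<dots> \<le> (\<integral>x. \<bar>f x - g x\<bar> \<partial>M)"
  proof (rule integral_mono)
    show "integrable M (\<lambda>x. (sqrt (f x) - sqrt (g x))\<^sup>2)"
      by (rule Bochner_Integration.integrable_bound[where f="\<lambda>x. f x - g x"]) (use le nn in auto)
  qed (use le nn in auto)
  finally have le: "(\<integral>x. (sqrt (enn2real (RN_deriv M ?F x)) - sqrt (enn2real (RN_deriv M ?G x)))\<^sup>2 \<partial>M)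
      \<le> (\<integral>x. \<bar>f x - g x\<bar> \<partial>M)" .
  have "0 \<le> (\<integral>x. (sqrt (enn2real (RN_deriv M ?F x)) - sqrt (enn2real (RN_deriv M ?G x)))\<^sup>2 \<partial>M)"
    by (intro integral_nonneg_AE) auto
  then show ?thesis using le by (simp add: hellinger_dist_def)
qed

text \<open>The error splits into that of the unnormalised functions and that of the normalisers,
  each at most the \<open>L^1\<close> distance over \<open>H\<close>. Only the normaliser of
  \<open>g\<close> remains in the bound, so \<open>g\<close> can play the fixed reference and
  \<open>f\<close> the perturbation.\<close>

lemma normalized_L1_dist_le:
  fixes f g :: "'a \<Rightarrow> real"
  assumes [simp]: "integrable M f" "integrable M g" and nn: "\<And>x. 0 \<le> f x" "\<And>x. 0 \<le> g x"
    and pos: "(\<integral>x. f x \<partial>M) > 0" "(\<integral>x. g x \<partial>M) > 0"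
  shows "(\<integral>x. \<bar>f x / (\<integral>x. f x \<partial>M) - g x / (\<integral>x. g x \<partial>M)\<bar> \<partial>M) \<le> 2 * (\<integral>x. \<bar>f x - g x\<bar> \<partial>M) / (\<integral>x. g x \<partial>M)"
proof -
  define F where "F = (\<integral>x. f x \<partial>M)"
  define H where "H = (\<integral>x. g x \<partial>M)"
  define I where "I = (\<integral>x. \<bar>f x - g x\<bar> \<partial>M)"
  have F: "F > 0" and H: "H > 0" using pos by (auto simp: F_def H_def)
  have FH: "\<bar>F - H\<bar> \<le> I"
  proof -
    have "F - H = (\<integral>x. f x - g x \<partial>M)" by (simp add: F_def H_def)
    then show ?thesis by (simp only: I_def integral_abs_bound)
  qed
  have "(\<integral>x. \<bar>f x / F - g x / H\<bar> \<partial>M) \<le> (\<integral>x. \<bar>f x - g x\<bar> / H + f x * (\<bar>F - H\<bar> / (F * H)) \<partial>M)"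
  proof (rule integral_mono)
    fix x
    have "f x / F - g x / H = (f x - g x) / H + f x * ((H - F) / (F * H))"
      using F H by (simp add: field_simps)
    also have "\<bar>\<dots>\<bar> \<le> \<bar>(f x - g x) / H\<bar> + \<bar>f x * ((H - F) / (F * H))\<bar>" by (rule abs_triangle_ineq)
    also have "\<dots> = \<bar>f x - g x\<bar> / H + f x * (\<bar>F - H\<bar> / (F * H))"
      using F H nn[of x] by (simp add: abs_mult abs_minus_commute)
    finally show "\<bar>f x / F - g x / H\<bar> \<le> \<bar>f x - g x\<bar> / H + f x * (\<bar>F - H\<bar> / (F * H))" .
  qed auto
  also have "\<dots> = I / H + F * (\<bar>F - H\<bar> / (F * H))"
    by (simp add: I_def F_def)
  also have "\<dots> = I / H + \<bar>F - H\<bar> / H" using F by simp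
  also have "\<dots> \<le> I / H + I / H" using FH H by (intro add_left_mono divide_right_mono) auto
  finally show ?thesis by (simp add: F_def H_def I_def)
qed

section \<open>Continuity of the posterior in the data\<close>

context gaussian_regression
begin

lemma measurable_pairing_G [measurable]: "(\<lambda>u. pairing b y (G u)) \<in> borel_measurable m0"
  unfolding pairing_def by measurable

lemma obs_space_pairing_limit:
  "y \<in> obs_space \<Longrightarrow> AE u in m0. (\<lambda>m. partial_pairing y m u) \<longlonglongrightarrow> pairing b y (G u)"
proof -
  assume "y \<in> obs_space"
  then have "AE u in m0. summable (\<lambda>i. y i * (G u \<bullet> b i))" by (simp add: obs_space_def)
  then show ?thesis by eventually_elim (simp add: partial_pairing_def pairing_sums flip: sums_def)
qed

lemma partial_pairing_le_SUP: "ennreal \<bar>partial_pairing y m u\<bar> \<le> (SUP m. ennreal (obs_weight m y u))"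
proof -
  have "ennreal \<bar>partial_pairing y m u\<bar> \<le> ennreal (obs_weight m y u)"
    by (intro ennreal_leI) (simp add: obs_weight_def sum_nonneg)
  also have "\<dots> \<le> (SUP m. ennreal (obs_weight m y u))" by (intro SUP_upper) auto
  finally show ?thesis .
qed

lemma obs_space_pairing_abs:
  assumes y: "y \<in> obs_space"
  shows "(\<integral>\<^sup>+u. ennreal \<bar>pairing b y (G u)\<bar> \<partial>m0) \<le> obs_norm y"
  unfolding obs_norm_def
proof (rule nn_integral_mono_AE, use obs_space_pairing_limit[OF y] in eventually_elim)
  case (elim u)
  then have "(\<lambda>m. ennreal \<bar>partial_pairing y m u\<bar>) \<longlonglongrightarrow> ennreal \<bar>pairing b y (G u)\<bar>"
    by (intro tendsto_ennrealI tendsto_rabs)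
  then show ?case by (rule LIMSEQ_le_const2) (use partial_pairing_le_SUP in auto)
qed

text \<open>A partial pairing of variance v has first absolute moment sqrt (2 v / pi), which the
  norm dominates. So all variances are at most pi / 2 times the squared norm, and the Gaussian
  exponential moments pass to the limit.\<close>

lemma obs_space_pairing_exp:
  assumes y: "y \<in> obs_space"
  shows "(\<integral>\<^sup>+u. ennreal (exp (t * pairing b y (G u))) \<partial>m0)
    \<le> ennreal (exp (t\<^sup>2 * (pi / 2 * (enn2real (obs_norm y))\<^sup>2) / 2))"
proof -
  define r where "r = enn2real (obs_norm y)"
  obtain v where v: "\<And>m. centered_normal m0 (partial_pairing y m) (v m)"
    using partial_pairing_normal by metis
  have "v m \<le> pi / 2 * r\<^sup>2" for m
  proof -
    have "ennreal (sqrt (2 * v m / pi)) = (\<integral>\<^sup>+u. ennreal \<bar>partial_pairing y m u\<bar> \<partial>m0)"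
      by (rule centered_normal_abs_moment[OF v, symmetric])
    also have "\<dots> \<le> obs_norm y" unfolding obs_norm_def by (intro nn_integral_mono partial_pairing_le_SUP)
    also have "\<dots> = ennreal r" using obs_norm_real[OF y] by (simp add: r_def)
    finally have "sqrt (2 * v m / pi) \<le> r" by (simp add: ennreal_le_iff r_def)
    then have "(sqrt (2 * v m / pi))\<^sup>2 \<le> r\<^sup>2" using centered_normal_nonneg[OF v] by (intro power_mono) auto
    then show ?thesis using centered_normal_nonneg[OF v[of m]] by (simp add: field_simps)
  qed
  from nn_integral_exp_convergent_gaussian_le[OF v this obs_space_pairing_limit[OF y]]
  show ?thesis by (simp add: r_def)
qed

lemma obs_space_pairing_exp_integrable:
  assumes y: "y \<in> obs_space"
  shows "integrable m0 (\<lambda>u. exp (t * pairing b y (G u)))"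
    "(\<integral>u. exp (t * pairing b y (G u)) \<partial>m0) \<le> exp (t\<^sup>2 * (pi / 2 * (enn2real (obs_norm y))\<^sup>2) / 2)"
proof -
  show "integrable m0 (\<lambda>u. exp (t * pairing b y (G u)))"
    using obs_space_pairing_exp[OF y, of t]
    by (intro integrableI_nonneg) (auto intro: le_less_trans)
  show "(\<integral>u. exp (t * pairing b y (G u)) \<partial>m0) \<le> exp (t\<^sup>2 * (pi / 2 * (enn2real (obs_norm y))\<^sup>2) / 2)"
    using enn2real_mono[OF obs_space_pairing_exp[OF y, of t]]
    by (subst integral_eq_nn_integral) auto
qed

lemma obs_space_pairing_integrable:
  assumes y: "y \<in> obs_space"
  shows "integrable m0 (\<lambda>u. pairing b y (G u))"
    "\<bar>\<integral>u. pairing b y (G u) \<partial>m0\<bar> \<le> enn2real (obs_norm y)"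
proof -
  show i: "integrable m0 (\<lambda>u. pairing b y (G u))"
    using obs_space_pairing_abs[OF y] y by (intro integrableI_bounded) (auto simp: obs_space_def intro: le_less_trans)
  have "\<bar>\<integral>u. pairing b y (G u) \<partial>m0\<bar> \<le> (\<integral>u. \<bar>pairing b y (G u)\<bar> \<partial>m0)" by (rule integral_abs_bound)
  also have "\<dots> \<le> enn2real (obs_norm y)"
    using obs_space_pairing_abs[OF y] y
    by (subst integral_eq_nn_integral) (auto simp: obs_space_def less_top intro!: enn2real_mono)
  finally show "\<bar>\<integral>u. pairing b y (G u) \<partial>m0\<bar> \<le> enn2real (obs_norm y)" .
qed

lemma measurable_likelihood [measurable]: "(\<lambda>u. likelihood G b n y u) \<in> borel_measurable m0"
  unfolding likelihood_def by measurable

lemma likelihood_pos: "0 < likelihood G b n y u"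
  by (simp add: likelihood_def)

lemma likelihood_integrable:
  assumes y: "y \<in> obs_space"
  shows "integrable m0 (likelihood G b n y)" "0 < (\<integral>u. likelihood G b n y u \<partial>m0)"
proof -
  show i: "integrable m0 (likelihood G b n y)"
    by (rule Bochner_Integration.integrable_bound[OF obs_space_pairing_exp_integrable(1)[OF y, of "real n"]])
      (auto simp: likelihood_def)
  have "(\<integral>u. likelihood G b n y u \<partial>m0) \<noteq> 0"
  proof
    assume "(\<integral>u. likelihood G b n y u \<partial>m0) = 0"
    then have "AE u in m0. likelihood G b n y u = 0"
      using i by (subst (asm) integral_nonneg_eq_0_iff_AE) (auto simp: likelihood_pos less_imp_le)
    then have "AE u in m0. False" by eventually_elim (use likelihood_pos in \<open>metis less_irrefl\<close>)
    then show False by simp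
  qed
  moreover have "0 \<le> (\<integral>u. likelihood G b n y u \<partial>m0)"
    by (intro integral_nonneg_AE) (simp add: likelihood_pos less_imp_le)
  ultimately show "0 < (\<integral>u. likelihood G b n y u \<partial>m0)" by simp
qed

text \<open>With \<open>X\<close> and \<open>D\<close> the pairings of \<open>y\<close> and of
  \<open>y' - y\<close>, the likelihoods differ by at most exp (n X) |exp (n D) - 1|. The inequality
  between means with a free weight \<open>c\<close> separates the fixed data from the perturbation;
  for fixed \<open>c\<close> the second part vanishes as \<open>r\<close> tends to 0.\<close>

lemma likelihood_L1_le:
  assumes y: "y \<in> obs_space" and y': "y' \<in> obs_space" and c: "c > 0"
  defines "r \<equiv> enn2real (obs_norm (\<lambda>i. y' i - y i))"
  shows "(\<integral>u. \<bar>likelihood G b n y' u - likelihood G b n y u\<bar> \<partial>m0)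
    \<le> (c * exp ((real n)\<^sup>2 * pi * (enn2real (obs_norm y))\<^sup>2) + (exp ((real n)\<^sup>2 * pi * r\<^sup>2) - 1 + 2 * real n * r) / c) / 2"
proof -
  define z where "z = (\<lambda>i. y' i - y i)"
  have z: "z \<in> obs_space" unfolding z_def by (rule obs_space_diff[OF y' y])
  define X where "X u = pairing b y (G u)" for u
  define D where "D u = pairing b z (G u)" for u
  have iX: "integrable m0 (\<lambda>u. exp (t * X u))" for t
    unfolding X_def by (rule obs_space_pairing_exp_integrable[OF y])
  have iD: "integrable m0 (\<lambda>u. exp (t * D u))" for t
    unfolding D_def by (rule obs_space_pairing_exp_integrable[OF z])
  have iD1: "integrable m0 D" "\<bar>\<integral>u. D u \<partial>m0\<bar> \<le> r"
    using obs_space_pairing_integrable[OF z] unfolding D_def[abs_def] r_def z_def by auto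
  have sq: "(exp (real n * x) - 1)\<^sup>2 = exp (2 * real n * x) - 2 * exp (real n * x) + 1" for x :: real
  proof -
    have "exp (2 * real n * x) = exp (real n * x) * exp (real n * x)" by (simp add: mult_exp_exp)
    then show ?thesis by (simp add: power2_eq_square algebra_simps)
  qed
  have isq: "integrable m0 (\<lambda>u. (exp (real n * D u) - 1)\<^sup>2)"
    unfolding sq by (intro Bochner_Integration.integrable_add Bochner_Integration.integrable_diff iD integrable_mult_right) simp
  \<comment> \<open>Expanding the square leaves a negative term that must be bounded from below; 1 +
    x \<le> exp x does this, with the mean of \<open>D\<close> estimated by its absolute
    moment.\<close>
  have "(\<integral>u. exp (real n * D u) \<partial>m0) \<ge> (\<integral>u. 1 + real n * D u \<partial>m0)"
    using iD1 by (intro integral_mono iD) auto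
  also have "(\<integral>u. 1 + real n * D u \<partial>m0) = 1 + real n * (\<integral>u. D u \<partial>m0)"
    using iD1 m0.prob_space by simp
  finally have lowD: "(\<integral>u. exp (real n * D u) \<partial>m0) \<ge> 1 + real n * (\<integral>u. D u \<partial>m0)" .
  have "real n * (\<integral>u. D u \<partial>m0) \<ge> real n * (- r)"
    using iD1(2) by (intro mult_left_mono) auto
  with lowD have lowD: "(\<integral>u. exp (real n * D u) \<partial>m0) \<ge> 1 - real n * r" by simp
  have upD: "(\<integral>u. exp (2 * real n * D u) \<partial>m0) \<le> exp ((real n)\<^sup>2 * pi * r\<^sup>2)"
    using obs_space_pairing_exp_integrable(2)[OF z, of "2 * real n"]
    by (simp add: D_def r_def z_def power_mult_distrib mult_ac)
  have upX: "(\<integral>u. exp (2 * real n * X u) \<partial>m0) \<le> exp ((real n)\<^sup>2 * pi * (enn2real (obs_norm y))\<^sup>2)"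
    using obs_space_pairing_exp_integrable(2)[OF y, of "2 * real n"]
    by (simp add: X_def power_mult_distrib mult_ac)
  have "(\<integral>u. (exp (real n * D u) - 1)\<^sup>2 \<partial>m0)
      = (\<integral>u. exp (2 * real n * D u) \<partial>m0) - 2 * (\<integral>u. exp (real n * D u) \<partial>m0) + 1"
    unfolding sq using iD m0.prob_space by simp
  with lowD upD have sqD: "(\<integral>u. (exp (real n * D u) - 1)\<^sup>2 \<partial>m0) \<le> exp ((real n)\<^sup>2 * pi * r\<^sup>2) - 1 + 2 * real n * r"
    by simp
  have sy: "AE u in m0. summable (\<lambda>i. y i * (G u \<bullet> b i))" "AE u in m0. summable (\<lambda>i. z i * (G u \<bullet> b i))"
    using y z by (auto simp: obs_space_def)
  have "(\<integral>u. \<bar>likelihood G b n y' u - likelihood G b n y u\<bar> \<partial>m0)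
      \<le> (\<integral>u. (c * exp (2 * real n * X u) + (exp (real n * D u) - 1)\<^sup>2 / c) / 2 \<partial>m0)"
  proof (rule integral_mono_AE)
    show "AE u in m0. \<bar>likelihood G b n y' u - likelihood G b n y u\<bar>
        \<le> (c * exp (2 * real n * X u) + (exp (real n * D u) - 1)\<^sup>2 / c) / 2"
      using sy
    proof eventually_elim
      case (elim u)
      have p: "pairing b y' (G u) = X u + D u"
        using pairing_add_left(2)[OF elim] by (simp add: X_def D_def z_def)
      define E where "E = exp (- (real n / 2) * (norm (G u))\<^sup>2)"
      have E: "0 < E" "E \<le> 1" by (auto simp: E_def)
      have "likelihood G b n y' u - likelihood G b n y u = E * (exp (real n * X u) * (exp (real n * D u) - 1))"
        by (simp add: likelihood_def p E_def mult_exp_exp distrib_left right_diff_distrib flip: X_def)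
      then have "\<bar>likelihood G b n y' u - likelihood G b n y u\<bar> = E * (exp (real n * X u) * \<bar>exp (real n * D u) - 1\<bar>)"
        using E by (simp add: abs_mult)
      also have "\<dots> \<le> exp (real n * X u) * \<bar>exp (real n * D u) - 1\<bar>"
        using E by (intro mult_left_le_one_le) auto
      also have "\<dots> \<le> (c * exp (2 * real n * X u) + (exp (real n * D u) - 1)\<^sup>2 / c) / 2"
      proof -
        have am_gm: "p * q \<le> (c * p\<^sup>2 + q\<^sup>2 / c) / 2" for p q :: real
        proof -
          have "(sqrt c * p - q / sqrt c)\<^sup>2 = c * p\<^sup>2 - 2 * (p * q) + q\<^sup>2 / c"
            using c by (simp add: power2_diff power_mult_distrib power_divide)
          then show ?thesis using zero_le_power2[of "sqrt c * p - q / sqrt c"] by simp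
        qed
        from am_gm[of "exp (real n * X u)" "\<bar>exp (real n * D u) - 1\<bar>"]
        show ?thesis by (simp add: exp_double[symmetric] mult.assoc)
      qed
      finally show ?case .
    qed
    show "integrable m0 (\<lambda>u. (c * exp (2 * real n * X u) + (exp (real n * D u) - 1)\<^sup>2 / c) / 2)"
      using iX isq by simp
    show "integrable m0 (\<lambda>u. \<bar>likelihood G b n y' u - likelihood G b n y u\<bar>)"
      using likelihood_integrable(1)[OF y] likelihood_integrable(1)[OF y'] by simp
  qed
  also have "\<dots> = (c * (\<integral>u. exp (2 * real n * X u) \<partial>m0) + (\<integral>u. (exp (real n * D u) - 1)\<^sup>2 \<partial>m0) / c) / 2"
    using iX isq by simp
  also have "\<dots> \<le> (c * exp ((real n)\<^sup>2 * pi * (enn2real (obs_norm y))\<^sup>2) + (exp ((real n)\<^sup>2 * pi * r\<^sup>2) - 1 + 2 * real n * r) / c) / 2"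
    using c upX sqD by (intro divide_right_mono add_mono mult_left_mono) auto
  finally show ?thesis .
qed

lemma posterior_eq_density:
  assumes "\<mu> n = m0"
  shows "posterior G b \<mu> n y = density m0 (\<lambda>u. ennreal (likelihood G b n y u / (\<integral>v. likelihood G b n y v \<partial>m0)))"
  by (simp add: posterior_def assms)

lemma posterior_prob_space:
  assumes "\<mu> n = m0" and y: "y \<in> obs_space"
  shows "prob_space (posterior G b \<mu> n y)"
proof (rule prob_spaceI)
  let ?Z = "\<integral>v. likelihood G b n y v \<partial>m0"
  note L = likelihood_integrable[OF y, of n]
  have "emeasure (posterior G b \<mu> n y) (space (posterior G b \<mu> n y)) = (\<integral>\<^sup>+u. ennreal (likelihood G b n y u / ?Z) \<partial>m0)"
    unfolding posterior_eq_density[of \<mu>, OF assms(1)] by (subst emeasure_density) auto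
  also have "\<dots> = ennreal (\<integral>u. likelihood G b n y u / ?Z \<partial>m0)"
    using L by (intro nn_integral_eq_integral) (auto simp: likelihood_pos less_imp_le)
  also have "\<dots> = 1" using L by simp
  finally show "emeasure (posterior G b \<mu> n y) (space (posterior G b \<mu> n y)) = 1" .
qed

lemma hellinger_dist_posterior_le:
  assumes "\<mu> n = m0" and y: "y \<in> obs_space" and y': "y' \<in> obs_space"
  shows "(hellinger_dist (\<mu> n) (posterior G b \<mu> n y') (posterior G b \<mu> n y))\<^sup>2
    \<le> (\<integral>u. \<bar>likelihood G b n y' u - likelihood G b n y u\<bar> \<partial>m0) / (\<integral>u. likelihood G b n y u \<partial>m0)"
proof -
  note L = likelihood_integrable[OF y, of n] and L' = likelihood_integrable[OF y', of n]
  have nn: "0 \<le> likelihood G b n y u" for y u by (simp add: likelihood_pos less_imp_le)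
  have "(hellinger_dist (\<mu> n) (posterior G b \<mu> n y') (posterior G b \<mu> n y))\<^sup>2
    \<le> (\<integral>u. \<bar>likelihood G b n y' u / (\<integral>v. likelihood G b n y' v \<partial>m0)
          - likelihood G b n y u / (\<integral>v. likelihood G b n y v \<partial>m0)\<bar> \<partial>m0) / 2"
    unfolding posterior_eq_density[of \<mu>, OF assms(1)] unfolding assms(1)
    using L L' nn by (intro hellinger_dist_density_le m0.sigma_finite_measure_axioms) auto
  also have "\<dots> \<le> (2 * (\<integral>u. \<bar>likelihood G b n y' u - likelihood G b n y u\<bar> \<partial>m0) / (\<integral>u. likelihood G b n y u \<partial>m0)) / 2"
    by (intro divide_right_mono normalized_L1_dist_le L L' nn) simp
  finally show ?thesis by simp
qed

lemma posterior_hellinger_continuous: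
  assumes \<mu>: "\<mu> n = m0" and y: "y \<in> obs_space" and \<epsilon>: "\<epsilon> > 0"
  shows "\<exists>d>0. \<forall>y'\<in>obs_space. enn2real (obs_norm (\<lambda>i. y' i - y i)) < d \<longrightarrow>
    hellinger_dist (\<mu> n) (posterior G b \<mu> n y') (posterior G b \<mu> n y) < \<epsilon>"
proof -
  define Z where "Z = (\<integral>u. likelihood G b n y u \<partial>m0)"
  have Z: "Z > 0" using likelihood_integrable(2)[OF y] by (simp add: Z_def)
  define A where "A = exp ((real n)\<^sup>2 * pi * (enn2real (obs_norm y))\<^sup>2)"
  have A: "A > 0" by (simp add: A_def)
  \<comment> \<open>This weight makes \<open>c * A\<close> equal to \<epsilon>^2 Z, half of the
    budget. The other half is left to \<open>g\<close>, which is continuous and vanishes at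
    0.\<close>
  define c where "c = \<epsilon>\<^sup>2 * Z / A"
  have c: "c > 0" using Z A \<epsilon> by (simp add: c_def)
  define g where "g r = (exp ((real n)\<^sup>2 * pi * r\<^sup>2) - 1 + 2 * real n * r) / c" for r :: real
  have "isCont g 0" unfolding g_def using c by (intro continuous_intros) auto
  then have g_lim: "g \<midarrow>0\<rightarrow> 0" by (simp add: isCont_def g_def)
  have pos: "\<epsilon>\<^sup>2 * Z > 0" using \<epsilon> Z by simp
  from LIM_D[OF g_lim pos] obtain d
    where d: "d > 0" "\<forall>r. r \<noteq> 0 \<and> norm (r - 0) < d \<longrightarrow> norm (g r - 0) < \<epsilon>\<^sup>2 * Z"
    by blast
  have g: "g r < \<epsilon>\<^sup>2 * Z" if "0 \<le> r" "r < d" for r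
  proof (cases "r = 0")
    case True
    then show ?thesis using pos by (simp add: g_def)
  next
    case False
    then have "norm (g r - 0) < \<epsilon>\<^sup>2 * Z" using d(2) that by auto
    then show ?thesis by simp
  qed
  show ?thesis
  proof (intro exI conjI ballI impI)
    fix y' assume y': "y' \<in> obs_space" and lt: "enn2real (obs_norm (\<lambda>i. y' i - y i)) < d"
    define r where "r = enn2real (obs_norm (\<lambda>i. y' i - y i))"
    have "(hellinger_dist (\<mu> n) (posterior G b \<mu> n y') (posterior G b \<mu> n y))\<^sup>2
      \<le> (\<integral>u. \<bar>likelihood G b n y' u - likelihood G b n y u\<bar> \<partial>m0) / Z"
      unfolding Z_def by (rule hellinger_dist_posterior_le[of \<mu>, OF \<mu> y y'])
    also have "\<dots> \<le> ((c * A + g r) / 2) / Z"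
      using likelihood_L1_le[OF y y' c, of n] Z by (intro divide_right_mono) (auto simp: A_def g_def r_def)
    also have "\<dots> < ((c * A + \<epsilon>\<^sup>2 * Z) / 2) / Z"
      using g[of r] lt Z by (intro divide_strict_right_mono) (auto simp: r_def)
    also have "\<dots> = \<epsilon>\<^sup>2" using Z A by (simp add: c_def field_simps)
    finally show "hellinger_dist (\<mu> n) (posterior G b \<mu> n y') (posterior G b \<mu> n y) < \<epsilon>"
      using \<epsilon> by (simp add: power_less_imp_less_base)
  qed (rule d)
qed

section \<open>Almost sure membership of the observations\<close>

text \<open>Cauchy-Schwarz bounds all partial pairings at once by
  \<open>norm x * norm (G u)\<close>, which the second moment of the prior makes integrable.
  Pointwise convergence is Parseval's identity.\<close>

lemma signal_in_obs_space: "(\<lambda>i. x \<bullet> b i) \<in> obs_space"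
proof -
  have "(SUP m. ennreal (obs_weight m (\<lambda>i. x \<bullet> b i) u)) \<le> ennreal (norm x * norm (G u)) + ennreal (2 * norm x)" for u
  proof (rule SUP_least)
    fix m
    have "\<bar>partial_pairing (\<lambda>i. x \<bullet> b i) m u\<bar> \<le> norm x * norm (G u)"
    proof -
      have "partial_pairing (\<lambda>i. x \<bullet> b i) m u = (\<Sum>i<m. (x \<bullet> b i) *\<^sub>R b i) \<bullet> G u"
        by (simp add: partial_pairing_def inner_sum_left inner_commute[of "b _"])
      then have "\<bar>partial_pairing (\<lambda>i. x \<bullet> b i) m u\<bar> \<le> norm (\<Sum>i<m. (x \<bullet> b i) *\<^sub>R b i) * norm (G u)"
        by (simp add: Cauchy_Schwarz_ineq2)
      moreover have le: "norm (\<Sum>i<m. (x \<bullet> b i) *\<^sub>R b i) \<le> norm x"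
        using onb_bessel[OF b, of "{..<m}" x] onb_norm_sum[OF b, of "{..<m}" "\<lambda>i. x \<bullet> b i"]
        by (intro power2_le_imp_le[where x="norm (\<Sum>i<m. (x \<bullet> b i) *\<^sub>R b i)" and y="norm x"]) simp_all
      have "norm (\<Sum>i<m. (x \<bullet> b i) *\<^sub>R b i) * norm (G u) \<le> norm x * norm (G u)"
        by (rule mult_right_mono[OF le]) simp
      ultimately show ?thesis by linarith
    qed
    moreover have "(\<Sum>i<m. (1/2)^i * \<bar>x \<bullet> b i\<bar>) \<le> 2 * norm x"
    proof -
      have nb: "norm (b i) = 1" for i using onb_inner[OF b, of i i] by (simp add: norm_eq_sqrt_inner)
      have "(\<Sum>i<m. (1/2)^i * \<bar>x \<bullet> b i\<bar>) \<le> (\<Sum>i<m. (1/2)^i * norm x)"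
        using Cauchy_Schwarz_ineq2[of x "b _"] by (intro sum_mono mult_left_mono) (auto simp: nb)
      also have "\<dots> = (\<Sum>i<m. (1/2)^i) * norm x" by (simp add: sum_distrib_right)
      also have "(\<Sum>i<m. (1/2::real)^i) \<le> (\<Sum>i. (1/2)^i)" by (intro sum_le_suminf summable_geometric) auto
      also have "(\<Sum>i. (1/2::real)^i) = 2" by (subst suminf_geometric) auto
      finally show ?thesis by (simp add: mult_right_mono)
    qed
    ultimately have "ennreal (obs_weight m (\<lambda>i. x \<bullet> b i) u) \<le> ennreal (norm x * norm (G u) + 2 * norm x)"
      by (intro ennreal_leI) (simp add: obs_weight_def)
    then show "ennreal (obs_weight m (\<lambda>i. x \<bullet> b i) u) \<le> ennreal (norm x * norm (G u)) + ennreal (2 * norm x)"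
      by simp
  qed
  then have "obs_norm (\<lambda>i. x \<bullet> b i) \<le> (\<integral>\<^sup>+u. ennreal (norm x * norm (G u)) + ennreal (2 * norm x) \<partial>m0)"
    unfolding obs_norm_def by (intro nn_integral_mono)
  also have "\<dots> \<le> (\<integral>\<^sup>+u. ennreal ((norm x)\<^sup>2 + 2 * norm x) + ennreal ((onorm G)\<^sup>2) * ennreal ((norm u)\<^sup>2) \<partial>m0)"
  proof (intro nn_integral_mono)
    fix u
    have "norm x * norm (G u) \<le> (norm x)\<^sup>2 + (norm (G u))\<^sup>2"
      using sum_squares_bound[of "norm x" "norm (G u)"] mult_nonneg_nonneg[OF norm_ge_zero[of x] norm_ge_zero[of "G u"]] by linarith
    also have "(norm (G u))\<^sup>2 \<le> (onorm G * norm u)\<^sup>2" by (intro power_mono onorm[OF G]) simp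
    finally have "norm x * norm (G u) + 2 * norm x \<le> ((norm x)\<^sup>2 + 2 * norm x) + (onorm G)\<^sup>2 * (norm u)\<^sup>2"
      by (simp add: power_mult_distrib)
    then show "ennreal (norm x * norm (G u)) + ennreal (2 * norm x)
        \<le> ennreal ((norm x)\<^sup>2 + 2 * norm x) + ennreal ((onorm G)\<^sup>2) * ennreal ((norm u)\<^sup>2)"
      by (simp add: ennreal_mult[symmetric] ennreal_plus[symmetric] ennreal_leI del: ennreal_plus)
  qed
  also have "\<dots> < \<infinity>"
    using m0_moment by (simp add: nn_integral_add nn_integral_cmult ennreal_mult_less_top)
  finally have "obs_norm (\<lambda>i. x \<bullet> b i) < \<infinity>" .
  moreover have "summable (\<lambda>i. (x \<bullet> b i) * (G u \<bullet> b i))" for u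
    using onb_parseval[OF b] by (auto simp: sums_iff)
  ultimately show ?thesis by (simp add: obs_space_def)
qed

text \<open>Fubini reduces both conditions to a fixed \<open>u\<close>. There the noise series
  converges almost surely, and the mean of its supremum is at most a constant plus a multiple of
  \<open>(norm (G u))\<^sup>2\<close>, which is integrable under the prior.\<close>

lemma noise_in_obs_space: "AE \<omega> in P. noise_coords \<omega> \<in> obs_space"
proof -
  let ?c = "\<Sum>l. 1 / (real (Suc l))\<^sup>2"
  have c: "0 \<le> ?c"
    using inverse_power_summable[of 2, where 'a=real, THEN summable_Suc_iff[THEN iffD2]]
    by (intro suminf_nonneg) (simp_all add: inverse_eq_divide)
  have [measurable]: "(\<lambda>z. obs_weight m (noise_coords (snd z)) (fst z)) \<in> borel_measurable (m0 \<Otimes>\<^sub>M P)" for m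
    unfolding obs_weight_def partial_pairing_def by measurable
  have inner: "(\<integral>\<^sup>+\<omega>. (SUP m. ennreal (obs_weight m (noise_coords \<omega>) u)) \<partial>P)
      \<le> ennreal (1 + (norm (G u))\<^sup>2 * ?c) + ennreal 2" for u
  proof -
    have "(\<integral>\<^sup>+\<omega>. (SUP m. ennreal (obs_weight m (noise_coords \<omega>) u)) \<partial>P)
        \<le> (\<integral>\<^sup>+\<omega>. (SUP m. ennreal \<bar>partial_pairing (noise_coords \<omega>) m u\<bar>) + (\<Sum>i. ennreal ((1/2)^i * \<bar>noise_coords \<omega> i\<bar>)) \<partial>P)"
    proof (intro nn_integral_mono SUP_least)
      fix \<omega> m
      have "ennreal (obs_weight m (noise_coords \<omega>) u)
          = ennreal \<bar>partial_pairing (noise_coords \<omega>) m u\<bar> + (\<Sum>i<m. ennreal ((1/2)^i * \<bar>noise_coords \<omega> i\<bar>))"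
        by (simp add: obs_weight_def sum_nonneg)
      also have "\<dots> \<le> (SUP m. ennreal \<bar>partial_pairing (noise_coords \<omega>) m u\<bar>) + (\<Sum>i. ennreal ((1/2)^i * \<bar>noise_coords \<omega> i\<bar>))"
        by (intro add_mono SUP_upper sum_le_suminf summableI) auto
      finally show "ennreal (obs_weight m (noise_coords \<omega>) u)
          \<le> (SUP m. ennreal \<bar>partial_pairing (noise_coords \<omega>) m u\<bar>) + (\<Sum>i. ennreal ((1/2)^i * \<bar>noise_coords \<omega> i\<bar>))" .
    qed
    also have "\<dots> = (\<integral>\<^sup>+\<omega>. (SUP m. ennreal \<bar>\<Sum>i<m. noise_coords \<omega> i * (G u \<bullet> b i)\<bar>) \<partial>P)
        + (\<Sum>i. \<integral>\<^sup>+\<omega>. ennreal ((1/2)^i * \<bar>noise_coords \<omega> i\<bar>) \<partial>P)"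
      unfolding partial_pairing_def by (subst nn_integral_add) (auto simp: nn_integral_suminf)
    also have "\<dots> \<le> ennreal (1 + (norm (G u))\<^sup>2 * ?c) + (\<Sum>i. ennreal ((1/2)^i))"
    proof (intro add_mono noise_expected_supremum suminf_le summableI)
      fix i
      have nb: "(norm (b i))\<^sup>2 = 1" using onb_inner[OF b, of i i] by (simp add: power2_norm_eq_inner)
      have "(\<integral>\<^sup>+\<omega>. ennreal ((1/2)^i * \<bar>noise_coords \<omega> i\<bar>) \<partial>P) = ennreal ((1/2)^i) * (\<integral>\<^sup>+\<omega>. ennreal \<bar>noise_coords \<omega> i\<bar> \<partial>P)"
        by (simp add: ennreal_mult nn_integral_cmult)
      also have "\<dots> = ennreal ((1/2)^i) * ennreal (sqrt (2 / pi))"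
        using centered_normal_abs_moment[OF noise_normal[of "b i"]] by (simp add: nb)
      also have "\<dots> \<le> ennreal ((1/2)^i) * ennreal 1"
        using pi_gt3 by (intro mult_left_mono ennreal_leI) auto
      finally show "(\<integral>\<^sup>+\<omega>. ennreal ((1/2)^i * \<bar>noise_coords \<omega> i\<bar>) \<partial>P) \<le> ennreal ((1/2)^i)" by simp
    qed
    also have "(\<Sum>i. ennreal ((1/2)^i)) = ennreal (\<Sum>i. (1/2)^i)" by (intro suminf_ennreal_eq) auto
    also have "(\<Sum>i. (1/2::real)^i) = 2" by (subst suminf_geometric) auto
    finally show ?thesis .
  qed
  have "(\<integral>\<^sup>+\<omega>. obs_norm (noise_coords \<omega>) \<partial>P) = (\<integral>\<^sup>+u. \<integral>\<^sup>+\<omega>. (SUP m. ennreal (obs_weight m (noise_coords \<omega>) u)) \<partial>P \<partial>m0)"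
    unfolding obs_norm_def by (rule Fubini') (simp add: case_prod_beta')
  also have "\<dots> \<le> (\<integral>\<^sup>+u. ennreal 3 + ennreal (?c * (onorm G)\<^sup>2) * ennreal ((norm u)\<^sup>2) \<partial>m0)"
  proof (intro nn_integral_mono order_trans[OF inner])
    fix u
    have "(norm (G u))\<^sup>2 \<le> (onorm G * norm u)\<^sup>2" by (intro power_mono onorm[OF G]) simp
    then have "(norm (G u))\<^sup>2 * ?c \<le> (onorm G * norm u)\<^sup>2 * ?c" using c by (intro mult_right_mono)
    then have "1 + (norm (G u))\<^sup>2 * ?c + 2 \<le> 3 + (?c * (onorm G)\<^sup>2) * (norm u)\<^sup>2"
      by (simp add: power_mult_distrib mult_ac)
    then show "ennreal (1 + (norm (G u))\<^sup>2 * ?c) + ennreal 2 \<le> ennreal 3 + ennreal (?c * (onorm G)\<^sup>2) * ennreal ((norm u)\<^sup>2)"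
      using c by (simp add: ennreal_mult[symmetric] ennreal_plus[symmetric] ennreal_leI del: ennreal_plus ennreal_numeral)
  qed
  also have "\<dots> < \<infinity>"
    using m0_moment by (simp add: nn_integral_add nn_integral_cmult ennreal_mult_less_top)
  finally have fin: "(\<integral>\<^sup>+\<omega>. obs_norm (noise_coords \<omega>) \<partial>P) < \<infinity>" .
  have [measurable]: "(\<lambda>\<omega>. obs_norm (noise_coords \<omega>)) \<in> borel_measurable P"
  proof -
    have [measurable]: "(\<lambda>z. obs_weight m (noise_coords (fst z)) (snd z)) \<in> borel_measurable (P \<Otimes>\<^sub>M m0)" for m
      unfolding obs_weight_def partial_pairing_def by measurable
    show ?thesis unfolding obs_norm_def
      by (rule m0.borel_measurable_nn_integral) (simp add: case_prod_beta')
  qed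
  have "AE \<omega> in P. obs_norm (noise_coords \<omega>) \<noteq> \<infinity>"
    by (rule nn_integral_PInf_AE) (use fin in auto)
  moreover have "AE \<omega> in P. AE u in m0. summable (\<lambda>i. noise_coords \<omega> i * (G u \<bullet> b i))"
  proof (subst AE_commute[symmetric])
    have "Measurable.pred (m0 \<Otimes>\<^sub>M P) (\<lambda>x. summable (\<lambda>i. noise_coords (snd x) i * (G (fst x) \<bullet> b i)))"
      by measurable
    then show "{x \<in> space (m0 \<Otimes>\<^sub>M P). summable (\<lambda>i. noise_coords (snd x) i * (G (fst x) \<bullet> b i))} \<in> sets (m0 \<Otimes>\<^sub>M P)"
      by (simp add: pred_def)
    show "AE u in m0. AE \<omega> in P. summable (\<lambda>i. noise_coords \<omega> i * (G u \<bullet> b i))"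
      by (intro AE_I2 noise_pairing_summable)
  qed
  ultimately show ?thesis
    by eventually_elim (simp add: obs_space_def less_top)
qed

lemma observation_in_obs_space:
  assumes "noise_coords \<omega> \<in> obs_space"
  shows "observation G b \<eta> n u \<omega> \<in> obs_space"
proof -
  have eq: "observation G b \<eta> n u \<omega> = (\<lambda>i. G u \<bullet> b i + (1 / sqrt (real n)) * noise_coords \<omega> i)"
    by (simp add: observation_def fun_eq_iff)
  show ?thesis
    unfolding eq by (rule obs_space_add[OF signal_in_obs_space obs_space_scale[OF assms]])
qed

text \<open>A good noise realisation is good for every \<open>u\<close>, so the exceptional set sits
  inside a product with a null set of noise. Working with this enclosing set sidesteps the
  measurability of \<open>obs_space\<close>.\<close>

lemma AE_pair_observation_in_obs_space:
  "AE z in m0 \<Otimes>\<^sub>M P. observation G b \<eta> n (fst z) (snd z) \<in> obs_space"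
proof -
  from noise_in_obs_space obtain N where N: "N \<in> null_sets P" "{\<omega> \<in> space P. noise_coords \<omega> \<notin> obs_space} \<subseteq> N"
    by (rule AE_E3) auto
  then have "emeasure (m0 \<Otimes>\<^sub>M P) (space m0 \<times> N) = emeasure m0 (space m0) * emeasure P N"
    by (intro sigma_finite_measure.emeasure_pair_measure_Times[OF prob_space_imp_sigma_finite]
        prob_spaceI P.emeasure_space_1) auto
  then have "space m0 \<times> N \<in> null_sets (m0 \<Otimes>\<^sub>M P)"
    using N(1) by (auto simp: null_sets_def simp del: space_m0)
  then show ?thesis
  proof (rule AE_I')
    show "{z \<in> space (m0 \<Otimes>\<^sub>M P). observation G b \<eta> n (fst z) (snd z) \<notin> obs_space} \<subseteq> space m0 \<times> N"
      using N(2) observation_in_obs_space by (auto simp: space_pair_measure)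
  qed
qed

end

lemma well_posedI:
  assumes "\<And>n. n \<ge> 1 \<Longrightarrow> gaussian_regression P \<eta> b G (\<mu> n)"
  shows "well_posed P G b \<eta> \<mu>"
  unfolding well_posed_def
proof (intro allI impI)
  fix n :: nat assume "n \<ge> 1"
  then interpret gaussian_regression P \<eta> b G "\<mu> n" by (rule assms)
  show "\<exists>Y N. banach_sequence_space Y N \<and>
        (AE z in \<mu> n \<Otimes>\<^sub>M P. observation G b \<eta> n (fst z) (snd z) \<in> Y) \<and>
        (\<forall>y\<in>Y. (AE u in \<mu> n. summable (\<lambda>i. y i * (G u \<bullet> b i))) \<and> prob_space (posterior G b \<mu> n y)) \<and>
        (\<forall>y\<in>Y. \<forall>\<epsilon>>0. \<exists>d>0. \<forall>y'\<in>Y. N (\<lambda>i. y' i - y i) < d \<longrightarrow>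
           hellinger_dist (\<mu> n) (posterior G b \<mu> n y') (posterior G b \<mu> n y) < \<epsilon>)"
  proof (rule exI[of _ obs_space], rule exI[of _ "\<lambda>y. enn2real (obs_norm y)"], intro conjI ballI allI impI)
    show "banach_sequence_space obs_space (\<lambda>y. enn2real (obs_norm y))" by (rule obs_banach)
    show "AE z in \<mu> n \<Otimes>\<^sub>M P. observation G b \<eta> n (fst z) (snd z) \<in> obs_space"
      by (rule AE_pair_observation_in_obs_space)
    fix y assume y: "y \<in> obs_space"
    show "AE u in \<mu> n. summable (\<lambda>i. y i * (G u \<bullet> b i))" using y by (simp add: obs_space_def)
    show "prob_space (posterior G b \<mu> n y)" by (rule posterior_prob_space[of \<mu> n y, OF refl y])
    show "\<exists>d>0. \<forall>y'\<in>obs_space. enn2real (obs_norm (\<lambda>i. y' i - y i)) < d \<longrightarrow>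
           hellinger_dist (\<mu> n) (posterior G b \<mu> n y') (posterior G b \<mu> n y) < \<epsilon>" if "\<epsilon> > 0" for \<epsilon>
      by (rule posterior_hellinger_continuous[of \<mu>, OF refl y that])
  qed
qed

section \<open>The posterior in the spectral basis\<close>

locale gaussian_regression_eigenbasis = gaussian_regression P \<eta> b G m0
  for P :: "'w measure" and \<eta> :: "'b::{real_inner, complete_space, second_countable_topology} \<Rightarrow> 'w \<Rightarrow> real"
    and b :: "nat \<Rightarrow> 'b"
    and G :: "'a::{real_inner, complete_space, second_countable_topology} \<Rightarrow> 'b"
    and m0 :: "'a measure" +
  fixes e :: "nat \<Rightarrow> 'a" and \<rho> :: "nat \<Rightarrow> real"
  assumes e: "orthonormal_basis_on UNIV e"
    and eig: "\<And>k. adjoint G (G (e k)) = (\<rho> k)\<^sup>2 *\<^sub>R e k"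
    and \<rho>_pos: "\<And>k. 0 < \<rho> k"
begin

definition head :: "nat \<Rightarrow> 'a \<Rightarrow> 'a" where
  "head d h = (\<Sum>k<d. (h \<bullet> e k) *\<^sub>R e k)"

lemma head_measurable [measurable]: "head d \<in> borel_measurable borel"
  unfolding head_def[abs_def] by measurable

lemma G_e_inner: "G v \<bullet> G (e k) = (\<rho> k)\<^sup>2 * (v \<bullet> e k)"
  by (rule gram_eigenbasis_inner[OF e G eig])

lemma G_head_norm: "(norm (G (head d h)))\<^sup>2 = (\<Sum>k<d. (\<rho> k)\<^sup>2 * (h \<bullet> e k)\<^sup>2)"
  unfolding head_def by (rule gram_eigenbasis_norm_sum[OF e G eig]) simp

lemma G_head_Pythagoras: "(norm (G h))\<^sup>2 = (norm (G (head d h)))\<^sup>2 + (norm (G (h - head d h)))\<^sup>2"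
proof -
  have "G (h - head d h) \<bullet> G (e k) = 0" if "k < d" for k
    using G_e_inner[of "h - head d h" k] that
    by (simp add: head_def inner_diff_left onb_inner_sum[OF e])
  then have "G (h - head d h) \<bullet> G (head d h) = 0"
    by (simp add: head_def G.sum G.scaleR inner_sum_right)
  then have 0: "G (head d h) \<bullet> G (h - head d h) = 0" by (simp add: inner_commute)
  have "G h = G (head d h) + G (h - head d h)" by (simp add: G.diff)
  then show ?thesis using 0 by (simp only: norm_add_Pythagorean orthogonal_def)
qed

text \<open>The Cameron-Martin density of the data law at \<open>u0 + h\<close> with respect to the
  one at \<open>u0\<close>, as a function of the noise behind the data. Values in
  \<open>ennreal\<close> let integrals over parameter and noise be exchanged freely.\<close>

definition lr :: "nat \<Rightarrow> 'a \<Rightarrow> 'w \<Rightarrow> ennreal" where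
  "lr n h \<omega> = ennreal (exp (sqrt (real n) * pairing b (noise_coords \<omega>) (G h) - real n / 2 * (norm (G h))\<^sup>2))"

text \<open>The exponential moment of the noise at sqrt n cancels the quadratic term
  exactly.\<close>

lemma nn_integral_lr: "(\<integral>\<^sup>+\<omega>. lr n h \<omega> \<partial>P) = 1"
proof -
  have "(\<integral>\<^sup>+\<omega>. lr n h \<omega> \<partial>P)
      = (\<integral>\<^sup>+\<omega>. ennreal (exp (- (real n / 2 * (norm (G h))\<^sup>2))) * ennreal (exp (sqrt (real n) * pairing b (noise_coords \<omega>) (G h))) \<partial>P)"
    by (simp add: lr_def ennreal_mult[symmetric] mult_exp_exp algebra_simps)
  also have "\<dots> = ennreal (exp (- (real n / 2 * (norm (G h))\<^sup>2))) * ennreal (exp ((sqrt (real n))\<^sup>2 * (norm (G h))\<^sup>2 / 2))"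
    using centered_normal_measurable[OF noise_pairing_normal[of "G h"]]
    by (subst nn_integral_cmult) (simp_all add: centered_normal_mgf[OF noise_pairing_normal])
  also have "\<dots> = 1"
    by (simp add: ennreal_mult[symmetric] mult_exp_exp)
  finally show ?thesis .
qed

lemma lr_section_measurable [measurable]:
  assumes [measurable]: "f \<in> borel_measurable borel" and \<omega>: "\<omega> \<in> space P"
  shows "(\<lambda>u. lr n (f u) \<omega>) \<in> borel_measurable m0"
  unfolding lr_def pairing_def by measurable

text \<open>Completing the square turns the likelihood at data generated from \<open>u0\<close> into the likelihood
  ratio \<open>lr\<close> at \<open>u - u0\<close>, up to a factor that does not depend on \<open>u\<close>.\<close>

lemma posterior_lr:
  assumes n: "n \<ge> 1" and \<mu>: "\<mu> n = m0"
  shows "AE \<omega> in P. \<forall>A\<in>sets m0.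
    emeasure (posterior G b \<mu> n (observation G b \<eta> n u0 \<omega>)) A * (\<integral>\<^sup>+u. lr n (u - u0) \<omega> \<partial>m0)
      = (\<integral>\<^sup>+u. lr n (u - u0) \<omega> * indicator A u \<partial>m0) \<and>
    prob_space (posterior G b \<mu> n (observation G b \<eta> n u0 \<omega>))"
  using noise_in_obs_space noise_pairing_summable[of "G u0"] AE_space
proof eventually_elim
  case (elim \<omega>)
  define y where "y = observation G b \<eta> n u0 \<omega>"
  have y: "y \<in> obs_space" unfolding y_def by (rule observation_in_obs_space) (use elim in simp)
  define c where "c = exp (real n / 2 * (norm (G u0))\<^sup>2 + sqrt (real n) * pairing b (noise_coords \<omega>) (G u0))"
  have c: "c > 0" by (simp add: c_def)
  define Z where "Z = (\<integral>v. likelihood G b n y v \<partial>m0)"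
  have Z: "Z > 0" using likelihood_integrable[OF y, of n] by (simp add: Z_def)
  have "AE u in m0. summable (\<lambda>i. noise_coords \<omega> i * (G u \<bullet> b i))"
    using elim by (simp add: obs_space_def)
  then have lik: "AE u in m0. ennreal (likelihood G b n y u) = ennreal c * lr n (u - u0) \<omega>"
  proof eventually_elim
    fix u assume s: "summable (\<lambda>i. noise_coords \<omega> i * (G u \<bullet> b i))"
    have sG: "summable (\<lambda>i. (G u0 \<bullet> b i) * (G u \<bullet> b i))" "pairing b (\<lambda>i. G u0 \<bullet> b i) (G u) = G u0 \<bullet> G u"
      using onb_parseval[OF b, of "G u0" "G u"] by (auto simp: sums_iff pairing_def)
    note sc = pairing_scale_left[OF s, of "1 / sqrt (real n)"]
    have "y = (\<lambda>i. G u0 \<bullet> b i + (1 / sqrt (real n)) * noise_coords \<omega> i)"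
      by (simp add: y_def observation_def fun_eq_iff)
    then have py: "pairing b y (G u) = G u0 \<bullet> G u + (1 / sqrt (real n)) * pairing b (noise_coords \<omega>) (G u)"
      using pairing_add_left(2)[OF sG(1) sc(1)] sG(2) sc(2) by simp
    have pd: "pairing b (noise_coords \<omega>) (G (u - u0)) = pairing b (noise_coords \<omega>) (G u) - pairing b (noise_coords \<omega>) (G u0)"
      using pairing_diff_right(2)[OF s elim(2)] by (simp add: G.diff)
    have nn: "real n * (1 / sqrt (real n)) = sqrt (real n)"
      using n by (simp add: real_div_sqrt)
    have sq: "(norm (G (u - u0)))\<^sup>2 = (norm (G u))\<^sup>2 - 2 * (G u0 \<bullet> G u) + (norm (G u0))\<^sup>2"
      by (simp add: G.diff power2_norm_eq_inner inner_diff_left inner_diff_right inner_commute)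
    have "- (real n / 2) * (norm (G u))\<^sup>2 + real n * pairing b y (G u)
        = (real n / 2 * (norm (G u0))\<^sup>2 + sqrt (real n) * pairing b (noise_coords \<omega>) (G u0))
          + (sqrt (real n) * pairing b (noise_coords \<omega>) (G (u - u0)) - real n / 2 * (norm (G (u - u0)))\<^sup>2)"
    proof -
      have "real n * pairing b y (G u) = real n * (G u0 \<bullet> G u) + sqrt (real n) * pairing b (noise_coords \<omega>) (G u)"
        unfolding py by (simp only: distrib_left mult.assoc[symmetric] nn)
      then show ?thesis unfolding pd sq by (simp add: algebra_simps)
    qed
    then have "likelihood G b n y u = c * exp (sqrt (real n) * pairing b (noise_coords \<omega>) (G (u - u0)) - real n / 2 * (norm (G (u - u0)))\<^sup>2)"
      unfolding likelihood_def c_def by (simp only: exp_add)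
    then show "ennreal (likelihood G b n y u) = ennreal c * lr n (u - u0) \<omega>"
      using c by (simp add: lr_def ennreal_mult)
  qed
  have [measurable]: "(\<lambda>u. lr n (u - u0) \<omega>) \<in> borel_measurable m0"
    by (rule lr_section_measurable) (use elim in auto)
  have ZD: "ennreal Z = ennreal c * (\<integral>\<^sup>+u. lr n (u - u0) \<omega> \<partial>m0)"
  proof -
    have "ennreal Z = (\<integral>\<^sup>+u. ennreal (likelihood G b n y u) \<partial>m0)"
      unfolding Z_def using likelihood_integrable(1)[OF y, of n]
      by (subst nn_integral_eq_integral) (auto simp: likelihood_pos less_imp_le)
    also have "\<dots> = (\<integral>\<^sup>+u. ennreal c * lr n (u - u0) \<omega> \<partial>m0)"
      by (rule nn_integral_cong_AE[OF lik])
    also have "\<dots> = ennreal c * (\<integral>\<^sup>+u. lr n (u - u0) \<omega> \<partial>m0)" by (rule nn_integral_cmult) measurable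
    finally show ?thesis .
  qed
  have "emeasure (posterior G b \<mu> n y) A * (\<integral>\<^sup>+u. lr n (u - u0) \<omega> \<partial>m0)
      = (\<integral>\<^sup>+u. lr n (u - u0) \<omega> * indicator A u \<partial>m0)" if [measurable]: "A \<in> sets m0" for A
  proof -
    have "emeasure (posterior G b \<mu> n y) A = (\<integral>\<^sup>+u. ennreal (likelihood G b n y u / Z) * indicator A u \<partial>m0)"
      unfolding posterior_eq_density[of \<mu>, OF \<mu>] Z_def[symmetric] by (subst emeasure_density) auto
    also have "\<dots> = (\<integral>\<^sup>+u. ennreal (c / Z) * (lr n (u - u0) \<omega> * indicator A u) \<partial>m0)"
    proof (rule nn_integral_cong_AE, use lik in eventually_elim)
      fix u assume "ennreal (likelihood G b n y u) = ennreal c * lr n (u - u0) \<omega>"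
      then have "ennreal (1 / Z) * ennreal (likelihood G b n y u) = (ennreal (1 / Z) * ennreal c) * lr n (u - u0) \<omega>"
        by (simp only: mult.assoc)
      then have "ennreal (likelihood G b n y u / Z) = ennreal (c / Z) * lr n (u - u0) \<omega>"
        using Z c by (simp add: ennreal_mult[symmetric] likelihood_pos less_imp_le)
      then show "ennreal (likelihood G b n y u / Z) * indicator A u = ennreal (c / Z) * (lr n (u - u0) \<omega> * indicator A u)"
        by (simp only: mult.assoc)
    qed
    also have "\<dots> = ennreal (c / Z) * (\<integral>\<^sup>+u. lr n (u - u0) \<omega> * indicator A u \<partial>m0)"
      by (rule nn_integral_cmult) measurable
    finally have "emeasure (posterior G b \<mu> n y) A * (\<integral>\<^sup>+u. lr n (u - u0) \<omega> \<partial>m0)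
        = (ennreal (1 / Z) * (ennreal c * (\<integral>\<^sup>+u. lr n (u - u0) \<omega> \<partial>m0))) * (\<integral>\<^sup>+u. lr n (u - u0) \<omega> * indicator A u \<partial>m0)"
      using Z c ennreal_mult[of "1 / Z" c] by (simp add: mult_ac)
    also have "\<dots> = (\<integral>\<^sup>+u. lr n (u - u0) \<omega> * indicator A u \<partial>m0)"
      unfolding ZD[symmetric] using Z by (simp add: ennreal_mult[symmetric])
    finally show ?thesis .
  qed
  moreover have "prob_space (posterior G b \<mu> n y)"
    by (rule posterior_prob_space[of \<mu> n y, OF \<mu> y])
  ultimately show ?case by (simp add: y_def)
qed

text \<open>The variables \<open>\<xi> k\<close> are independent standard normal, as the
  \<open>G (e k)\<close> are orthogonal with length \<open>\<rho> k\<close>. Exponential Markov with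
  parameter 1/4, the largest that \<open>gaussian_exp_square_sum\<close> admits at unit variance,
  gives exp (-d) times the moment bound exp (d / 2).\<close>

lemma noise_head_tail:
  "emeasure P {\<omega> \<in> space P. 4 * real d < (\<Sum>k<d. (\<eta> (G (e k)) \<omega> / \<rho> k)\<^sup>2)} \<le> ennreal (exp (- (real d / 2)))"
proof -
  define \<xi> where "\<xi> k \<omega> = (1 / \<rho> k) * \<eta> (G (e k)) \<omega>" for k \<omega>
  have \<xi>: "centered_gaussian_process P \<xi> (\<lambda>i k. (1 / \<rho> i) * (1 / \<rho> k) * (G (e i) \<bullet> G (e k)))"
    unfolding \<xi>_def[abs_def]
    by (rule centered_gaussian_process_scale[OF centered_gaussian_process_reindex[OF noise_process]])
  have K: "(1 / \<rho> i) * (1 / \<rho> k) * (G (e i) \<bullet> G (e k)) = (if i = k then 1 else 0)" for i k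
    using G_e_inner[of "e i" k] \<rho>_pos[of i] \<rho>_pos[of k]
    by (auto simp: onb_inner[OF e] power2_eq_square)
  have [measurable]: "\<xi> k \<in> borel_measurable P" for k unfolding \<xi>_def[abs_def] by measurable
  let ?S = "\<lambda>\<omega>. \<Sum>k<d. (\<xi> k \<omega>)\<^sup>2"
  have "emeasure P {\<omega> \<in> space P. 4 * real d < ?S \<omega>}
      \<le> emeasure P {\<omega> \<in> space P. 1 \<le> ennreal (exp (- real d)) * ennreal (exp (1/4 * ?S \<omega>))}"
  proof (rule emeasure_mono)
    show "{\<omega> \<in> space P. 4 * real d < ?S \<omega>} \<subseteq> {\<omega> \<in> space P. 1 \<le> ennreal (exp (- real d)) * ennreal (exp (1/4 * ?S \<omega>))}"
      by (auto simp: ennreal_mult[symmetric] mult_exp_exp ennreal_1[symmetric] ennreal_le_iff simp del: ennreal_1)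
  qed measurable
  also have "\<dots> \<le> ennreal (exp (- real d)) * (\<integral>\<^sup>+\<omega>. ennreal (exp (1/4 * ?S \<omega>)) * indicator (space P) \<omega> \<partial>P)"
    by (rule nn_integral_Markov_inequality) measurable
  also have "(\<integral>\<^sup>+\<omega>. ennreal (exp (1/4 * ?S \<omega>)) * indicator (space P) \<omega> \<partial>P) = (\<integral>\<^sup>+\<omega>. ennreal (exp (1/4 * ?S \<omega>)) \<partial>P)"
    by (intro nn_integral_cong) simp
  also have "\<dots> \<le> ennreal (exp (2 * (1/4) * (\<Sum>k<d. (1 / \<rho> k) * (1 / \<rho> k) * (G (e k) \<bullet> G (e k)))))"
    by (rule gaussian_exp_square_sum[OF \<xi>]) (simp_all only: K, simp_all)
  also have "\<dots> = ennreal (exp (real d / 2))" by (simp only: K) simp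
  also have "ennreal (exp (- real d)) * ennreal (exp (real d / 2)) = ennreal (exp (- (real d / 2)))"
    by (simp add: ennreal_mult[symmetric] mult_exp_exp)
  finally show ?thesis by (simp add: \<xi>_def mult_left_mono)
qed

text \<open>By Cauchy-Schwarz in the coordinates scaled with \<open>\<rho>\<close>, the noise term
  of the head is at most sqrt n * N1 * 2 sqrt d. The factor 64 makes sqrt d at most sqrt n * N1 / 8,
  so this is at most n N1^2 / 4, half of the quadratic term; what is left is at most -K / 4.\<close>

lemma lr_head_bound:
  assumes s: "summable (\<lambda>i. noise_coords \<omega> i * (G h \<bullet> b i))"
    and se: "\<And>k. summable (\<lambda>i. noise_coords \<omega> i * (G (e k) \<bullet> b i))"
    and pe: "\<And>k. pairing b (noise_coords \<omega>) (G (e k)) = \<eta> (G (e k)) \<omega>"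
    and E: "(\<Sum>k<d. (\<eta> (G (e k)) \<omega> / \<rho> k)\<^sup>2) \<le> 4 * real d"
    and K: "64 * real d \<le> K" "K \<le> real n * (norm (G (head d h)))\<^sup>2"
  shows "lr n h \<omega> \<le> ennreal (exp (- K / 4)) * lr n (h - head d h) \<omega>"
proof -
  define S where "S = (\<Sum>k<d. (h \<bullet> e k) * \<eta> (G (e k)) \<omega>)"
  define N1 where "N1 = norm (G (head d h))"
  have Gh: "G (head d h) = (\<Sum>k<d. (h \<bullet> e k) *\<^sub>R G (e k))" by (simp add: head_def G.sum G.scaleR)
  have ph: "summable (\<lambda>i. noise_coords \<omega> i * (G (head d h) \<bullet> b i))" "pairing b (noise_coords \<omega>) (G (head d h)) = S"
    using pairing_sum_right[of "{..<d}" "noise_coords \<omega>" "\<lambda>k. G (e k)" b "\<lambda>k. h \<bullet> e k"] se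
    by (simp_all add: Gh S_def pe)
  have split: "pairing b (noise_coords \<omega>) (G h) = S + pairing b (noise_coords \<omega>) (G (h - head d h))"
    using pairing_diff_right(2)[OF s ph(1)] ph(2) by (simp add: G.diff)
  have "S \<le> N1 * (2 * sqrt (real d))"
  proof -
    have "S = (\<Sum>k<d. (\<rho> k * (h \<bullet> e k)) * (\<eta> (G (e k)) \<omega> / \<rho> k))"
      unfolding S_def using \<rho>_pos by (intro sum.cong) (auto simp: less_imp_neq[THEN not_sym])
    also have "\<dots> \<le> \<bar>\<dots>\<bar>" by simp
    also have "\<dots> \<le> sqrt (\<Sum>k<d. (\<rho> k * (h \<bullet> e k))\<^sup>2) * sqrt (\<Sum>k<d. (\<eta> (G (e k)) \<omega> / \<rho> k)\<^sup>2)"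
    proof -
      have "(\<Sum>k<d. (\<rho> k * (h \<bullet> e k)) * (\<eta> (G (e k)) \<omega> / \<rho> k))\<^sup>2
          \<le> (\<Sum>k<d. (\<rho> k * (h \<bullet> e k))\<^sup>2) * (\<Sum>k<d. (\<eta> (G (e k)) \<omega> / \<rho> k)\<^sup>2)"
        by (rule Cauchy_Schwarz_ineq_sum)
      then have "sqrt ((\<Sum>k<d. (\<rho> k * (h \<bullet> e k)) * (\<eta> (G (e k)) \<omega> / \<rho> k))\<^sup>2)
          \<le> sqrt ((\<Sum>k<d. (\<rho> k * (h \<bullet> e k))\<^sup>2) * (\<Sum>k<d. (\<eta> (G (e k)) \<omega> / \<rho> k)\<^sup>2))"
        by (rule real_sqrt_le_mono)
      then show ?thesis by (simp only: real_sqrt_abs real_sqrt_mult)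
    qed
    also have "(\<Sum>k<d. (\<rho> k * (h \<bullet> e k))\<^sup>2) = N1\<^sup>2" by (simp add: N1_def G_head_norm power_mult_distrib)
    also have "sqrt (N1\<^sup>2) * sqrt (\<Sum>k<d. (\<eta> (G (e k)) \<omega> / \<rho> k)\<^sup>2) \<le> N1 * sqrt (4 * real d)"
      using E by (intro mult_mono real_sqrt_le_mono) (auto simp: N1_def intro: sum_nonneg)
    finally show ?thesis by (simp add: real_sqrt_mult)
  qed
  then have "sqrt (real n) * S \<le> sqrt (real n) * (N1 * (2 * sqrt (real d)))"
    by (intro mult_left_mono) auto
  also have "\<dots> = 2 * (sqrt (real n) * N1) * sqrt (real d)" by simp
  also have "\<dots> \<le> 2 * (sqrt (real n) * N1) * (sqrt (real n) * N1 / 8)"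
  proof (intro mult_left_mono)
    have "64 * real d \<le> real n * N1\<^sup>2" using K by (simp add: N1_def)
    then have "sqrt (64 * real d) \<le> sqrt (real n * N1\<^sup>2)" by (rule real_sqrt_le_mono)
    then show "sqrt (real d) \<le> sqrt (real n) * N1 / 8" by (simp add: real_sqrt_mult N1_def)
  qed (simp add: N1_def)
  also have "\<dots> = (sqrt (real n) * sqrt (real n)) * N1\<^sup>2 / 4" by (simp add: power2_eq_square)
  also have "\<dots> = real n * N1\<^sup>2 / 4" by simp
  finally have S: "sqrt (real n) * S - real n / 2 * N1\<^sup>2 \<le> - K / 4" using K by (simp add: N1_def)
  have "sqrt (real n) * pairing b (noise_coords \<omega>) (G h) - real n / 2 * (norm (G h))\<^sup>2
      = (sqrt (real n) * S - real n / 2 * N1\<^sup>2)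
        + (sqrt (real n) * pairing b (noise_coords \<omega>) (G (h - head d h)) - real n / 2 * (norm (G (h - head d h)))\<^sup>2)"
    unfolding split G_head_Pythagoras[of h d] N1_def[symmetric] by (simp add: algebra_simps)
  also have "\<dots> \<le> - K / 4
        + (sqrt (real n) * pairing b (noise_coords \<omega>) (G (h - head d h)) - real n / 2 * (norm (G (h - head d h)))\<^sup>2)"
    using S by simp
  finally show ?thesis
    unfolding lr_def by (simp add: ennreal_mult[symmetric] mult_exp_exp ennreal_leI)
qed

text \<open>On \<open>B\<close> the exponent of the likelihood ratio has mean at least \<open>- Q / 2\<close> and variance at most
  \<open>Q\<close>, so Chebyshev's inequality applies to most of \<open>B\<close>.\<close>

lemma evidence_lower_bound:
  assumes B[measurable]: "B \<in> sets m0" and \<beta>: "emeasure m0 B = ennreal \<beta>" "\<beta> > 0" and Q: "Q > 0"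
    and le: "\<And>u. u \<in> B \<Longrightarrow> real n * (norm (G (u - u0)))\<^sup>2 \<le> Q"
  shows "\<exists>T\<in>sets P. emeasure P T \<le> ennreal (2 / Q) \<and>
    (\<forall>\<omega>\<in>space P - T. ennreal (\<beta> / 2 * exp (- 3 / 2 * Q)) \<le> (\<integral>\<^sup>+u. lr n (u - u0) \<omega> \<partial>m0))"
proof -
  define N where "N = (\<lambda>(u, \<omega>). sqrt (real n) * pairing b (noise_coords \<omega>) (G (u - u0)))"
  have Nm[measurable]: "N \<in> borel_measurable (m0 \<Otimes>\<^sub>M P)"
    unfolding N_def pairing_def by measurable
  define bad where "bad = (\<lambda>(u, \<omega>). indicator B u * indicator {x. x < - Q} (N (u, \<omega>)) :: ennreal)"
  have badm[measurable]: "bad \<in> borel_measurable (m0 \<Otimes>\<^sub>M P)" unfolding bad_def by measurable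
  have badm2[measurable]: "(\<lambda>\<omega>. \<integral>\<^sup>+u. bad (u, \<omega>) \<partial>m0) \<in> borel_measurable P"
    by (rule m0.borel_measurable_nn_integral) (simp add: case_prod_beta')
  have cheb: "(\<integral>\<^sup>+\<omega>. bad (u, \<omega>) \<partial>P) \<le> indicator B u * ennreal (1 / Q)" for u
  proof (cases "u \<in> B")
    case True
    have "(\<integral>\<^sup>+\<omega>. bad (u, \<omega>) \<partial>P) \<le> (\<integral>\<^sup>+\<omega>. ennreal (real n / Q\<^sup>2) * ennreal ((pairing b (noise_coords \<omega>) (G (u - u0)))\<^sup>2) \<partial>P)"
    proof (intro nn_integral_mono)
      fix \<omega>
      define p where "p = pairing b (noise_coords \<omega>) (G (u - u0))"
      show "bad (u, \<omega>) \<le> ennreal (real n / Q\<^sup>2) * ennreal ((pairing b (noise_coords \<omega>) (G (u - u0)))\<^sup>2)"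
      proof (cases "N (u, \<omega>) < - Q")
        case True
        then have "Q\<^sup>2 \<le> (sqrt (real n) * p)\<^sup>2"
          using Q abs_le_square_iff[of Q "sqrt (real n) * p"] by (simp add: N_def p_def)
        then have "1 \<le> real n / Q\<^sup>2 * p\<^sup>2"
          using Q by (simp add: power_mult_distrib field_simps)
        then have "ennreal 1 \<le> ennreal (real n / Q\<^sup>2) * ennreal (p\<^sup>2)"
          by (subst ennreal_mult[symmetric]) (auto intro: ennreal_leI)
        then show ?thesis using True \<open>u \<in> B\<close> by (simp add: bad_def p_def)
      qed (simp add: bad_def)
    qed
    also have "\<dots> = ennreal (real n / Q\<^sup>2) * ennreal ((norm (G (u - u0)))\<^sup>2)"
      using centered_normal_measurable[OF noise_pairing_normal[of "G (u - u0)"]]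
      by (subst nn_integral_cmult) (simp_all add: centered_normal_second_moment[OF noise_pairing_normal])
    also have "\<dots> = ennreal (real n * (norm (G (u - u0)))\<^sup>2 / Q\<^sup>2)" by (simp add: ennreal_mult[symmetric])
    also have "\<dots> \<le> ennreal (Q / Q\<^sup>2)" using le[OF True] Q by (intro ennreal_leI divide_right_mono) auto
    also have "Q / Q\<^sup>2 = 1 / Q" using Q by (simp add: power2_eq_square)
    finally show ?thesis using True by simp
  qed (simp add: bad_def)
  have "(\<integral>\<^sup>+\<omega>. \<integral>\<^sup>+u. bad (u, \<omega>) \<partial>m0 \<partial>P) = (\<integral>\<^sup>+u. \<integral>\<^sup>+\<omega>. bad (u, \<omega>) \<partial>P \<partial>m0)"
    by (rule Fubini') simp
  also have "\<dots> \<le> (\<integral>\<^sup>+u. indicator B u * ennreal (1 / Q) \<partial>m0)" by (intro nn_integral_mono cheb)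
  also have "\<dots> = ennreal (1 / Q) * ennreal \<beta>" by (simp add: nn_integral_multc mult.commute \<beta>)
  finally have int: "(\<integral>\<^sup>+\<omega>. \<integral>\<^sup>+u. bad (u, \<omega>) \<partial>m0 \<partial>P) \<le> ennreal (1 / Q) * ennreal \<beta>" .
  \<comment> \<open>Markov's inequality at level \<open>\<beta> / 2\<close>: outside
    \<open>T\<close> at least half of the mass of \<open>B\<close> remains good.\<close>
  define T where "T = {\<omega> \<in> space P. 1 \<le> ennreal (2 / \<beta>) * (\<integral>\<^sup>+u. bad (u, \<omega>) \<partial>m0)}"
  have T: "T \<in> sets P" unfolding T_def by measurable
  have "emeasure P T \<le> ennreal (2 / \<beta>) * (\<integral>\<^sup>+\<omega>. (\<integral>\<^sup>+u. bad (u, \<omega>) \<partial>m0) * indicator (space P) \<omega> \<partial>P)"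
    unfolding T_def by (rule nn_integral_Markov_inequality) measurable
  also have "(\<integral>\<^sup>+\<omega>. (\<integral>\<^sup>+u. bad (u, \<omega>) \<partial>m0) * indicator (space P) \<omega> \<partial>P) = (\<integral>\<^sup>+\<omega>. \<integral>\<^sup>+u. bad (u, \<omega>) \<partial>m0 \<partial>P)"
    by (intro nn_integral_cong) simp
  also have "ennreal (2 / \<beta>) * \<dots> \<le> ennreal (2 / \<beta>) * (ennreal (1 / Q) * ennreal \<beta>)"
    by (intro mult_left_mono int) simp
  also have "\<dots> = ennreal (2 / Q)" using \<beta> Q by (simp add: ennreal_mult[symmetric])
  finally have TP: "emeasure P T \<le> ennreal (2 / Q)" .
  have "ennreal (\<beta> / 2 * exp (- 3 / 2 * Q)) \<le> (\<integral>\<^sup>+u. lr n (u - u0) \<omega> \<partial>m0)" if \<omega>: "\<omega> \<in> space P - T" for \<omega>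
  proof -
    have [measurable]: "(\<lambda>u. bad (u, \<omega>)) \<in> borel_measurable m0"
      using \<omega> by (intro measurable_compose[OF measurable_Pair2' badm]) auto
    define g where "g = (\<integral>\<^sup>+u. bad (u, \<omega>) \<partial>m0)"
    have "ennreal (2 / \<beta>) * g < 1" using \<omega> by (simp add: T_def g_def not_le)
    have g_le: "g \<le> ennreal (\<beta> / 2)"
    proof (rule ccontr)
      assume "\<not> g \<le> ennreal (\<beta> / 2)"
      then have "ennreal (2 / \<beta>) * ennreal (\<beta> / 2) \<le> ennreal (2 / \<beta>) * g" by (intro mult_left_mono) auto
      also have "ennreal (2 / \<beta>) * ennreal (\<beta> / 2) = 1" using \<beta> by (simp add: ennreal_mult[symmetric])
      finally show False using \<open>ennreal (2 / \<beta>) * g < 1\<close> by simp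
    qed
    have "ennreal \<beta> = (\<integral>\<^sup>+u. indicator B u \<partial>m0)" by (simp add: \<beta>)
    \<comment> \<open>On the good part of \<open>B\<close> the noise term is at least
      \<open>- Q\<close> and the quadratic term at least - Q / 2, whence the exponent 3/2.\<close>
    also have "\<dots> \<le> (\<integral>\<^sup>+u. ennreal (exp (3 / 2 * Q)) * lr n (u - u0) \<omega> + bad (u, \<omega>) \<partial>m0)"
    proof (intro nn_integral_mono)
      fix u
      show "indicator B u \<le> ennreal (exp (3 / 2 * Q)) * lr n (u - u0) \<omega> + bad (u, \<omega>)"
      proof (cases "u \<in> B \<and> \<not> N (u, \<omega>) < - Q")
        case True
        then have "0 \<le> 3 / 2 * Q + (N (u, \<omega>) - real n / 2 * (norm (G (u - u0)))\<^sup>2)"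
          using le[of u] by simp
        then have "1 \<le> exp (3 / 2 * Q) * exp (N (u, \<omega>) - real n / 2 * (norm (G (u - u0)))\<^sup>2)"
          by (simp add: mult_exp_exp)
        then have "ennreal 1 \<le> ennreal (exp (3 / 2 * Q)) * lr n (u - u0) \<omega>"
          unfolding lr_def by (subst ennreal_mult[symmetric]) (auto simp: N_def intro: ennreal_leI)
        then have "1 \<le> ennreal (exp (3 / 2 * Q)) * lr n (u - u0) \<omega> + bad (u, \<omega>)"
          by (simp add: add_increasing2)
        then show ?thesis using True by simp
      next
        case False
        then show ?thesis by (auto simp: bad_def indicator_def)
      qed
    qed
    also have "\<dots> = ennreal (exp (3 / 2 * Q)) * (\<integral>\<^sup>+u. lr n (u - u0) \<omega> \<partial>m0) + g"
    proof -
      have [measurable]: "(\<lambda>u. lr n (u - u0) \<omega>) \<in> borel_measurable m0"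
        by (rule lr_section_measurable) (use \<omega> in auto)
      show ?thesis by (simp add: nn_integral_add nn_integral_cmult g_def)
    qed
    also have "\<dots> \<le> ennreal (exp (3 / 2 * Q)) * (\<integral>\<^sup>+u. lr n (u - u0) \<omega> \<partial>m0) + ennreal (\<beta> / 2)"
      by (intro add_left_mono g_le)
    finally have *: "ennreal \<beta> \<le> ennreal (exp (3 / 2 * Q)) * (\<integral>\<^sup>+u. lr n (u - u0) \<omega> \<partial>m0) + ennreal (\<beta> / 2)" .
    have "ennreal (\<beta> / 2) = ennreal \<beta> - ennreal (\<beta> / 2)" using \<beta> by (subst ennreal_minus) auto
    also have "\<dots> \<le> ennreal (exp (3 / 2 * Q)) * (\<integral>\<^sup>+u. lr n (u - u0) \<omega> \<partial>m0)"
      using * by (subst ennreal_minus_le_iff) (auto simp: add.commute)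
    finally have "ennreal (exp (- 3 / 2 * Q)) * ennreal (\<beta> / 2)
        \<le> ennreal (exp (- 3 / 2 * Q)) * (ennreal (exp (3 / 2 * Q)) * (\<integral>\<^sup>+u. lr n (u - u0) \<omega> \<partial>m0))"
      by (intro mult_left_mono) auto
    also have "\<dots> = (\<integral>\<^sup>+u. lr n (u - u0) \<omega> \<partial>m0)"
      by (simp add: mult.assoc[symmetric] ennreal_mult[symmetric] mult_exp_exp)
    finally show ?thesis using \<beta> by (simp add: ennreal_mult[symmetric] mult.commute)
  qed
  with T TP show ?thesis by blast
qed

lemma observation_measurable: "observation G b \<eta> n u0 \<in> P \<rightarrow>\<^sub>M PiM UNIV (\<lambda>_. borel)"
proof (rule measurable_PiM_single')
  show "(\<lambda>\<omega>. observation G b \<eta> n u0 \<omega> i) \<in> borel_measurable P" for i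
    unfolding observation_def by measurable
qed auto

text \<open>Three events of noise are discarded: a small normalising constant (\<open>T1\<close>), a
  large noise energy in the head (\<open>T2\<close>), a large numerator (\<open>T3\<close>). The
  numerator is majorised by an integral whose mean over the noise can be computed, so Markov's
  inequality takes the place of a test.\<close>

lemma posterior_tail_bound:
  assumes n: "n \<ge> 1" and \<mu>: "\<mu> n = m0"
    and A[measurable]: "A \<in> sets m0" and A2[measurable]: "A2 \<in> sets m0"
    and cover: "\<And>u. u \<in> A \<Longrightarrow> u \<notin> A2 \<Longrightarrow> K \<le> real n * (norm (G (head d (u - u0))))\<^sup>2"
    and K: "64 * real d \<le> K"
    and B: "B \<in> sets m0" "emeasure m0 B = ennreal \<beta>" "\<beta> > 0" and Q: "Q > 0"
    and le: "\<And>u. u \<in> B \<Longrightarrow> real n * (norm (G (u - u0)))\<^sup>2 \<le> Q"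
    and \<epsilon>: "\<epsilon> > 0"
  shows "measure (observation_law P G b \<eta> u0 n) {y. measure (posterior G b \<mu> n y) A > \<epsilon>}
    \<le> 2 / Q + exp (- (real d / 2)) + (measure m0 A2 + exp (- K / 4)) / (\<epsilon> * (\<beta> / 2 * exp (- 3 / 2 * Q)))"
proof -
  define S where "S = {y. measure (posterior G b \<mu> n y) A > \<epsilon>}"
  define d0 where "d0 = \<beta> / 2 * exp (- 3 / 2 * Q)"
  have d0: "d0 > 0" using B by (simp add: d0_def)
  define a where "a = measure m0 A2 + exp (- K / 4)"
  have a: "a \<ge> 0" by (simp add: a_def)
  obtain T1 where T1: "T1 \<in> sets P" "emeasure P T1 \<le> ennreal (2 / Q)"
    and evid: "\<And>\<omega>. \<omega> \<in> space P - T1 \<Longrightarrow> ennreal d0 \<le> (\<integral>\<^sup>+u. lr n (u - u0) \<omega> \<partial>m0)"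
    using evidence_lower_bound[OF B Q le] unfolding d0_def by blast
  define T2 where "T2 = {\<omega> \<in> space P. 4 * real d < (\<Sum>k<d. (\<eta> (G (e k)) \<omega> / \<rho> k)\<^sup>2)}"
  have T2: "T2 \<in> sets P" "emeasure P T2 \<le> ennreal (exp (- (real d / 2)))"
    unfolding T2_def by (measurable, rule noise_head_tail)
  \<comment> \<open>Off \<open>T2\<close> this majorises the unnormalised posterior mass of
    \<open>A\<close>: on \<open>A2\<close> the likelihood ratio is kept, elsewhere its head is
    replaced by the gain exp (-K / 4). Both ratios have mean one, so the mean of
    \<open>\<Phi>\<close> is \<open>a\<close>.\<close>
  define \<Phi> where "\<Phi> \<omega> = (\<integral>\<^sup>+u. lr n (u - u0) \<omega> * indicator A2 u + ennreal (exp (- K / 4)) * lr n ((u - u0) - head d (u - u0)) \<omega> \<partial>m0)" for \<omega>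
  have lrm: "(\<lambda>z. lr n (f (fst z)) (snd z)) \<in> borel_measurable (m0 \<Otimes>\<^sub>M P)"
    if [measurable]: "f \<in> borel_measurable borel" for f
    unfolding lr_def pairing_def by measurable
  have lrm': "(\<lambda>z. lr n (f (snd z)) (fst z)) \<in> borel_measurable (P \<Otimes>\<^sub>M m0)"
    if [measurable]: "f \<in> borel_measurable borel" for f
    unfolding lr_def pairing_def by measurable
  note [measurable] = lrm[of "\<lambda>u. u - u0"] lrm[of "\<lambda>u. (u - u0) - head d (u - u0)"]
    lrm'[of "\<lambda>u. u - u0"] lrm'[of "\<lambda>u. (u - u0) - head d (u - u0)"]
  have \<Phi>m[measurable]: "\<Phi> \<in> borel_measurable P"
    unfolding \<Phi>_def[abs_def] by (rule m0.borel_measurable_nn_integral) (simp add: case_prod_beta')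
  have lr\<omega>: "lr n h \<in> borel_measurable P" for h
    unfolding lr_def[abs_def] using centered_normal_measurable[OF noise_pairing_normal[of "G h"]] by measurable
  have "(\<integral>\<^sup>+\<omega>. \<Phi> \<omega> \<partial>P) = (\<integral>\<^sup>+u. \<integral>\<^sup>+\<omega>. lr n (u - u0) \<omega> * indicator A2 u
      + ennreal (exp (- K / 4)) * lr n ((u - u0) - head d (u - u0)) \<omega> \<partial>P \<partial>m0)"
    unfolding \<Phi>_def by (rule Fubini') (simp add: case_prod_beta')
  also have "\<dots> = (\<integral>\<^sup>+u. indicator A2 u + ennreal (exp (- K / 4)) \<partial>m0)"
    using lr\<omega> by (intro nn_integral_cong) (simp add: nn_integral_add nn_integral_cmult nn_integral_multc nn_integral_lr)
  also have "\<dots> = ennreal a"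
    using m0.prob_space by (simp add: nn_integral_add a_def m0.emeasure_eq_measure)
  finally have \<Phi>int: "(\<integral>\<^sup>+\<omega>. \<Phi> \<omega> \<partial>P) = ennreal a" .
  define T3 where "T3 = {\<omega> \<in> space P. 1 \<le> ennreal (1 / (\<epsilon> * d0)) * \<Phi> \<omega>}"
  have T3: "T3 \<in> sets P" unfolding T3_def by measurable
  have T3P: "emeasure P T3 \<le> ennreal (a / (\<epsilon> * d0))"
  proof -
    have "emeasure P T3 \<le> ennreal (1 / (\<epsilon> * d0)) * (\<integral>\<^sup>+\<omega>. \<Phi> \<omega> * indicator (space P) \<omega> \<partial>P)"
      unfolding T3_def by (rule nn_integral_Markov_inequality) measurable
    also have "(\<integral>\<^sup>+\<omega>. \<Phi> \<omega> * indicator (space P) \<omega> \<partial>P) = (\<integral>\<^sup>+\<omega>. \<Phi> \<omega> \<partial>P)"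
      by (intro nn_integral_cong) simp
    also have "ennreal (1 / (\<epsilon> * d0)) * \<dots> = ennreal (a / (\<epsilon> * d0))"
      using \<Phi>int a d0 \<epsilon> by (simp add: ennreal_mult[symmetric])
    finally show ?thesis .
  qed
  have sume: "AE \<omega> in P. \<forall>k. summable (\<lambda>i. noise_coords \<omega> i * (G (e k) \<bullet> b i))"
    unfolding AE_all_countable by (intro allI noise_pairing_summable)
  have paire: "AE \<omega> in P. \<forall>k. pairing b (noise_coords \<omega>) (G (e k)) = \<eta> (G (e k)) \<omega>"
    unfolding AE_all_countable by (intro allI noise_pairing_eq)
  have ae: "AE \<omega> in P. \<omega> \<in> observation G b \<eta> n u0 -` S \<inter> space P \<longrightarrow> \<omega> \<in> T1 \<union> T2 \<union> T3"
    using posterior_lr[of n \<mu> u0, OF n \<mu>] noise_in_obs_space noise_pairing_summable[of "G u0"] sume paire AE_space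
  proof eventually_elim
    case (elim \<omega>)
    show ?case
    proof (intro impI, rule ccontr)
      assume S: "\<omega> \<in> observation G b \<eta> n u0 -` S \<inter> space P" and nT: "\<omega> \<notin> T1 \<union> T2 \<union> T3"
      define post where "post = posterior G b \<mu> n (observation G b \<eta> n u0 \<omega>)"
      interpret post: prob_space post using elim A by (auto simp: post_def)
      have "ennreal \<epsilon> \<le> emeasure post A"
        using S by (simp add: S_def post_def[symmetric] post.emeasure_eq_measure ennreal_leI)
      moreover have "ennreal d0 \<le> (\<integral>\<^sup>+u. lr n (u - u0) \<omega> \<partial>m0)"
        using evid[of \<omega>] nT elim by auto
      ultimately have "ennreal \<epsilon> * ennreal d0 \<le> emeasure post A * (\<integral>\<^sup>+u. lr n (u - u0) \<omega> \<partial>m0)"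
        by (intro mult_mono) auto
      also have "\<dots> = (\<integral>\<^sup>+u. lr n (u - u0) \<omega> * indicator A u \<partial>m0)"
        using elim A by (auto simp: post_def)
      also have "\<dots> \<le> \<Phi> \<omega>"
        unfolding \<Phi>_def
      proof (rule nn_integral_mono_AE)
        have "AE u in m0. summable (\<lambda>i. noise_coords \<omega> i * (G u \<bullet> b i))"
          using elim by (simp add: obs_space_def)
        then show "AE u in m0. lr n (u - u0) \<omega> * indicator A u
            \<le> lr n (u - u0) \<omega> * indicator A2 u + ennreal (exp (- K / 4)) * lr n ((u - u0) - head d (u - u0)) \<omega>"
        proof eventually_elim
          fix u assume su: "summable (\<lambda>i. noise_coords \<omega> i * (G u \<bullet> b i))"
          consider "u \<notin> A" | "u \<in> A2" | "u \<in> A" "u \<notin> A2" by blast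
          then show "lr n (u - u0) \<omega> * indicator A u
            \<le> lr n (u - u0) \<omega> * indicator A2 u + ennreal (exp (- K / 4)) * lr n ((u - u0) - head d (u - u0)) \<omega>"
          proof cases
            case 2
            then have "lr n (u - u0) \<omega> * indicator A u \<le> lr n (u - u0) \<omega> * indicator A2 u"
              by (intro mult_left_mono) (auto split: split_indicator)
            then show ?thesis by (rule order_trans) simp
          next
            case 3
            have "lr n (u - u0) \<omega> \<le> ennreal (exp (- K / 4)) * lr n ((u - u0) - head d (u - u0)) \<omega>"
            proof (rule lr_head_bound)
              show "summable (\<lambda>i. noise_coords \<omega> i * (G (u - u0) \<bullet> b i))"
                using pairing_diff_right(1)[OF su] elim by (simp add: G.diff)
              show "(\<Sum>k<d. (\<eta> (G (e k)) \<omega> / \<rho> k)\<^sup>2) \<le> 4 * real d"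
                using nT elim by (auto simp: T2_def)
            qed (use elim K cover[OF 3] in auto)
            then show ?thesis using 3 by simp
          qed simp
        qed
      qed
      finally have "ennreal (\<epsilon> * d0) \<le> \<Phi> \<omega>" using \<epsilon> d0 by (simp add: ennreal_mult)
      then have "ennreal (1 / (\<epsilon> * d0)) * ennreal (\<epsilon> * d0) \<le> ennreal (1 / (\<epsilon> * d0)) * \<Phi> \<omega>"
        by (intro mult_left_mono) auto
      moreover have "ennreal (1 / (\<epsilon> * d0)) * ennreal (\<epsilon> * d0) = 1"
        using \<epsilon> d0 by (simp add: ennreal_mult[symmetric])
      ultimately have "\<omega> \<in> T3" using elim by (simp add: T3_def)
      then show False using nT by simp
    qed
  qed
  have bound: "emeasure P (observation G b \<eta> n u0 -` S \<inter> space P)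
      \<le> ennreal (2 / Q + exp (- (real d / 2)) + a / (\<epsilon> * d0))"
  proof -
    have "emeasure P (observation G b \<eta> n u0 -` S \<inter> space P) \<le> emeasure P (T1 \<union> T2 \<union> T3)"
      using ae T1 T2 T3 by (intro emeasure_mono_AE) auto
    also have "\<dots> \<le> emeasure P (T1 \<union> T2) + emeasure P T3"
      using T1 T2 T3 by (intro emeasure_subadditive) auto
    also have "\<dots> \<le> (emeasure P T1 + emeasure P T2) + emeasure P T3"
      using T1 T2 by (intro add_right_mono emeasure_subadditive) auto
    also have "\<dots> \<le> (ennreal (2 / Q) + ennreal (exp (- (real d / 2)))) + ennreal (a / (\<epsilon> * d0))"
      by (intro add_mono T1 T2 T3P)
    also have "\<dots> = ennreal (2 / Q + exp (- (real d / 2)) + a / (\<epsilon> * d0))"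
      using Q a \<epsilon> d0 by (simp add: ennreal_plus[symmetric] del: ennreal_plus)
    finally show ?thesis .
  qed
  have nonneg: "0 \<le> 2 / Q + exp (- (real d / 2)) + a / (\<epsilon> * d0)" using Q a \<epsilon> d0 by simp
  have "measure (observation_law P G b \<eta> u0 n) S \<le> 2 / Q + exp (- (real d / 2)) + a / (\<epsilon> * d0)"
  \<comment> \<open>The set of data could fail to be measurable in the product space;
    \<open>measure\<close> is then 0 by convention and the bound is trivial.\<close>
  proof (cases "S \<in> sets (PiM UNIV (\<lambda>_. borel :: real measure))")
    case True
    have "measure (observation_law P G b \<eta> u0 n) S = measure P (observation G b \<eta> n u0 -` S \<inter> space P)"
      unfolding observation_law_def by (rule measure_distr[OF observation_measurable True])
    also have "\<dots> \<le> 2 / Q + exp (- (real d / 2)) + a / (\<epsilon> * d0)"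
      unfolding measure_def using enn2real_mono[OF bound] nonneg by simp
    finally show ?thesis .
  next
    case False
    then have "measure (observation_law P G b \<eta> u0 n) S = 0"
      by (intro measure_notin_sets) (simp add: observation_law_def)
    then show ?thesis using nonneg by simp
  qed
  then show ?thesis by (simp add: S_def a_def d0_def)
qed

end

section \<open>Gaussian measures with independent coordinates\<close>

text \<open>For an orthonormal basis, the squared norm of the component beyond the first
  \<open>p\<close> vectors. The form as a difference makes measurability evident.\<close>

definition onb_tail :: "(nat \<Rightarrow> 'a::real_inner) \<Rightarrow> nat \<Rightarrow> 'a \<Rightarrow> real" where
  "onb_tail \<phi> p u = (norm u)\<^sup>2 - (\<Sum>j<p. (u \<bullet> \<phi> j)\<^sup>2)"

context
  fixes \<phi> :: "nat \<Rightarrow> 'a::real_inner"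
  assumes \<phi>: "orthonormal_basis_on UNIV \<phi>"
begin

lemma onb_tail_eq_norm: "onb_tail \<phi> p u = (norm (u - (\<Sum>j<p. (u \<bullet> \<phi> j) *\<^sub>R \<phi> j)))\<^sup>2"
  by (simp add: onb_tail_def onb_dist_projection[OF \<phi>])

lemma onb_tail_limit: "(\<lambda>m. \<Sum>j=p..<m. (u \<bullet> \<phi> j)\<^sup>2) \<longlonglongrightarrow> onb_tail \<phi> p u"
proof -
  have "(\<lambda>m. (\<Sum>j<m. (u \<bullet> \<phi> j)\<^sup>2) - (\<Sum>j<p. (u \<bullet> \<phi> j)\<^sup>2)) \<longlonglongrightarrow> onb_tail \<phi> p u"
    using onb_parseval_norm[OF \<phi>, of u] unfolding sums_def onb_tail_def
    by (intro tendsto_diff tendsto_const)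
  moreover have "\<forall>\<^sub>F m in sequentially. (\<Sum>j<m. (u \<bullet> \<phi> j)\<^sup>2) - (\<Sum>j<p. (u \<bullet> \<phi> j)\<^sup>2) = (\<Sum>j=p..<m. (u \<bullet> \<phi> j)\<^sup>2)"
    using eventually_ge_at_top[of p]
    by eventually_elim (use sum_diff_nat_ivl[of 0 p _ "\<lambda>j. (u \<bullet> \<phi> j)\<^sup>2"] in \<open>simp add: atLeast0LessThan\<close>)
  ultimately show ?thesis by (rule Lim_transform_eventually)
qed

lemma onb_tail_diff: "onb_tail \<phi> p (u - v) \<le> 2 * onb_tail \<phi> p u + 2 * onb_tail \<phi> p v"
proof -
  let ?a = "u - (\<Sum>j<p. (u \<bullet> \<phi> j) *\<^sub>R \<phi> j)" and ?c = "v - (\<Sum>j<p. (v \<bullet> \<phi> j) *\<^sub>R \<phi> j)"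
  have eq: "(u - v) - (\<Sum>j<p. ((u - v) \<bullet> \<phi> j) *\<^sub>R \<phi> j) = ?a - ?c"
    by (simp add: inner_diff_left scaleR_diff_left sum_subtractf)
  have le: "(norm (x - y))\<^sup>2 \<le> 2 * (norm x)\<^sup>2 + 2 * (norm y)\<^sup>2" for x y :: 'a
  proof -
    have "0 \<le> (norm (x + y))\<^sup>2" by simp
    then show ?thesis
      by (simp add: power2_norm_eq_inner inner_add_left inner_add_right inner_diff_left inner_diff_right inner_commute)
  qed
  show ?thesis unfolding onb_tail_eq_norm eq by (rule le)
qed

lemma onb_tail_le_weighted:
  assumes w: "\<And>j. j \<ge> p \<Longrightarrow> (u \<bullet> \<phi> j)\<^sup>2 \<le> c * f j" and f: "summable f" "\<And>j. 0 \<le> f j" and c: "0 \<le> c"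
  shows "onb_tail \<phi> p u \<le> c * suminf f"
proof (rule LIMSEQ_le_const2[OF onb_tail_limit], intro exI allI impI)
  fix m
  have "(\<Sum>j=p..<m. (u \<bullet> \<phi> j)\<^sup>2) \<le> (\<Sum>j=p..<m. c * f j)" by (intro sum_mono w) auto
  also have "\<dots> = c * (\<Sum>j=p..<m. f j)" by (simp add: sum_distrib_left)
  also have "\<dots> \<le> c * suminf f" using f c by (intro mult_left_mono sum_le_suminf) auto
  finally show "(\<Sum>j=p..<m. (u \<bullet> \<phi> j)\<^sup>2) \<le> c * suminf f" .
qed

end

locale gaussian_prior =
  fixes m0 :: "'a::{real_inner, complete_space, second_countable_topology} measure"
    and \<phi> :: "nat \<Rightarrow> 'a" and v :: "nat \<Rightarrow> real"
  assumes \<phi>: "orthonormal_basis_on UNIV \<phi>"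
    and sets_m0: "sets m0 = sets borel"
    and coords: "centered_gaussian_process m0 (\<lambda>j u. u \<bullet> \<phi> j) (\<lambda>j k. if j = k then v j else 0)"
    and v_pos: "\<And>j. 0 < v j"
begin

sublocale prob_space m0
  using coords by (simp add: centered_gaussian_process_def)

declare sets_m0 [measurable_cong]

lemma coords_normal: "centered_normal m0 (\<lambda>u. u \<bullet> \<phi> j) (v j)"
  using centered_gaussian_process_component[OF coords, of j] by simp

lemma onb_tail_measurable [measurable]: "onb_tail \<phi> p \<in> borel_measurable m0"
  unfolding onb_tail_def[abs_def] by measurable

lemma space_m0': "space m0 = UNIV"
  using sets_eq_imp_space_eq[OF sets_m0] by simp

lemma second_moment:
  assumes "summable v"
  shows "(\<integral>\<^sup>+u. ennreal ((norm u)\<^sup>2) \<partial>m0) < \<infinity>"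
proof -
  have "ennreal ((norm u)\<^sup>2) = (\<Sum>j. ennreal ((u \<bullet> \<phi> j)\<^sup>2))" for u
    using onb_parseval_norm[OF \<phi>, of u] by (subst suminf_ennreal_eq) (auto simp: sums_iff)
  then have "(\<integral>\<^sup>+u. ennreal ((norm u)\<^sup>2) \<partial>m0) = (\<Sum>j. \<integral>\<^sup>+u. ennreal ((u \<bullet> \<phi> j)\<^sup>2) \<partial>m0)"
    by (simp add: nn_integral_suminf)
  also have "\<dots> = (\<Sum>j. ennreal (v j))" by (simp add: centered_normal_second_moment[OF coords_normal])
  also have "\<dots> = ennreal (suminf v)" using assms v_pos by (intro suminf_ennreal_eq) (auto intro: less_imp_le)
  finally show ?thesis by simp
qed

text \<open>Exponential Markov inequality; the moment of the infinite tail is obtained from its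
  finite sections by Fatou's lemma, and \<open>t\<close> is capped by the largest variance beyond
  \<open>p\<close>.\<close>

lemma prior_tail:
  assumes t: "0 \<le> t" "\<And>j. j \<ge> p \<Longrightarrow> 4 * t * v j \<le> 1" and V: "\<And>m. (\<Sum>j=p..<m. v j) \<le> V"
  shows "measure m0 {u. s < onb_tail \<phi> p u} \<le> exp (2 * t * V - t * s)"
proof -
  have [measurable]: "{u. s < onb_tail \<phi> p u} \<in> sets m0"
    using measurable_sets[OF onb_tail_measurable[of p], of "{s<..}"] by (simp add: vimage_def space_m0')
  have "(\<integral>\<^sup>+u. ennreal (exp (t * onb_tail \<phi> p u)) \<partial>m0)
      = (\<integral>\<^sup>+u. liminf (\<lambda>m. ennreal (exp (t * (\<Sum>j=p..<m. (u \<bullet> \<phi> j)\<^sup>2)))) \<partial>m0)"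
    by (intro nn_integral_cong lim_imp_Liminf[symmetric] tendsto_ennrealI tendsto_exp tendsto_mult
        tendsto_const onb_tail_limit[OF \<phi>]) simp
  also have "\<dots> \<le> liminf (\<lambda>m. \<integral>\<^sup>+u. ennreal (exp (t * (\<Sum>j=p..<m. (u \<bullet> \<phi> j)\<^sup>2))) \<partial>m0)"
    by (rule nn_integral_liminf) measurable
  also have "\<dots> \<le> ennreal (exp (2 * t * V))"
  proof (intro Liminf_le always_eventually allI)
    fix m
    have "(\<integral>\<^sup>+u. ennreal (exp (t * (\<Sum>j=p..<m. (u \<bullet> \<phi> j)\<^sup>2))) \<partial>m0)
        \<le> ennreal (exp (2 * t * (\<Sum>j=p..<m. if j = j then v j else 0)))"
      by (rule gaussian_exp_square_sum[OF coords]) (use t in auto)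
    also have "\<dots> \<le> ennreal (exp (2 * t * V))" using V[of m] t by (intro ennreal_leI) (simp add: mult_left_mono)
    finally show "(\<integral>\<^sup>+u. ennreal (exp (t * (\<Sum>j=p..<m. (u \<bullet> \<phi> j)\<^sup>2))) \<partial>m0) \<le> ennreal (exp (2 * t * V))" .
  qed simp
  finally have int: "(\<integral>\<^sup>+u. ennreal (exp (t * onb_tail \<phi> p u)) \<partial>m0) \<le> ennreal (exp (2 * t * V))" .
  have "emeasure m0 {u. s < onb_tail \<phi> p u} = (\<integral>\<^sup>+u. indicator {u. s < onb_tail \<phi> p u} u \<partial>m0)"
    by simp
  also have "\<dots> \<le> (\<integral>\<^sup>+u. ennreal (exp (- t * s)) * ennreal (exp (t * onb_tail \<phi> p u)) \<partial>m0)"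
  proof (intro nn_integral_mono)
    fix u
    show "indicator {u. s < onb_tail \<phi> p u} u \<le> ennreal (exp (- t * s)) * ennreal (exp (t * onb_tail \<phi> p u))"
    proof (cases "s < onb_tail \<phi> p u")
      case True
      then have "0 \<le> - t * s + t * onb_tail \<phi> p u" using t by (simp add: mult_left_mono)
      then have "1 \<le> exp (- t * s) * exp (t * onb_tail \<phi> p u)" by (simp only: mult_exp_exp one_le_exp_iff)
      then have "ennreal 1 \<le> ennreal (exp (- t * s)) * ennreal (exp (t * onb_tail \<phi> p u))"
        by (subst ennreal_mult[symmetric]) (auto intro: ennreal_leI)
      then show ?thesis using True by simp
    qed simp
  qed
  also have "\<dots> = ennreal (exp (- t * s)) * (\<integral>\<^sup>+u. ennreal (exp (t * onb_tail \<phi> p u)) \<partial>m0)"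
    by (rule nn_integral_cmult) measurable
  also have "\<dots> \<le> ennreal (exp (- t * s)) * ennreal (exp (2 * t * V))" by (intro mult_left_mono int) simp
  also have "\<dots> = ennreal (exp (2 * t * V - t * s))" by (simp add: ennreal_mult[symmetric] mult_exp_exp)
  finally show ?thesis by (simp add: emeasure_eq_measure)
qed

text \<open>The box \<open>H\<close> on the first \<open>p\<close> coordinates is independent of
  every later one, so given \<open>H\<close> the mean tail energy is still at most \<open>V\<close>.
  By Markov's inequality the requirement on the tail then costs at most half of the mass of
  \<open>H\<close>, whence the final division by 2.\<close>

lemma small_ball:
  fixes a r :: "nat \<Rightarrow> real"
  assumes r: "\<And>j. j < p \<Longrightarrow> 0 < r j" "\<And>j. j < p \<Longrightarrow> r j \<le> sqrt (v j)"
    and V: "\<And>m. (\<Sum>j=p..<m. v j) \<le> V" and Vpos: "V > 0"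
  defines "B \<equiv> {u. (\<forall>j<p. \<bar>u \<bullet> \<phi> j - a j\<bar> \<le> r j) \<and> onb_tail \<phi> p u \<le> 2 * V}"
  shows "B \<in> sets m0"
    and "measure m0 B \<ge> (\<Prod>j<p. exp (- 1 - (a j)\<^sup>2 / v j) * sqrt (2 / pi) * (r j / sqrt (v j))) / 2"
proof -
  define H where "H = {u. \<forall>j\<in>{..<p}. \<bar>u \<bullet> \<phi> j - a j\<bar> \<le> r j}"
  have H[measurable]: "H \<in> sets m0"
  proof -
    have "{u \<in> space m0. \<forall>j\<in>{..<p}. \<bar>u \<bullet> \<phi> j - a j\<bar> \<le> r j} \<in> sets m0" by measurable
    then show ?thesis by (simp add: H_def space_m0')
  qed
  define T where "T = {u. 2 * V < onb_tail \<phi> p u}"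
  have T[measurable]: "T \<in> sets m0"
    using measurable_sets[OF onb_tail_measurable[of p], of "{2 * V<..}"] by (simp add: T_def vimage_def space_m0')
  have BHT: "B = H - T" by (auto simp: B_def H_def T_def)
  then show "B \<in> sets m0" by simp
  define I where "I j = (indicator {x. \<bar>x - a j\<bar> \<le> r j} :: real \<Rightarrow> ennreal)" for j
  have [measurable]: "I j \<in> borel_measurable borel" for j unfolding I_def by measurable
  define pr where "pr j = measure m0 {u \<in> space m0. \<bar>u \<bullet> \<phi> j - a j\<bar> \<le> r j}" for j
  have Ipr: "(\<integral>\<^sup>+u. I j (u \<bullet> \<phi> j) \<partial>m0) = ennreal (pr j)" for j
  proof -
    have "(\<integral>\<^sup>+u. I j (u \<bullet> \<phi> j) \<partial>m0) = (\<integral>\<^sup>+u. indicator {u \<in> space m0. \<bar>u \<bullet> \<phi> j - a j\<bar> \<le> r j} u \<partial>m0)"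
      by (intro nn_integral_cong) (auto simp: I_def split: split_indicator)
    then show ?thesis by (simp add: pr_def emeasure_eq_measure)
  qed
  have indH: "indicator H u = (\<Prod>j<p. I j (u \<bullet> \<phi> j))" for u
    by (auto simp: H_def I_def indicator_def prod_zero_iff)
  have ind: "indep_vars (\<lambda>_. borel) (\<lambda>j u. g j (u \<bullet> \<phi> j)) S" if "\<And>j. g j \<in> borel_measurable borel"
    for g :: "nat \<Rightarrow> real \<Rightarrow> ennreal" and S
    using that
    by (intro indep_vars_compose2[OF indep_vars_subset[OF centered_gaussian_process_indep[OF coords]]]) auto
  have prodH: "emeasure m0 H = (\<Prod>j<p. ennreal (pr j))"
  proof -
    have "emeasure m0 H = (\<integral>\<^sup>+u. (\<Prod>j<p. I j (u \<bullet> \<phi> j)) \<partial>m0)"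
      unfolding indH[symmetric] by simp
    also have "\<dots> = (\<Prod>j<p. \<integral>\<^sup>+u. I j (u \<bullet> \<phi> j) \<partial>m0)"
      by (intro indep_vars_nn_integral ind) auto
    finally show ?thesis by (simp add: Ipr)
  qed
  \<comment> \<open>One later coordinate at a time joins the finite product that defines
    \<open>H\<close>; the infinite tail then needs only Fatou's lemma.\<close>
  have cross: "(\<integral>\<^sup>+u. indicator H u * ennreal ((u \<bullet> \<phi> k)\<^sup>2) \<partial>m0) = emeasure m0 H * ennreal (v k)" if k: "p \<le> k" for k
  proof -
    let ?g = "\<lambda>j. if j = k then (\<lambda>x. ennreal (x\<^sup>2)) else I j"
    have ins: "(\<Prod>j\<in>insert k {..<p}. F j) = F k * (\<Prod>j<p. F j)" for F :: "nat \<Rightarrow> ennreal"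
      using k by simp
    have "(\<integral>\<^sup>+u. indicator H u * ennreal ((u \<bullet> \<phi> k)\<^sup>2) \<partial>m0) = (\<integral>\<^sup>+u. (\<Prod>j\<in>insert k {..<p}. ?g j (u \<bullet> \<phi> j)) \<partial>m0)"
      unfolding ins indH using k by (intro nn_integral_cong) (auto simp: mult.commute intro!: arg_cong2[where f="(*)"] prod.cong)
    also have "\<dots> = (\<Prod>j\<in>insert k {..<p}. \<integral>\<^sup>+u. ?g j (u \<bullet> \<phi> j) \<partial>m0)"
      by (intro indep_vars_nn_integral ind) auto
    also have "\<dots> = ennreal (v k) * (\<Prod>j<p. ennreal (pr j))"
      unfolding ins using k
      by (auto simp: centered_normal_second_moment[OF coords_normal] Ipr intro!: arg_cong2[where f="(*)"] prod.cong)
    finally show ?thesis by (simp add: prodH mult.commute)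
  qed
  have "(\<integral>\<^sup>+u. indicator H u * ennreal (onb_tail \<phi> p u) \<partial>m0)
      = (\<integral>\<^sup>+u. liminf (\<lambda>m. \<Sum>j=p..<m. indicator H u * ennreal ((u \<bullet> \<phi> j)\<^sup>2)) \<partial>m0)"
  proof (intro nn_integral_cong lim_imp_Liminf[symmetric])
    fix u
    have "(\<lambda>m. indicator H u * ennreal (\<Sum>j=p..<m. (u \<bullet> \<phi> j)\<^sup>2)) \<longlonglongrightarrow> indicator H u * ennreal (onb_tail \<phi> p u)"
      by (intro ennreal_tendsto_cmult tendsto_ennrealI onb_tail_limit[OF \<phi>]) (auto split: split_indicator)
    moreover have "indicator H u * ennreal (\<Sum>j=p..<m. (u \<bullet> \<phi> j)\<^sup>2) = (\<Sum>j=p..<m. indicator H u * ennreal ((u \<bullet> \<phi> j)\<^sup>2))" for m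
      by (simp add: sum_distrib_left[symmetric] sum_ennreal)
    ultimately show "(\<lambda>m. \<Sum>j=p..<m. indicator H u * ennreal ((u \<bullet> \<phi> j)\<^sup>2)) \<longlonglongrightarrow> indicator H u * ennreal (onb_tail \<phi> p u)"
      by simp
  qed simp
  also have "\<dots> \<le> liminf (\<lambda>m. \<integral>\<^sup>+u. (\<Sum>j=p..<m. indicator H u * ennreal ((u \<bullet> \<phi> j)\<^sup>2)) \<partial>m0)"
    by (rule nn_integral_liminf) measurable
  also have "\<dots> \<le> emeasure m0 H * ennreal V"
  proof (intro Liminf_le always_eventually allI)
    fix m
    have "(\<integral>\<^sup>+u. (\<Sum>j=p..<m. indicator H u * ennreal ((u \<bullet> \<phi> j)\<^sup>2)) \<partial>m0) = (\<Sum>j=p..<m. emeasure m0 H * ennreal (v j))"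
      by (subst nn_integral_sum) (auto simp: cross)
    also have "\<dots> = emeasure m0 H * ennreal (\<Sum>j=p..<m. v j)"
      using v_pos by (simp add: sum_distrib_left[symmetric] sum_ennreal less_imp_le)
    also have "\<dots> \<le> emeasure m0 H * ennreal V" by (intro mult_left_mono ennreal_leI V) simp
    finally show "(\<integral>\<^sup>+u. (\<Sum>j=p..<m. indicator H u * ennreal ((u \<bullet> \<phi> j)\<^sup>2)) \<partial>m0) \<le> emeasure m0 H * ennreal V" .
  qed simp
  finally have HT: "(\<integral>\<^sup>+u. indicator H u * ennreal (onb_tail \<phi> p u) \<partial>m0) \<le> emeasure m0 H * ennreal V" .
  have "ennreal (2 * V) * emeasure m0 (H \<inter> T) = (\<integral>\<^sup>+u. ennreal (2 * V) * indicator (H \<inter> T) u \<partial>m0)"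
    by (simp add: nn_integral_cmult)
  also have "\<dots> \<le> (\<integral>\<^sup>+u. indicator H u * ennreal (onb_tail \<phi> p u) \<partial>m0)"
    by (intro nn_integral_mono) (auto simp: T_def split: split_indicator intro!: ennreal_leI)
  also note HT
  finally have "ennreal (2 * V * measure m0 (H \<inter> T)) \<le> ennreal (measure m0 H * V)"
    using Vpos by (simp only: emeasure_eq_measure ennreal_mult[symmetric] measure_nonneg less_imp_le mult_nonneg_nonneg zero_le_numeral)
  then have "2 * V * measure m0 (H \<inter> T) \<le> measure m0 H * V"
    using Vpos by (subst (asm) ennreal_le_iff) auto
  then have "V * (2 * measure m0 (H \<inter> T)) \<le> V * measure m0 H" by (simp add: mult_ac)
  then have "2 * measure m0 (H \<inter> T) \<le> measure m0 H" using Vpos by simp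
  moreover have "measure m0 B = measure m0 H - measure m0 (H \<inter> T)"
    unfolding BHT by (rule finite_measure_Diff') auto
  ultimately have BH: "measure m0 B \<ge> measure m0 H / 2" by simp
  have "measure m0 H = (\<Prod>j<p. pr j)"
    using prodH by (simp add: emeasure_eq_measure prod_ennreal pr_def prod_nonneg)
  moreover have "(\<Prod>j<p. exp (- 1 - (a j)\<^sup>2 / v j) * sqrt (2 / pi) * (r j / sqrt (v j))) \<le> (\<Prod>j<p. pr j)"
  proof (intro prod_mono conjI)
    fix j assume "j \<in> {..<p}"
    then have j: "j < p" by simp
    show "0 \<le> exp (- 1 - (a j)\<^sup>2 / v j) * sqrt (2 / pi) * (r j / sqrt (v j))"
      using r(1)[OF j] v_pos[of j] by simp
    show "exp (- 1 - (a j)\<^sup>2 / v j) * sqrt (2 / pi) * (r j / sqrt (v j)) \<le> pr j"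
      unfolding pr_def by (rule centered_normal_small_interval[OF coords_normal v_pos r(1)[OF j] r(2)[OF j]])
  qed
  ultimately show "measure m0 B \<ge> (\<Prod>j<p. exp (- 1 - (a j)\<^sup>2 / v j) * sqrt (2 / pi) * (r j / sqrt (v j))) / 2"
    using BH by linarith
qed

end

section \<open>Elementary bounds for power sums and factorials\<close>

text \<open>Comparison with an integral, by the mean value theorem for the antiderivative
  \<open>g\<close>. The first term is split off because \<open>g\<close> is unusable at 0 when
  \<open>p = 0\<close>; it accounts for the summand 1 in the constant.\<close>

lemma sum_powr_tail_le:
  assumes \<beta>: "\<beta> > 0"
  shows "(\<Sum>j=p..<m. real (Suc j) powr (- 1 - \<beta>)) \<le> (1 + 1 / \<beta>) * real (Suc p) powr (- \<beta>)"
proof (cases "p < m")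
  case True
  define g where "g x = - (x powr (- \<beta>)) / \<beta>" for x :: real
  have step: "real (Suc j) powr (- 1 - \<beta>) \<le> g (real (Suc j)) - g (real j)" if j: "j > 0" for j
  proof -
    have "\<exists>z>real j. z < real (Suc j) \<and> g (real (Suc j)) - g (real j) = (real (Suc j) - real j) * (z powr (- \<beta> - 1))"
    proof (rule MVT2)
      fix x assume "real j \<le> x" 
      then have "x > 0" using j by linarith
      then show "(g has_real_derivative x powr (- \<beta> - 1)) (at x)"
        unfolding g_def using \<beta> by (auto intro!: derivative_eq_intros simp: field_simps)
    qed simp
    then obtain z where z: "z > real j" "z < real (Suc j)" "g (real (Suc j)) - g (real j) = z powr (- \<beta> - 1)" by auto
    have "real (Suc j) powr (- \<beta> - 1) \<le> z powr (- \<beta> - 1)"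
      using z \<beta> j by (intro powr_mono2') auto
    moreover have "- \<beta> - 1 = - 1 - \<beta>" by simp
    ultimately show ?thesis using z(3) by metis
  qed
  have "(\<Sum>j=p..<m. real (Suc j) powr (- 1 - \<beta>)) = real (Suc p) powr (- 1 - \<beta>) + (\<Sum>j=Suc p..<m. real (Suc j) powr (- 1 - \<beta>))"
    by (rule sum.atLeast_Suc_lessThan[OF True])
  also have "(\<Sum>j=Suc p..<m. real (Suc j) powr (- 1 - \<beta>)) \<le> (\<Sum>j=Suc p..<m. g (real (Suc j)) - g (real j))"
    by (intro sum_mono step) auto
  also have "\<dots> = g (real m) - g (real (Suc p))"
    using True by (intro sum_Suc_diff'[where f="\<lambda>j. g (real j)"]) simp
  also have "\<dots> \<le> real (Suc p) powr (- \<beta>) / \<beta>" using \<beta> by (simp add: g_def)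
  also have "real (Suc p) powr (- 1 - \<beta>) \<le> real (Suc p) powr (- \<beta>)" by (intro powr_mono) auto
  finally show ?thesis by (simp add: algebra_simps)
qed (use \<beta> in simp)

text \<open>A single term of the exponential series. Its purpose: radii that shrink like a power of
  index over dimension cost the small-ball probability only a factor exponential in the
  dimension.\<close>

lemma fact_ge_power_exp: "real d ^ d * exp (- real d) \<le> fact d"
proof -
  have "(\<Sum>k\<in>{d}. inverse (fact k) * real d ^ k) \<le> (\<Sum>k. inverse (fact k) * real d ^ k)"
    using summable_exp[of "real d"] by (intro sum_le_suminf) auto
  also have "\<dots> = exp (real d)" by (simp add: exp_def scaleR_conv_of_real)
  finally have "real d ^ d \<le> fact d * exp (real d)"
    by (simp add: field_simps)
  then have "real d ^ d * exp (- real d) \<le> (fact d * exp (real d)) * exp (- real d)" by (intro mult_right_mono) auto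
  then show ?thesis by (simp add: mult.assoc mult_exp_exp)
qed

section \<open>Contraction rate\<close>

lemma powr_mult_eqI: "a + c = s \<Longrightarrow> x powr a * x powr c = (x::real) powr s"
  by (simp flip: powr_add)

text \<open>Both \<open>n\<close> and the prior scale are expressed by \<open>J\<close>, the latter
  as R_n = J powr (\<gamma> - \<delta>), so that all estimates become arithmetic of exponents.
  Indices start at 0, hence the \<open>Suc\<close> and the offsets 5 and 1 in the support
  conditions.\<close>

locale meyer_regression =
  gaussian_regression_eigenbasis P \<eta> b G m0 e \<rho> + prior: gaussian_prior m0 \<phi> v
  for P :: "'w measure" and \<eta> :: "'b::{real_inner, complete_space, second_countable_topology} \<Rightarrow> 'w \<Rightarrow> real"
    and b :: "nat \<Rightarrow> 'b"
    and G :: "'a::{real_inner, complete_space, second_countable_topology} \<Rightarrow> 'b"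
    and m0 :: "'a measure" and e :: "nat \<Rightarrow> 'a" and \<rho> :: "nat \<Rightarrow> real"
    and \<phi> :: "nat \<Rightarrow> 'a" and v :: "nat \<Rightarrow> real" +
  fixes \<alpha> \<delta> \<gamma> c1 c2 J :: real and n :: nat
  assumes pos: "\<alpha> > 0" "\<delta> > 0" "\<gamma> > 0" "c1 > 0" "c2 > 0" and \<gamma>\<delta>: "2 * \<gamma> \<le> 1 + 2 * \<delta>"
    and \<rho>_lower: "\<And>k. c1 * (1 + (real (Suc k))\<^sup>2) powr (- \<alpha> / 2) \<le> \<rho> k"
    and \<rho>_upper: "\<And>k. \<rho> k \<le> c2 * (1 + (real (Suc k))\<^sup>2) powr (- \<alpha> / 2)"
    and supp_upper: "\<And>j k. j > 3 * k + 5 \<Longrightarrow> \<phi> j \<bullet> e k = 0"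
    and supp_lower: "\<And>j k. k > 2 * j + 1 \<Longrightarrow> \<phi> j \<bullet> e k = 0"
    and v: "\<And>j. v j = J powr (2 * \<delta> - 2 * \<gamma>) * real (Suc j) powr (- 1 - 2 * \<delta>)"
    and J: "J \<ge> 1" and n: "real n = J powr (1 + 2 * \<alpha> + 2 * \<gamma>)"
begin

definition cut :: nat where "cut = nat \<lceil>J\<rceil>"

text \<open>A wavelet with index \<open>j\<close> reaches up to frequency \<open>2 * j + 1\<close>,
  so exactly the wavelets below \<open>half\<close> are guaranteed to stay below frequency
  \<open>cut\<close>.\<close>

definition half :: nat where "half = cut div 2"

lemma J_pos: "0 < J" using J by linarith

lemma cut_bounds: "J \<le> real cut" "real cut \<le> 2 * J"
  using J unfolding cut_def by linarith+

lemma half_bound: "half \<le> p \<Longrightarrow> J / 2 \<le> real (Suc p)"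
proof -
  assume "half \<le> p"
  then have "cut \<le> 2 * Suc p" by (simp add: half_def)
  then have "real cut \<le> 2 * real (Suc p)" by (metis of_nat_le_iff of_nat_mult of_nat_numeral)
  then have "J \<le> 2 * real (Suc p)" using cut_bounds(1) by (rule order_trans[rotated])
  then show "J / 2 \<le> real (Suc p)" by simp
qed

lemma half_le_cut: "half \<le> cut" by (simp add: half_def)

lemma n_pos: "n \<ge> 1"
proof -
  have "1 \<le> real n" unfolding n using J pos by (intro ge_one_powr_ge_zero) auto
  then show ?thesis by simp
qed

lemma Suc_powr_le: "half \<le> p \<Longrightarrow> 0 \<le> s \<Longrightarrow> real (Suc p) powr (- s) \<le> 2 powr s * J powr (- s)"
proof -
  assume p: "half \<le> p" and s: "0 \<le> s"
  have "real (Suc p) powr (- s) \<le> (J / 2) powr (- s)"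
    using half_bound[OF p] J_pos s by (intro powr_mono2') auto
  also have "(J / 2) powr (- s) = 2 powr s * J powr (- s)"
    using J_pos by (simp add: powr_divide powr_minus field_simps)
  finally show ?thesis .
qed

text \<open>With this scaling the prior's energy beyond a cut-off of order \<open>J\<close> is of
  the order of the squared rate.\<close>

lemma prior_tail_sum:
  assumes p: "half \<le> p"
  shows "(\<Sum>j=p..<m. v j) \<le> ((1 + 1 / (2 * \<delta>)) * 2 powr (2 * \<delta>)) * J powr (- 2 * \<gamma>)"
proof -
  have "(\<Sum>j=p..<m. v j) = J powr (2 * \<delta> - 2 * \<gamma>) * (\<Sum>j=p..<m. real (Suc j) powr (- 1 - 2 * \<delta>))"
    by (simp only: v sum_distrib_left)
  also have "\<dots> \<le> J powr (2 * \<delta> - 2 * \<gamma>) * ((1 + 1 / (2 * \<delta>)) * real (Suc p) powr (- (2 * \<delta>)))"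
    using pos sum_powr_tail_le[of "2 * \<delta>" p m] by (intro mult_left_mono) auto
  also have "\<dots> \<le> J powr (2 * \<delta> - 2 * \<gamma>) * ((1 + 1 / (2 * \<delta>)) * (2 powr (2 * \<delta>) * J powr (- (2 * \<delta>))))"
    using pos by (intro mult_left_mono Suc_powr_le p) auto
  also have "\<dots> = ((1 + 1 / (2 * \<delta>)) * 2 powr (2 * \<delta>)) * (J powr (2 * \<delta> - 2 * \<gamma>) * J powr (- (2 * \<delta>)))"
    by (simp only: mult_ac)
  also have "J powr (2 * \<delta> - 2 * \<gamma>) * J powr (- (2 * \<delta>)) = J powr (- 2 * \<gamma>)"
    by (rule powr_mult_eqI) simp
  finally show ?thesis .
qed

text \<open>Admits an exponential Markov parameter of order J powr (1 + 2\<gamma>); multiplied by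
  the squared rate it yields an exponent of order J.\<close>

lemma prior_variance_bound: "half \<le> j \<Longrightarrow> v j \<le> 2 powr (1 + 2 * \<delta>) * J powr (- 1 - 2 * \<gamma>)"
proof -
  assume j: "half \<le> j"
  have "v j = J powr (2 * \<delta> - 2 * \<gamma>) * real (Suc j) powr (- (1 + 2 * \<delta>))" by (simp add: v)
  also have "\<dots> \<le> J powr (2 * \<delta> - 2 * \<gamma>) * (2 powr (1 + 2 * \<delta>) * J powr (- (1 + 2 * \<delta>)))"
    using pos by (intro mult_left_mono Suc_powr_le j) auto
  also have "\<dots> = 2 powr (1 + 2 * \<delta>) * (J powr (2 * \<delta> - 2 * \<gamma>) * J powr (- (1 + 2 * \<delta>)))"
    by (simp only: mult_ac)
  also have "J powr (2 * \<delta> - 2 * \<gamma>) * J powr (- (1 + 2 * \<delta>)) = J powr (- 1 - 2 * \<gamma>)"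
    by (rule powr_mult_eqI) simp
  finally show ?thesis .
qed

section \<open>Estimates around a fixed truth\<close>

context
  fixes u0 :: 'a and U :: real
  assumes smooth: "summable (\<lambda>j. real (Suc j) powr (2 * \<gamma>) * (u0 \<bullet> \<phi> j)\<^sup>2)"
    and U: "(\<Sum>j. real (Suc j) powr (2 * \<gamma>) * (u0 \<bullet> \<phi> j)\<^sup>2) \<le> U"
begin

lemma U_nonneg: "0 \<le> U"
  using suminf_nonneg[OF smooth] U by simp

text \<open>From index \<open>half\<close> on the smoothness weights are at least of order J powr
  (2\<gamma>), so truncating the truth costs no more than the squared rate.\<close>

lemma truth_tail:
  assumes p: "half \<le> p"
  shows "onb_tail \<phi> p u0 \<le> 2 powr (2 * \<gamma>) * U * J powr (- 2 * \<gamma>)"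
proof -
  let ?f = "\<lambda>j. real (Suc j) powr (2 * \<gamma>) * (u0 \<bullet> \<phi> j)\<^sup>2"
  have "onb_tail \<phi> p u0 \<le> (2 powr (2 * \<gamma>) * J powr (- (2 * \<gamma>))) * suminf ?f"
  proof (rule onb_tail_le_weighted[OF prior.\<phi> _ smooth])
    fix j assume "p \<le> j"
    then have j: "half \<le> j" using p by simp
    have "(u0 \<bullet> \<phi> j)\<^sup>2 = real (Suc j) powr (- (2 * \<gamma>)) * ?f j"
      by (simp add: powr_minus)
    also have "\<dots> \<le> (2 powr (2 * \<gamma>) * J powr (- (2 * \<gamma>))) * ?f j"
      using pos by (intro mult_right_mono Suc_powr_le j) auto
    finally show "(u0 \<bullet> \<phi> j)\<^sup>2 \<le> (2 powr (2 * \<gamma>) * J powr (- (2 * \<gamma>))) * ?f j" .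
  qed auto
  also have "\<dots> \<le> (2 powr (2 * \<gamma>) * J powr (- (2 * \<gamma>))) * U" by (intro mult_left_mono U) auto
  finally show ?thesis by (simp add: mult_ac)
qed

text \<open>The only use of \<open>2 * \<gamma> \<le> 1 + 2 * \<delta>\<close>: the truth need not lie in the Cameron-Martin space, but the
  squared Cameron-Martin norm of its truncation at the cut-off is at most of order \<open>J\<close>.\<close>

lemma truth_cameron_martin:
  "(\<Sum>j<cut. (u0 \<bullet> \<phi> j)\<^sup>2 / v j) \<le> 2 powr (1 + 2 * \<delta> - 2 * \<gamma>) * U * J"
proof -
  let ?f = "\<lambda>j. real (Suc j) powr (2 * \<gamma>) * (u0 \<bullet> \<phi> j)\<^sup>2"
  let ?s = "1 + 2 * \<delta> - 2 * \<gamma>"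
  have "(u0 \<bullet> \<phi> j)\<^sup>2 / v j \<le> (J powr (2 * \<gamma> - 2 * \<delta>) * (2 * J) powr ?s) * ?f j" if j: "j < cut" for j
  proof -
    have "(u0 \<bullet> \<phi> j)\<^sup>2 / v j = (u0 \<bullet> \<phi> j)\<^sup>2 * (J powr (- (2 * \<delta> - 2 * \<gamma>)) * real (Suc j) powr (- (- 1 - 2 * \<delta>)))"
      unfolding v powr_minus by (simp add: field_simps)
    also have "real (Suc j) powr (- (- 1 - 2 * \<delta>)) = real (Suc j) powr ?s * real (Suc j) powr (2 * \<gamma>)"
      by (rule powr_mult_eqI[symmetric]) simp
    also have "(u0 \<bullet> \<phi> j)\<^sup>2 * (J powr (- (2 * \<delta> - 2 * \<gamma>)) * (real (Suc j) powr ?s * real (Suc j) powr (2 * \<gamma>)))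
        = (J powr (2 * \<gamma> - 2 * \<delta>) * real (Suc j) powr ?s) * ?f j"
      by (simp add: mult_ac)
    also have "\<dots> \<le> (J powr (2 * \<gamma> - 2 * \<delta>) * (2 * J) powr ?s) * ?f j"
    proof (intro mult_right_mono mult_left_mono powr_mono2)
      show "real (Suc j) \<le> 2 * J" using j cut_bounds(2) by linarith
    qed (use \<gamma>\<delta> in auto)
    finally show ?thesis .
  qed
  then have "(\<Sum>j<cut. (u0 \<bullet> \<phi> j)\<^sup>2 / v j) \<le> (\<Sum>j<cut. (J powr (2 * \<gamma> - 2 * \<delta>) * (2 * J) powr ?s) * ?f j)"
    by (intro sum_mono) auto
  also have "\<dots> = (J powr (2 * \<gamma> - 2 * \<delta>) * (2 * J) powr ?s) * (\<Sum>j<cut. ?f j)"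
    by (simp only: sum_distrib_left)
  also have "\<dots> \<le> (J powr (2 * \<gamma> - 2 * \<delta>) * (2 * J) powr ?s) * U"
  proof (intro mult_left_mono)
    have "(\<Sum>j<cut. ?f j) \<le> suminf ?f" by (rule sum_le_suminf[OF smooth]) auto
    then show "(\<Sum>j<cut. ?f j) \<le> U" using U by simp
  qed auto
  also have "(2 * J) powr ?s = 2 powr ?s * J powr ?s" using J_pos by (simp add: powr_mult)
  also have "J powr (2 * \<gamma> - 2 * \<delta>) * (2 powr ?s * J powr ?s) * U
      = 2 powr ?s * U * (J powr (2 * \<gamma> - 2 * \<delta>) * J powr ?s)" by (simp only: mult_ac)
  also have "J powr (2 * \<gamma> - 2 * \<delta>) * J powr ?s = J powr 1" by (rule powr_mult_eqI) simp
  finally show ?thesis using J_pos by simp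
qed

text \<open>The neighbourhood is a box around the truth in the first \<open>cut\<close> wavelets,
  with the remaining energy of \<open>u\<close> merely kept small; the tail of the truth is of the
  same size anyway. \<open>C5\<close> collects the cost in prior mass and \<open>C6\<close> the
  error seen through \<open>G\<close>.\<close>

lemma prior_mass_near_truth:
  fixes C3 C5 C6 \<sigma> :: real
  defines "C3 \<equiv> (1 + 1 / (2 * \<delta>)) * 2 powr (2 * \<delta>)"
  defines "\<sigma> \<equiv> (1 + 2 * \<alpha> + 2 * \<delta>) / 2"
  defines "C5 \<equiv> 2 * (2 + \<sigma>) + 2 powr (1 + 2 * \<delta> - 2 * \<gamma>) * U"
  defines "C6 \<equiv> c2\<^sup>2 * 6 powr (2 * \<alpha>) * (1 + 4 * C3 + 2 * 2 powr (2 * \<gamma>) * U)"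
  shows "\<exists>B\<in>sets m0. measure m0 B \<ge> exp (- C5 * J) / 2 \<and>
    (\<forall>u\<in>B. real n * (norm (G (u - u0)))\<^sup>2 \<le> C6 * J)"
proof -
  define d where "d = real cut"
  have d: "J \<le> d" "d \<le> 2 * J" "0 < d" using cut_bounds J_pos by (auto simp: d_def)
  have \<sigma>: "\<sigma> > 0" using pos by (simp add: \<sigma>_def)
  \<comment> \<open>The exponent \<sigma> makes
    \<open>real (Suc j) powr (- 2 * \<alpha>) * (r j)\<^sup>2\<close> the same for all
    \<open>j\<close>, so the coordinates share the error budget equally. The product of the ratios
    \<open>r j / sqrt (v j)\<close> is the \<sigma>-th power of a factorial over
    \<open>d ^ cut\<close>, at least exp (- \<sigma> d).\<close>
  define r where "r j = sqrt (v j) * (real (Suc j) / d) powr \<sigma>" for j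
  define V where "V = C3 * J powr (- 2 * \<gamma>)"
  have C3: "C3 > 0" using pos by (simp add: C3_def add_pos_pos)
  have V: "V > 0" using J_pos C3 by (simp add: V_def)
  define B where "B = {u. (\<forall>j<cut. \<bar>u \<bullet> \<phi> j - u0 \<bullet> \<phi> j\<bar> \<le> r j) \<and> onb_tail \<phi> cut u \<le> 2 * V}"
  have r: "0 < r j" "r j \<le> sqrt (v j)" if "j < cut" for j
  proof -
    have sv: "0 < sqrt (v j)" using prior.v_pos by simp
    have "real (Suc j) / d \<le> 1" using that d by (simp add: d_def)
    then have "(real (Suc j) / d) powr \<sigma> \<le> 1" using \<sigma> d by (intro powr_le1) auto
    then show "r j \<le> sqrt (v j)" using sv by (simp add: r_def mult_left_le)
    show "0 < r j" using sv d by (simp add: r_def)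
  qed
  have sumV: "(\<Sum>j=cut..<m. v j) \<le> V" for m
    using prior_tail_sum[OF half_le_cut, of m] by (simp add: V_def C3_def)
  note sb = prior.small_ball[of cut r V "\<lambda>j. u0 \<bullet> \<phi> j", OF r sumV V]
  have B: "B \<in> sets m0" using sb(1) by (simp add: B_def)
  have "exp (- C5 * J) \<le> (\<Prod>j<cut. exp (- 1 - (u0 \<bullet> \<phi> j)\<^sup>2 / v j) * sqrt (2 / pi) * (r j / sqrt (v j)))"
  proof -
    have "exp (- C5 * J) \<le> exp (- 2 * d - (\<Sum>j<cut. (u0 \<bullet> \<phi> j)\<^sup>2 / v j)) * exp (- d) powr \<sigma>"
    proof -
      \<comment> \<open>Per coordinate, 1 in the exponent comes from the Gaussian density, 1 from
        exp (-1) \<le> sqrt (2 / pi), and \<sigma> from the shrunken radius; there are at most 2 J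
        coordinates.\<close>
      have "d * (2 + \<sigma>) \<le> (2 * J) * (2 + \<sigma>)" using d \<sigma> by (intro mult_right_mono) auto
      then have "- C5 * J \<le> - 2 * d - (\<Sum>j<cut. (u0 \<bullet> \<phi> j)\<^sup>2 / v j) + - d * \<sigma>"
        using truth_cameron_martin by (simp add: C5_def algebra_simps)
      then show ?thesis by (simp add: mult_exp_exp powr_def mult.commute)
    qed
    also have "\<dots> \<le> exp (- 2 * d - (\<Sum>j<cut. (u0 \<bullet> \<phi> j)\<^sup>2 / v j)) * (\<Prod>j<cut. real (Suc j) / d) powr \<sigma>"
    proof (intro mult_left_mono powr_mono2)
      have "(\<Prod>j<cut. real (Suc j) / d) = fact cut / d ^ cut"
        by (simp add: prod_dividef fact_prod_Suc atLeast0LessThan)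
      moreover have "exp (- d) \<le> fact cut / d ^ cut"
        using fact_ge_power_exp[of cut] d by (simp add: d_def field_simps)
      ultimately show "exp (- d) \<le> (\<Prod>j<cut. real (Suc j) / d)" by simp
    qed (use \<sigma> in auto)
    also have "(\<Prod>j<cut. real (Suc j) / d) powr \<sigma> = (\<Prod>j<cut. (real (Suc j) / d) powr \<sigma>)"
      by (rule prod_powr_distrib)
    also have "exp (- 2 * d - (\<Sum>j<cut. (u0 \<bullet> \<phi> j)\<^sup>2 / v j)) = (\<Prod>j<cut. exp (- 2 - (u0 \<bullet> \<phi> j)\<^sup>2 / v j))"
      by (simp add: exp_sum[symmetric] sum_subtractf d_def)
    also have "(\<Prod>j<cut. exp (- 2 - (u0 \<bullet> \<phi> j)\<^sup>2 / v j)) * (\<Prod>j<cut. (real (Suc j) / d) powr \<sigma>)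
        = (\<Prod>j<cut. exp (- 2 - (u0 \<bullet> \<phi> j)\<^sup>2 / v j) * (real (Suc j) / d) powr \<sigma>)"
      by (simp only: prod.distrib)
    also have "\<dots> \<le> (\<Prod>j<cut. exp (- 1 - (u0 \<bullet> \<phi> j)\<^sup>2 / v j) * sqrt (2 / pi) * (r j / sqrt (v j)))"
    proof (intro prod_mono conjI)
      fix j
      have e: "exp (- 1) \<le> sqrt (2 / pi)"
      proof (rule real_le_rsqrt)
        have "pi / 2 \<le> exp 2" using pi_less_4 exp_ge_add_one_self[of "2::real"] by linarith
        then show "(exp (- 1))\<^sup>2 \<le> 2 / pi"
          by (simp add: exp_minus field_simps power2_eq_square mult_exp_exp)
      qed
      have "exp (- 2 - (u0 \<bullet> \<phi> j)\<^sup>2 / v j) = exp (- 1 - (u0 \<bullet> \<phi> j)\<^sup>2 / v j) * exp (- 1)"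
        by (simp add: mult_exp_exp)
      also have "\<dots> \<le> exp (- 1 - (u0 \<bullet> \<phi> j)\<^sup>2 / v j) * sqrt (2 / pi)" by (intro mult_left_mono e) simp
      finally show "exp (- 2 - (u0 \<bullet> \<phi> j)\<^sup>2 / v j) * (real (Suc j) / d) powr \<sigma>
          \<le> exp (- 1 - (u0 \<bullet> \<phi> j)\<^sup>2 / v j) * sqrt (2 / pi) * (r j / sqrt (v j))"
        using prior.v_pos[of j] by (simp add: r_def mult_right_mono)
    qed simp
    finally show ?thesis .
  qed
  then have mass: "measure m0 B \<ge> exp (- C5 * J) / 2"
    using sb(2) by (simp add: B_def)
  have "real n * (norm (G (u - u0)))\<^sup>2 \<le> C6 * J" if u: "u \<in> B" for u
  proof -
    define h where "h = u - u0"
    let ?w = "\<lambda>j. real (Suc j) powr (- 2 * \<alpha>)"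
    define F where "F = (\<lambda>j. ?w j * (h \<bullet> \<phi> j)\<^sup>2)"
    have J\<alpha>: "?w j \<le> J powr (- 2 * \<alpha>)" if "cut \<le> j" for j
      using that cut_bounds(1) J_pos pos by (intro powr_mono2') auto
    have tail_h: "onb_tail \<phi> cut h \<le> (4 * C3 + 2 * 2 powr (2 * \<gamma>) * U) * J powr (- 2 * \<gamma>)"
    proof -
      have "onb_tail \<phi> cut h \<le> 2 * onb_tail \<phi> cut u + 2 * onb_tail \<phi> cut u0"
        unfolding h_def by (rule onb_tail_diff[OF prior.\<phi>])
      also have "\<dots> \<le> 2 * (2 * V) + 2 * (2 powr (2 * \<gamma>) * U * J powr (- 2 * \<gamma>))"
        using u truth_tail[OF half_le_cut] by (intro add_mono mult_left_mono) (auto simp: B_def)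
      finally show ?thesis by (simp add: V_def algebra_simps)
    qed
    have headF: "(\<Sum>j<cut. F j) \<le> J powr (- 2 * \<gamma>) * J powr (- 2 * \<alpha>)"
    proof -
      have "F j \<le> J powr (2 * \<delta> - 2 * \<gamma>) * d powr (- (1 + 2 * \<alpha> + 2 * \<delta>))" if j: "j < cut" for j
      proof -
        have sj: "real (Suc j) > 0" by simp
        have "\<bar>h \<bullet> \<phi> j\<bar> \<le> r j" using u j by (simp add: B_def h_def inner_diff_left)
        then have "(h \<bullet> \<phi> j)\<^sup>2 \<le> (r j)\<^sup>2" using r(1)[OF j] by (intro abs_le_square_iff[THEN iffD1]) auto
        also have "(r j)\<^sup>2 = v j * ((real (Suc j) / d) powr \<sigma> * (real (Suc j) / d) powr \<sigma>)"
          using prior.v_pos[of j] by (simp add: r_def power_mult_distrib power2_eq_square[of "_ powr _"] less_imp_le)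
        also have "(real (Suc j) / d) powr \<sigma> * (real (Suc j) / d) powr \<sigma> = (real (Suc j) / d) powr (1 + 2 * \<alpha> + 2 * \<delta>)"
          by (rule powr_mult_eqI) (simp add: \<sigma>_def field_simps)
        also have "\<dots> = real (Suc j) powr (1 + 2 * \<alpha> + 2 * \<delta>) * d powr (- (1 + 2 * \<alpha> + 2 * \<delta>))"
          using d by (subst powr_divide) (auto simp only: powr_minus divide_inverse)
        finally have "F j \<le> ?w j * (v j * (real (Suc j) powr (1 + 2 * \<alpha> + 2 * \<delta>) * d powr (- (1 + 2 * \<alpha> + 2 * \<delta>))))"
          unfolding F_def by (intro mult_left_mono) auto
        also have "\<dots> = (?w j * real (Suc j) powr (- 1 - 2 * \<delta>)) * real (Suc j) powr (1 + 2 * \<alpha> + 2 * \<delta>)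
            * (J powr (2 * \<delta> - 2 * \<gamma>) * d powr (- (1 + 2 * \<alpha> + 2 * \<delta>)))"
          unfolding v by (simp only: mult_ac)
        also have "?w j * real (Suc j) powr (- 1 - 2 * \<delta>) = real (Suc j) powr (- (1 + 2 * \<alpha> + 2 * \<delta>))"
          by (rule powr_mult_eqI) simp
        also have "real (Suc j) powr (- (1 + 2 * \<alpha> + 2 * \<delta>)) * real (Suc j) powr (1 + 2 * \<alpha> + 2 * \<delta>) = real (Suc j) powr 0"
          by (rule powr_mult_eqI) simp
        finally show ?thesis using sj by simp
      qed
      then have "(\<Sum>j<cut. F j) \<le> (\<Sum>j<cut. J powr (2 * \<delta> - 2 * \<gamma>) * d powr (- (1 + 2 * \<alpha> + 2 * \<delta>)))"
        by (intro sum_mono) auto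
      also have "\<dots> = J powr (2 * \<delta> - 2 * \<gamma>) * (d powr 1 * d powr (- (1 + 2 * \<alpha> + 2 * \<delta>)))"
        using d by (simp add: d_def[symmetric])
      also have "d powr 1 * d powr (- (1 + 2 * \<alpha> + 2 * \<delta>)) = d powr (- (2 * \<alpha> + 2 * \<delta>))"
        by (rule powr_mult_eqI) simp
      also have "J powr (2 * \<delta> - 2 * \<gamma>) * d powr (- (2 * \<alpha> + 2 * \<delta>)) \<le> J powr (2 * \<delta> - 2 * \<gamma>) * J powr (- (2 * \<alpha> + 2 * \<delta>))"
        using d J_pos pos by (intro mult_left_mono powr_mono2') auto
      also have "\<dots> = J powr (- 2 * \<gamma> - 2 * \<alpha>)" by (rule powr_mult_eqI) simp
      also have "\<dots> = J powr (- 2 * \<gamma>) * J powr (- 2 * \<alpha>)" by (rule powr_mult_eqI[symmetric]) simp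
      finally show ?thesis .
    qed
    have sumF: "(\<Sum>j<m. F j) \<le> (\<Sum>j<cut. F j) + J powr (- 2 * \<alpha>) * onb_tail \<phi> cut h" for m
    proof -
      have F0: "0 \<le> F j" for j by (simp add: F_def)
      have "(\<Sum>j<m. F j) \<le> (\<Sum>j<max m cut. F j)" by (intro sum_mono2) (auto simp: F0)
      also have "\<dots> = (\<Sum>j<cut. F j) + (\<Sum>j=cut..<max m cut. F j)"
        using sum.atLeastLessThan_concat[of 0 cut "max m cut" F] by (simp add: atLeast0LessThan)
      also have "(\<Sum>j=cut..<max m cut. F j) \<le> (\<Sum>j=cut..<max m cut. J powr (- 2 * \<alpha>) * (h \<bullet> \<phi> j)\<^sup>2)"
        unfolding F_def by (intro sum_mono mult_right_mono J\<alpha>) auto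
      also have "\<dots> = J powr (- 2 * \<alpha>) * (\<Sum>j=cut..<max m cut. (h \<bullet> \<phi> j)\<^sup>2)"
        by (simp only: sum_distrib_left)
      also have "\<dots> \<le> J powr (- 2 * \<alpha>) * onb_tail \<phi> cut h"
      proof (intro mult_left_mono)
        have "(\<Sum>j=cut..<max m cut. (h \<bullet> \<phi> j)\<^sup>2) + (\<Sum>j<cut. (h \<bullet> \<phi> j)\<^sup>2) = (\<Sum>j<max m cut. (h \<bullet> \<phi> j)\<^sup>2)"
          using sum.atLeastLessThan_concat[of 0 cut "max m cut" "\<lambda>j. (h \<bullet> \<phi> j)\<^sup>2"] by (simp add: atLeast0LessThan)
        then show "(\<Sum>j=cut..<max m cut. (h \<bullet> \<phi> j)\<^sup>2) \<le> onb_tail \<phi> cut h"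
          using onb_bessel[OF prior.\<phi>, of "{..<max m cut}" h] by (simp add: onb_tail_def)
      qed simp
      finally show ?thesis by simp
    qed
    have "(norm (G h))\<^sup>2 \<le> c2\<^sup>2 * 6 powr (2 * \<alpha>) * suminf F"
      unfolding F_def using pos \<rho>_pos
      by (intro smoothing_norm_upper_bound[OF e prior.\<phi> G _ _ eig _ \<rho>_upper supp_upper]) (auto intro: less_imp_le)
    also have "suminf F \<le> (\<Sum>j<cut. F j) + J powr (- 2 * \<alpha>) * onb_tail \<phi> cut h"
    proof (rule suminf_le_const[OF _ sumF])
      show "summable F"
        by (rule summableI_nonneg_bounded[OF _ sumF]) (simp add: F_def)
    qed
    also have "\<dots> \<le> J powr (- 2 * \<gamma>) * J powr (- 2 * \<alpha>) + J powr (- 2 * \<alpha>) * ((4 * C3 + 2 * 2 powr (2 * \<gamma>) * U) * J powr (- 2 * \<gamma>))"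
      by (intro add_mono headF mult_left_mono tail_h) auto
    finally have Gh: "(norm (G h))\<^sup>2 \<le> c2\<^sup>2 * 6 powr (2 * \<alpha>)
        * (J powr (- 2 * \<gamma>) * J powr (- 2 * \<alpha>) + J powr (- 2 * \<alpha>) * ((4 * C3 + 2 * 2 powr (2 * \<gamma>) * U) * J powr (- 2 * \<gamma>)))"
      using pos by (simp add: mult_left_mono)
    have "real n * (norm (G h))\<^sup>2 \<le> real n * (c2\<^sup>2 * 6 powr (2 * \<alpha>)
        * (J powr (- 2 * \<gamma>) * J powr (- 2 * \<alpha>) + J powr (- 2 * \<alpha>) * ((4 * C3 + 2 * 2 powr (2 * \<gamma>) * U) * J powr (- 2 * \<gamma>))))"
      by (intro mult_left_mono Gh) simp
    \<comment> \<open>The summands of the last factor of \<open>C6\<close>: 1 for the box,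
      \<open>4 * C3\<close> for twice the tail bound \<open>2 * V\<close> of \<open>u\<close>, and
      the last for twice the tail of the truth.\<close>
    also have "\<dots> = C6 * ((real n * J powr (- 2 * \<gamma>)) * J powr (- 2 * \<alpha>))"
      by (simp add: C6_def algebra_simps)
    also have "real n * J powr (- 2 * \<gamma>) = J powr (1 + 2 * \<alpha>)"
      unfolding n by (rule powr_mult_eqI) simp
    also have "J powr (1 + 2 * \<alpha>) * J powr (- 2 * \<alpha>) = J powr 1" by (rule powr_mult_eqI) simp
    finally show ?thesis using J_pos by (simp add: h_def)
  qed
  then show ?thesis using B mass by blast
qed

text \<open>The tails of \<open>u\<close> and of the truth beyond \<open>half\<close> account for at
  most half of the squared distance, so the wavelets below \<open>half\<close> carry the rest. These
  are built from frequencies below \<open>cut\<close>, where \<open>\<rho> k\<close> is still at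
  least of order J powr -\<alpha>.\<close>

lemma head_detects_distance:
  assumes A: "norm (u - u0) > M * J powr (- \<gamma>)" "0 < M"
    and A2: "onb_tail \<phi> half u \<le> M\<^sup>2 / 8 * J powr (- 2 * \<gamma>)"
    and M: "8 * 2 powr (2 * \<gamma>) * U \<le> M\<^sup>2"
  shows "(c1\<^sup>2 * 5 powr (- \<alpha>) / 2) * M\<^sup>2 * J \<le> real n * (norm (G (head cut (u - u0))))\<^sup>2"
proof -
  define h where "h = u - u0"
  define x where "x = M\<^sup>2 * J powr (- 2 * \<gamma>)"
  have x0: "0 \<le> x" by (simp add: x_def)
  have normh: "x \<le> (norm h)\<^sup>2"
  proof -
    have "(M * J powr (- \<gamma>))\<^sup>2 \<le> (norm h)\<^sup>2" using A by (intro power_mono) (auto simp: h_def)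
    moreover have "J powr (- \<gamma>) * J powr (- \<gamma>) = J powr (- 2 * \<gamma>)" by (rule powr_mult_eqI) simp
    ultimately show ?thesis by (simp add: x_def power2_eq_square mult_ac)
  qed
  have "onb_tail \<phi> half h \<le> 2 * onb_tail \<phi> half u + 2 * onb_tail \<phi> half u0"
    unfolding h_def by (rule onb_tail_diff[OF prior.\<phi>])
  also have "\<dots> \<le> 2 * (x / 8) + 2 * (x / 8)"
  proof (intro add_mono mult_left_mono)
    show "onb_tail \<phi> half u \<le> x / 8" using A2 by (simp add: x_def)
    have "onb_tail \<phi> half u0 \<le> (2 powr (2 * \<gamma>) * U) * J powr (- 2 * \<gamma>)" by (rule truth_tail) simp
    also have "\<dots> \<le> (M\<^sup>2 / 8) * J powr (- 2 * \<gamma>)" using M by (intro mult_right_mono) auto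
    finally show "onb_tail \<phi> half u0 \<le> x / 8" by (simp add: x_def)
  qed auto
  finally have tail_h: "onb_tail \<phi> half h \<le> x / 2" by simp
  have "(\<Sum>j<half. (h \<bullet> \<phi> j)\<^sup>2) \<le> (\<Sum>k<cut. (h \<bullet> e k)\<^sup>2)"
  proof (rule onb_block_inequality[OF prior.\<phi> e])
    fix j k assume "j \<in> {..<half}" "k \<notin> {..<cut}"
    then have "k > 2 * j + 1" by (auto simp: half_def)
    then show "\<phi> j \<bullet> e k = 0" by (rule supp_lower)
  qed auto
  then have low: "x / 2 \<le> (\<Sum>k<cut. (h \<bullet> e k)\<^sup>2)"
    using tail_h normh by (simp add: onb_tail_def)
  define w where "w = c1\<^sup>2 * 5 powr (- \<alpha>) * J powr (- 2 * \<alpha>)"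
  have w: "0 \<le> w" by (simp add: w_def)
  have \<rho>w: "w \<le> (\<rho> k)\<^sup>2" if k: "k < cut" for k
  proof -
    have k2: "real (Suc k) \<le> 2 * J" using k cut_bounds(2) by linarith
    \<comment> \<open>With 1 \<le> J and \<open>Suc k\<close> at most 2 J, the constant is 5 = 1 +
      4.\<close>
    have "1 + (real (Suc k))\<^sup>2 \<le> J\<^sup>2 + (2 * J)\<^sup>2"
      using J k2 by (intro add_mono power_mono) (auto simp: one_le_power)
    then have le: "1 + (real (Suc k))\<^sup>2 \<le> 5 * J\<^sup>2" by (simp add: power_mult_distrib)
    have "w = (c1 * (5 * J\<^sup>2) powr (- \<alpha> / 2))\<^sup>2"
    proof -
      have a: "(5 * J\<^sup>2) powr (- \<alpha> / 2) = 5 powr (- \<alpha> / 2) * J powr (- \<alpha>)"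
        using J_pos by (simp add: powr_mult powr_powr flip: powr_numeral)
      have b: "5 powr (- \<alpha> / 2) * 5 powr (- \<alpha> / 2) = 5 powr (- \<alpha>)" "J powr (- \<alpha>) * J powr (- \<alpha>) = J powr (- 2 * \<alpha>)"
        by (rule powr_mult_eqI, simp)+
      have "(c1 * (5 powr (- \<alpha> / 2) * J powr (- \<alpha>)))\<^sup>2
          = c1\<^sup>2 * ((5 powr (- \<alpha> / 2) * 5 powr (- \<alpha> / 2)) * (J powr (- \<alpha>) * J powr (- \<alpha>)))"
        by (simp only: power2_eq_square mult_ac)
      then show ?thesis unfolding a w_def by (simp only: b mult.assoc)
    qed
    also have "\<dots> \<le> (\<rho> k)\<^sup>2"
    proof (rule power_mono)
      have "c1 * (5 * J\<^sup>2) powr (- \<alpha> / 2) \<le> c1 * (1 + (real (Suc k))\<^sup>2) powr (- \<alpha> / 2)"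
        using pos le by (intro mult_left_mono powr_mono2') (auto intro: add_pos_nonneg)
      then show "c1 * (5 * J\<^sup>2) powr (- \<alpha> / 2) \<le> \<rho> k" using \<rho>_lower[of k] by linarith
    qed (use pos in simp)
    finally show ?thesis .
  qed
  have "real n * (w * (x / 2)) \<le> real n * (w * (\<Sum>k<cut. (h \<bullet> e k)\<^sup>2))"
    by (intro mult_left_mono low w) simp
  also have "\<dots> \<le> real n * (\<Sum>k<cut. (\<rho> k)\<^sup>2 * (h \<bullet> e k)\<^sup>2)"
    unfolding sum_distrib_left[of w] by (intro mult_left_mono sum_mono mult_right_mono \<rho>w) auto
  also have "\<dots> = real n * (norm (G (head cut h)))\<^sup>2" by (simp add: G_head_norm)
  also have "real n * (w * (x / 2)) = (c1\<^sup>2 * 5 powr (- \<alpha>) / 2) * M\<^sup>2 * ((real n * J powr (- 2 * \<gamma>)) * J powr (- 2 * \<alpha>))"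
    by (simp add: w_def x_def mult_ac)
  also have "real n * J powr (- 2 * \<gamma>) = J powr (1 + 2 * \<alpha>)"
    unfolding n by (rule powr_mult_eqI) simp
  also have "J powr (1 + 2 * \<alpha>) * J powr (- 2 * \<alpha>) = J powr 1" by (rule powr_mult_eqI) simp
  finally show ?thesis using J_pos by (simp add: h_def)
qed

text \<open>\<open>C7 * J\<close> is the exponent lost in dividing by the normalising constant:
  \<open>C5\<close> for the prior mass of \<open>B\<close> and 3/2 \<open>C6\<close> for the
  likelihood ratio on it. \<open>M3\<close> and \<open>M4\<close> push the prior tail and the
  low-frequency factor down to exp (-(C7 + 1) J), so that exp (-J) remains; \<open>M1\<close> and
  \<open>M2\<close> make \<open>head_detects_distance\<close> and the bound on the head of the noise
  applicable.\<close>

lemma contraction_bound: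
  fixes C3 C5 C6 C7 \<kappa> \<tau> M \<epsilon> :: real
  defines "C3 \<equiv> (1 + 1 / (2 * \<delta>)) * 2 powr (2 * \<delta>)"
  defines "C5 \<equiv> 2 * (2 + (1 + 2 * \<alpha> + 2 * \<delta>) / 2) + 2 powr (1 + 2 * \<delta> - 2 * \<gamma>) * U"
  defines "C6 \<equiv> c2\<^sup>2 * 6 powr (2 * \<alpha>) * (1 + 4 * C3 + 2 * 2 powr (2 * \<gamma>) * U)"
  defines "C7 \<equiv> C5 + 3 / 2 * C6"
  defines "\<kappa> \<equiv> c1\<^sup>2 * 5 powr (- \<alpha>) / 2"
  defines "\<tau> \<equiv> 2 powr (- 3 - 2 * \<delta>)"
  assumes \<mu>: "\<mu> n = m0" and \<epsilon>: "\<epsilon> > 0" and M: "M > 0"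
    and M1: "8 * 2 powr (2 * \<gamma>) * U \<le> M\<^sup>2" and M2: "128 \<le> \<kappa> * M\<^sup>2"
    and M3: "2 * \<tau> * C3 + C7 + 1 \<le> \<tau> * (M\<^sup>2 / 8)" and M4: "C7 + 1 \<le> \<kappa> * M\<^sup>2 / 4"
  shows "measure (observation_law P G b \<eta> u0 n)
      {y. measure (posterior G b \<mu> n y) {u. norm (u - u0) > M * J powr (- \<gamma>)} > \<epsilon>}
    \<le> 2 / (C6 * J) + exp (- J / 2) + 8 / \<epsilon> * exp (- J)"
proof -
  have C3: "C3 > 0" using pos by (simp add: C3_def add_pos_pos)
  have C6: "C6 > 0" using pos C3 U_nonneg by (simp add: C6_def add_pos_nonneg)
  define s where "s = M\<^sup>2 / 8 * J powr (- 2 * \<gamma>)"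
  \<comment> \<open>The largest parameter that \<open>prior_variance_bound\<close> permits: 4 *
    \<tau> * 2 powr (1 + 2\<delta>) = 1.\<close>
  define t where "t = \<tau> * J powr (1 + 2 * \<gamma>)"
  define K where "K = \<kappa> * M\<^sup>2 * J"
  define A where "A = {u. norm (u - u0) > M * J powr (- \<gamma>)}"
  define A2 where "A2 = {u. s < onb_tail \<phi> half u}"
  obtain B where B: "B \<in> sets m0" "measure m0 B \<ge> exp (- C5 * J) / 2"
    and Bn: "\<And>u. u \<in> B \<Longrightarrow> real n * (norm (G (u - u0)))\<^sup>2 \<le> C6 * J"
    using prior_mass_near_truth unfolding C3_def[symmetric] C5_def[symmetric] C6_def[symmetric] by blast
  define \<beta> where "\<beta> = measure m0 B"
  have \<beta>: "\<beta> > 0" "exp (- C5 * J) / 2 \<le> \<beta>"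
    using B(2) less_le_trans[of 0 "exp (- C5 * J) / 2" "measure m0 B"] by (auto simp: \<beta>_def)
  have Jp: "J powr (1 + 2 * \<gamma>) * J powr (- 2 * \<gamma>) = J" "J powr (1 + 2 * \<gamma>) * J powr (- 1 - 2 * \<gamma>) = 1"
    using J_pos powr_mult_eqI[of "1 + 2 * \<gamma>" "- 2 * \<gamma>" 1 J] powr_mult_eqI[of "1 + 2 * \<gamma>" "- 1 - 2 * \<gamma>" 0 J] by auto
  have A: "A \<in> sets m0"
  proof -
    have "A = {u \<in> space m0. norm (u - u0) > M * J powr (- \<gamma>)}" by (simp add: A_def)
    also have "\<dots> \<in> sets m0" by measurable
    finally show ?thesis .
  qed
  have A2: "A2 \<in> sets m0"
    using measurable_sets[OF prior.onb_tail_measurable[of half], of "{s<..}"] by (simp add: A2_def vimage_def)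
  have bound: "measure (observation_law P G b \<eta> u0 n) {y. measure (posterior G b \<mu> n y) A > \<epsilon>}
    \<le> 2 / (C6 * J) + exp (- (real cut / 2)) + (measure m0 A2 + exp (- K / 4)) / (\<epsilon> * (\<beta> / 2 * exp (- 3 / 2 * (C6 * J))))"
  proof (rule posterior_tail_bound[where B=B])
    show "K \<le> real n * (norm (G (head cut (u - u0))))\<^sup>2" if "u \<in> A" "u \<notin> A2" for u
      unfolding K_def \<kappa>_def using that M M1
      by (intro head_detects_distance) (auto simp: A_def A2_def s_def)
    have "64 * real cut \<le> 128 * J" using cut_bounds by simp
    also have "\<dots> \<le> K" unfolding K_def using M2 J_pos by (intro mult_right_mono) auto
    finally show "64 * real cut \<le> K" .
    show "emeasure m0 B = ennreal \<beta>" by (simp add: \<beta>_def m0.emeasure_eq_measure)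
    show "C6 * J > 0" using C6 J_pos by simp
  qed (use n_pos \<mu> A A2 B Bn \<beta> \<epsilon> in auto)
  have "measure m0 A2 \<le> exp (2 * t * (C3 * J powr (- 2 * \<gamma>)) - t * s)"
    unfolding A2_def
  proof (rule prior.prior_tail)
    show "0 \<le> t" by (simp add: t_def \<tau>_def)
    show "4 * t * v j \<le> 1" if "half \<le> j" for j
    proof -
      have "4 * t * v j \<le> 4 * t * (2 powr (1 + 2 * \<delta>) * J powr (- 1 - 2 * \<gamma>))"
        using prior_variance_bound[OF that] by (intro mult_left_mono) (auto simp: t_def \<tau>_def)
      also have "\<dots> = (2 powr 2 * (\<tau> * 2 powr (1 + 2 * \<delta>))) * (J powr (1 + 2 * \<gamma>) * J powr (- 1 - 2 * \<gamma>))"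
        by (simp add: t_def)
      also have "\<tau> * 2 powr (1 + 2 * \<delta>) = 2 powr (- 2)" unfolding \<tau>_def by (rule powr_mult_eqI) simp
      also have "2 powr 2 * 2 powr (- 2) = (2::real) powr 0" by (rule powr_mult_eqI) simp
      finally show ?thesis unfolding Jp by simp
    qed
    show "(\<Sum>j=half..<m. v j) \<le> C3 * J powr (- 2 * \<gamma>)" for m
      unfolding C3_def by (rule prior_tail_sum) simp
  qed
  also have "2 * t * (C3 * J powr (- 2 * \<gamma>)) - t * s
      = (2 * \<tau> * C3 - \<tau> * (M\<^sup>2 / 8)) * (J powr (1 + 2 * \<gamma>) * J powr (- 2 * \<gamma>))"
    by (simp add: t_def s_def algebra_simps)
  also have "\<dots> = (2 * \<tau> * C3 - \<tau> * (M\<^sup>2 / 8)) * J" by (simp only: Jp)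
  also have "exp \<dots> \<le> exp (- (C7 + 1) * J)"
    using M3 J_pos by (subst exp_le_cancel_iff, intro mult_right_mono) auto
  finally have mA2: "measure m0 A2 \<le> exp (- (C7 + 1) * J)" .
  have mK: "exp (- K / 4) \<le> exp (- (C7 + 1) * J)"
  proof -
    have "(C7 + 1) * J \<le> (\<kappa> * M\<^sup>2 / 4) * J" using M4 J_pos by (intro mult_right_mono) auto
    then show ?thesis by (simp add: K_def algebra_simps)
  qed
  have "(measure m0 A2 + exp (- K / 4)) / (\<epsilon> * (\<beta> / 2 * exp (- 3 / 2 * (C6 * J))))
      \<le> (2 * exp (- (C7 + 1) * J)) / (\<epsilon> * ((exp (- C5 * J) / 2) / 2 * exp (- 3 / 2 * (C6 * J))))"
  proof (rule frac_le)
    show "measure m0 A2 + exp (- K / 4) \<le> 2 * exp (- (C7 + 1) * J)" using mA2 mK by linarith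
    show "\<epsilon> * ((exp (- C5 * J) / 2) / 2 * exp (- 3 / 2 * (C6 * J))) \<le> \<epsilon> * (\<beta> / 2 * exp (- 3 / 2 * (C6 * J)))"
      using \<beta> \<epsilon> by (intro mult_left_mono mult_right_mono divide_right_mono) auto
  qed (use \<epsilon> in auto)
  \<comment> \<open>The 8 is 2 for the two numerators, 2 for the halved evidence and 2 for the
    halved small-ball mass; the exponents cancel by the choice of \<open>C7\<close>.\<close>
  also have "\<dots> = 8 / \<epsilon> * exp (- J)"
  proof -
    have "exp (- (C7 + 1) * J) = exp (- C5 * J) * exp (- 3 / 2 * (C6 * J)) * exp (- J)"
      by (simp add: mult_exp_exp C7_def algebra_simps)
    then show ?thesis using \<epsilon> by (simp add: field_simps)
  qed
  finally have third: "(measure m0 A2 + exp (- K / 4)) / (\<epsilon> * (\<beta> / 2 * exp (- 3 / 2 * (C6 * J)))) \<le> 8 / \<epsilon> * exp (- J)" .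
  have "exp (- (real cut / 2)) \<le> exp (- J / 2)" using cut_bounds by simp
  then show ?thesis using bound third unfolding A_def by linarith
qed

end

end

section \<open>Passage from one-based indices, and the two regimes of the rate\<close>

lemma summable_powr_Suc:
  assumes "\<beta> > 0"
  shows "summable (\<lambda>j. real (Suc j) powr (- 1 - \<beta>))"
proof (rule summableI_nonneg_bounded)
  show "(\<Sum>j<m. real (Suc j) powr (- 1 - \<beta>)) \<le> (1 + 1 / \<beta>) * real (Suc 0) powr (- \<beta>)" for m
    using sum_powr_tail_le[OF assms, of 0 m] by (simp add: atLeast0LessThan)
qed simp

lemma smoothness_space_summable:
  assumes "u \<in> smoothness_space \<phi> \<gamma>"
  shows "summable (\<lambda>j. real (Suc j) powr (2 * \<gamma>) * (u \<bullet> \<phi> (Suc j))\<^sup>2)"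
proof -
  let ?f = "\<lambda>i. real i powr (2 * \<gamma>) * (u \<bullet> \<phi> i)\<^sup>2"
  have "{1..} = range Suc" by (auto simp: image_iff) (metis Suc_le_D)
  then have "?f summable_on range Suc" using assms by (simp add: smoothness_space_def)
  then have "(?f \<circ> Suc) summable_on UNIV" by (subst (asm) summable_on_reindex) auto
  then show ?thesis by (subst (asm) summable_on_UNIV_nonneg_real_iff) (auto simp: comp_def)
qed

lemma smoothness_space_antimono:
  assumes "\<gamma>' \<le> \<gamma>"
  shows "smoothness_space \<phi> \<gamma> \<subseteq> smoothness_space \<phi> \<gamma>'"
proof
  fix u assume "u \<in> smoothness_space \<phi> \<gamma>"
  then have "(\<lambda>i. real i powr (2 * \<gamma>) * (u \<bullet> \<phi> i)\<^sup>2) summable_on {1..}"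
    by (simp add: smoothness_space_def)
  then have "(\<lambda>i. real i powr (2 * \<gamma>') * (u \<bullet> \<phi> i)\<^sup>2) summable_on {1..}"
    by (rule summable_on_comparison_test) (use assms in \<open>auto intro!: mult_right_mono powr_mono\<close>)
  then show "u \<in> smoothness_space \<phi> \<gamma>'" by (simp add: smoothness_space_def)
qed

theorem theorem4p2:
  fixes G :: "'a::{real_inner, complete_space, second_countable_topology} \<Rightarrow>
              'b::{real_inner, complete_space, second_countable_topology}"
    and e \<phi> :: "nat \<Rightarrow> 'a"
    and b :: "nat \<Rightarrow> 'b"
    and \<rho> R :: "nat \<Rightarrow> real"
    and c1 c2 \<alpha> \<delta> :: real
    and C :: "nat \<Rightarrow> 'a \<Rightarrow> 'a"
    and \<mu> :: "nat \<Rightarrow> 'a measure"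
    and P :: "'w measure"
    and \<eta> :: "'b \<Rightarrow> 'w \<Rightarrow> real"
  assumes "\<alpha> > 0" and "\<delta> > 0" and "\<And>n. n \<ge> 1 \<Longrightarrow> R n > 0"
    and "bounded_linear G" and "inj G"
    and "orthonormal_basis_on {1..} e"
    and "\<And>k. k \<ge> 1 \<Longrightarrow> adjoint G (G (e k)) = (\<rho> k)\<^sup>2 *\<^sub>R e k"
    and "c1 > 0" and "c2 > 0"
    and "\<And>k. k \<ge> 1 \<Longrightarrow> c1 * (1 + (real k)\<^sup>2) powr (- \<alpha> / 2) \<le> \<rho> k"
    and "\<And>k. k \<ge> 1 \<Longrightarrow> \<rho> k \<le> c2 * (1 + (real k)\<^sup>2) powr (- \<alpha> / 2)"
    and "orthonormal_basis_on {1..} \<phi>"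
    and "\<And>j k. j \<ge> 1 \<Longrightarrow> k \<ge> 1 \<Longrightarrow> real k \<notin> {real j / 3 - 1 .. 2 * real j} \<Longrightarrow> \<phi> j \<bullet> e k = 0"
    and "orthonormal_basis_on UNIV b"
    and "white_noise P \<eta>"
    and "\<And>n. n \<ge> 1 \<Longrightarrow> centered_gaussian_measure (\<mu> n) (C n)"
    and "\<And>n j. n \<ge> 1 \<Longrightarrow> j \<ge> 1 \<Longrightarrow>
           C n (\<phi> j) = (R n powr (-2) * real j powr (- 1 - 2 * \<delta>)) *\<^sub>R \<phi> j"
  shows "well_posed P G b \<eta> \<mu> \<and>
    (\<forall>\<gamma> u0. \<gamma> > 0 \<longrightarrow> u0 \<in> smoothness_space \<phi> \<gamma> \<longrightarrow>
       (2 * \<gamma> \<le> 1 + 2 * \<delta> \<and>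
        (\<forall>n\<ge>1. R n = real n powr ((\<gamma> - \<delta>) / (1 + 2 * \<alpha> + 2 * \<gamma>))) \<longrightarrow>
          contraction_rate P G b \<eta> \<mu> u0
            (\<lambda>n. real n powr (- \<gamma> / (1 + 2 * \<alpha> + 2 * \<gamma>)))) \<and>
       (2 * \<gamma> > 1 + 2 * \<delta> \<and>
        (\<forall>n\<ge>1. R n = real n powr (1 / (4 * (1 + \<alpha> + \<delta>)))) \<longrightarrow>
          contraction_rate P G b \<eta> \<mu> u0
            (\<lambda>n. real n powr (- (2 * \<delta> + 1) / (4 * (1 + \<alpha> + \<delta>))))))"
proof -
  note pos = assms(1,2,8,9)
  define e' where "e' k = e (Suc k)" for k
  define \<phi>' where "\<phi>' j = \<phi> (Suc j)" for j
  define \<rho>' where "\<rho>' k = \<rho> (Suc k)" for k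
  have e': "orthonormal_basis_on UNIV e'" and \<phi>': "orthonormal_basis_on UNIV \<phi>'"
    unfolding e'_def[abs_def] \<phi>'_def[abs_def] using assms(6,12) by (auto intro: orthonormal_basis_on_Suc)
  have eig: "adjoint G (G (e' k)) = (\<rho>' k)\<^sup>2 *\<^sub>R e' k" for k
    using assms(7)[of "Suc k"] by (simp add: e'_def \<rho>'_def)
  have \<rho>_lower: "c1 * (1 + (real (Suc k))\<^sup>2) powr (- \<alpha> / 2) \<le> \<rho>' k" for k
    using assms(10)[of "Suc k"] by (simp add: \<rho>'_def)
  have \<rho>_upper: "\<rho>' k \<le> c2 * (1 + (real (Suc k))\<^sup>2) powr (- \<alpha> / 2)" for k
    using assms(11)[of "Suc k"] by (simp add: \<rho>'_def)
  have \<rho>_pos: "0 < \<rho>' k" for k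
  proof -
    have "0 < 1 + (real (Suc k))\<^sup>2" by (intro add_pos_nonneg) auto
    then have "0 < c1 * (1 + (real (Suc k))\<^sup>2) powr (- \<alpha> / 2)" using pos by simp
    then show ?thesis using \<rho>_lower[of k] by (rule less_le_trans)
  qed
  \<comment> \<open>After the shift by one, k + 1 < (j + 1) / 3 - 1 reads j > 3 k + 5.\<close>
  have supp_upper: "\<phi>' j \<bullet> e' k = 0" if "j > 3 * k + 5" for j k
    unfolding \<phi>'_def e'_def
  proof (rule assms(13))
    have "real j \<ge> 3 * real k + 6" using that by linarith
    then show "real (Suc k) \<notin> {real (Suc j) / 3 - 1..2 * real (Suc j)}" by simp
  qed auto
  \<comment> \<open>After the shift, k + 1 > 2 (j + 1) reads k > 2 j + 1.\<close>
  have supp_lower: "\<phi>' j \<bullet> e' k = 0" if "k > 2 * j + 1" for j k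
    unfolding \<phi>'_def e'_def
  proof (rule assms(13))
    have "real k \<ge> 2 * real j + 2" using that by linarith
    then show "real (Suc k) \<notin> {real (Suc j) / 3 - 1..2 * real (Suc j)}" by simp
  qed auto
  define v where "v n j = R n powr (- 2) * real (Suc j) powr (- 1 - 2 * \<delta>)" for n j
  have prior: "gaussian_prior (\<mu> n) \<phi>' (v n)" if n: "n \<ge> 1" for n
  proof
    have gp: "centered_gaussian_process (\<mu> n) (\<lambda>h u. u \<bullet> h) (\<lambda>h h'. C n h \<bullet> h')"
      using assms(16)[OF n] by (simp add: centered_gaussian_measure_def)
    have "C n (\<phi>' j) \<bullet> \<phi>' k = (if j = k then v n j else 0)" for j k
      using assms(17)[OF n, of "Suc j"] onb_inner[OF \<phi>', of j k] by (auto simp: v_def \<phi>'_def)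
    then show "centered_gaussian_process (\<mu> n) (\<lambda>j u. u \<bullet> \<phi>' j) (\<lambda>j k. if j = k then v n j else 0)"
      using centered_gaussian_process_reindex[OF gp, of \<phi>'] by simp
    show "0 < v n j" for j using assms(3)[OF n] by (simp add: v_def)
    show "sets (\<mu> n) = sets borel" using assms(16)[OF n] by (simp add: centered_gaussian_measure_def)
  qed (rule \<phi>')
  have regression: "gaussian_regression_eigenbasis P \<eta> b G (\<mu> n) e' \<rho>'" if n: "n \<ge> 1" for n
  proof (intro gaussian_regression_eigenbasis.intro gaussian_regression.intro white_noise_basis.intro
      gaussian_regression_axioms.intro gaussian_regression_eigenbasis_axioms.intro)
    interpret prior: gaussian_prior "\<mu> n" \<phi>' "v n" by (rule prior[OF n])
    have gp: "centered_gaussian_process (\<mu> n) (\<lambda>h u. u \<bullet> h) (\<lambda>h h'. C n h \<bullet> h')"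
      using assms(16)[OF n] by (simp add: centered_gaussian_measure_def)
    show "\<exists>v. centered_normal (\<mu> n) (\<lambda>u. u \<bullet> h) v" for h
      using centered_gaussian_process_component[OF gp] by blast
    show "prob_space (\<mu> n)" by (rule prior.prob_space_axioms)
    show "sets (\<mu> n) = sets borel" by (rule prior.sets_m0)
    show "(\<integral>\<^sup>+u. ennreal ((norm u)\<^sup>2) \<partial>\<mu> n) < \<infinity>"
    proof (rule prior.second_moment)
      show "summable (v n)"
        unfolding v_def[abs_def] using pos by (intro summable_mult summable_powr_Suc) auto
    qed
    show "G x \<bullet> y = x \<bullet> adjoint G y" for x y by (rule adjoint_inner[OF e' assms(4)])
  qed (use assms(4,14,15) e' eig \<rho>_pos in auto)
  have "well_posed P G b \<eta> \<mu>"
    using regression by (intro well_posedI) (auto simp: gaussian_regression_eigenbasis_def)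
  moreover have rate: "contraction_rate P G b \<eta> \<mu> u0 (\<lambda>n. real n powr (- \<gamma> / (1 + 2 * \<alpha> + 2 * \<gamma>)))"
    if \<gamma>: "\<gamma> > 0" "2 * \<gamma> \<le> 1 + 2 * \<delta>" and u0: "u0 \<in> smoothness_space \<phi> \<gamma>"
      and R: "\<And>n. n \<ge> 1 \<Longrightarrow> R n = real n powr ((\<gamma> - \<delta>) / (1 + 2 * \<alpha> + 2 * \<gamma>))" for \<gamma> u0
  proof -
    define S where "S = 1 + 2 * \<alpha> + 2 * \<gamma>"
    have S: "S > 0" using pos \<gamma> by (simp add: S_def)
    \<comment> \<open>For n \<ge> 1 this turns the prescribed \<open>R n\<close> into J powr
      (\<gamma> - \<delta>); the rate becomes J powr -\<gamma>.\<close>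
    define J where "J n = real n powr (1 / S)" for n
    define U where "U = (\<Sum>j. real (Suc j) powr (2 * \<gamma>) * (u0 \<bullet> \<phi>' j)\<^sup>2)"
    have smooth: "summable (\<lambda>j. real (Suc j) powr (2 * \<gamma>) * (u0 \<bullet> \<phi>' j)\<^sup>2)"
      unfolding \<phi>'_def by (rule smoothness_space_summable[OF u0])
    have U: "0 \<le> U" unfolding U_def by (rule suminf_nonneg[OF smooth]) simp
    have meyer: "meyer_regression P \<eta> b G (\<mu> n) e' \<rho>' \<phi>' (v n) \<alpha> \<delta> \<gamma> c1 c2 (J n) n" if n: "n \<ge> 1" for n
    proof (rule meyer_regression.intro[OF regression[OF n] prior[OF n]], unfold_locales)
      have "R n powr (- 2) = J n powr (2 * \<delta> - 2 * \<gamma>)"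
        unfolding R[OF n] J_def powr_powr S_def[symmetric] using S by (intro arg_cong2[where f="(powr)"]) (auto simp: field_simps)
      then show "v n j = J n powr (2 * \<delta> - 2 * \<gamma>) * real (Suc j) powr (- 1 - 2 * \<delta>)" for j
        by (simp add: v_def)
      show "1 \<le> J n" unfolding J_def using n S by (intro ge_one_powr_ge_zero) auto
      show "real n = J n powr (1 + 2 * \<alpha> + 2 * \<gamma>)"
        unfolding J_def S_def[symmetric] powr_powr using n S by simp
    qed (fact pos \<gamma> \<rho>_lower \<rho>_upper supp_upper supp_lower)+
    define C3 where "C3 = (1 + 1 / (2 * \<delta>)) * 2 powr (2 * \<delta>)"
    define C5 where "C5 = 2 * (2 + (1 + 2 * \<alpha> + 2 * \<delta>) / 2) + 2 powr (1 + 2 * \<delta> - 2 * \<gamma>) * U"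
    define C6 where "C6 = c2\<^sup>2 * 6 powr (2 * \<alpha>) * (1 + 4 * C3 + 2 * 2 powr (2 * \<gamma>) * U)"
    define C7 where "C7 = C5 + 3 / 2 * C6"
    define \<kappa> where "\<kappa> = c1\<^sup>2 * 5 powr (- \<alpha>) / 2"
    define \<tau> where "\<tau> = (2::real) powr (- 3 - 2 * \<delta>)"
    have C3: "C3 > 0" using pos by (simp add: C3_def add_pos_pos)
    have C6: "C6 > 0" using pos C3 U by (simp add: C6_def add_pos_nonneg)
    have "C5 \<ge> 0" using pos U by (simp add: C5_def)
    then have C7: "C7 \<ge> 0" using C6 by (simp add: C7_def)
    have \<kappa>: "\<kappa> > 0" and \<tau>: "\<tau> > 0" using pos by (simp_all add: \<kappa>_def \<tau>_def)
    \<comment> \<open>The sum of all lower bounds imposed on M^2; the leading 1 ensures M \<le> M^2,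
      so that each bound holds for the square. No summand depends on \<open>n\<close> or on the
      tolerance, as \<open>contraction_rate\<close> fixes the constant first.\<close>
    define M where "M = 1 + 8 * 2 powr (2 * \<gamma>) * U + 128 / \<kappa> + 8 * (2 * \<tau> * C3 + C7 + 1) / \<tau> + 4 * (C7 + 1) / \<kappa>"
    have terms: "0 \<le> 8 * 2 powr (2 * \<gamma>) * U" "0 \<le> 128 / \<kappa>" "0 \<le> 8 * (2 * \<tau> * C3 + C7 + 1) / \<tau>" "0 \<le> 4 * (C7 + 1) / \<kappa>"
      using U \<kappa> \<tau> C3 C7 by auto
    then have M1: "1 \<le> M" unfolding M_def by linarith
    then have MM: "M \<le> M\<^sup>2" by (simp add: power2_eq_square)
    have M: "M > 0" "8 * 2 powr (2 * \<gamma>) * U \<le> M\<^sup>2" "128 / \<kappa> \<le> M\<^sup>2"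
      "8 * (2 * \<tau> * C3 + C7 + 1) / \<tau> \<le> M\<^sup>2" "4 * (C7 + 1) / \<kappa> \<le> M\<^sup>2"
      using terms M1 MM M_def by linarith+
    have bound: "measure (observation_law P G b \<eta> u0 n)
        {y. measure (posterior G b \<mu> n y) {u. norm (u - u0) > M * J n powr (- \<gamma>)} > \<epsilon>}
      \<le> 2 / (C6 * J n) + exp (- J n / 2) + 8 / \<epsilon> * exp (- J n)" if n: "n \<ge> 1" and \<epsilon>: "\<epsilon> > 0" for n \<epsilon>
    proof -
      interpret meyer_regression P \<eta> b G "\<mu> n" e' \<rho>' \<phi>' "v n" \<alpha> \<delta> \<gamma> c1 c2 "J n" n by (rule meyer[OF n])
      show ?thesis
        using contraction_bound[of u0 U \<mu> \<epsilon> M] smooth \<epsilon> M \<kappa> \<tau>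
        unfolding U_def[symmetric] C3_def[symmetric] C5_def[symmetric] C6_def[symmetric] C7_def[symmetric]
          \<kappa>_def[symmetric] \<tau>_def[symmetric]
        by (simp add: field_simps)
    qed
    show ?thesis
      unfolding contraction_rate_def
    proof (intro exI conjI allI impI)
      show "M > 0" by (rule M)
      fix \<epsilon> :: real assume \<epsilon>: "\<epsilon> > 0"
      have J_top: "filterlim J at_top sequentially"
        unfolding J_def[abs_def] using S
        by (intro filterlim_compose[OF real_powr_at_top filterlim_real_sequentially]) simp
      have exp0: "(\<lambda>n. exp (- f n)) \<longlonglongrightarrow> 0" if "filterlim f at_top sequentially" for f :: "nat \<Rightarrow> real"
        using that by (intro filterlim_compose[OF exp_at_bot]) (simp add: filterlim_uminus_at_top)
      have "filterlim (\<lambda>n. (1 / 2) * J n) at_top sequentially"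
        by (rule filterlim_tendsto_pos_mult_at_top[OF tendsto_const _ J_top]) simp
      from exp0[OF this] exp0[OF J_top] tendsto_inverse_0_at_top[OF J_top]
      have "(\<lambda>n. 2 / C6 * inverse (J n) + exp (- ((1 / 2) * J n)) + 8 / \<epsilon> * exp (- J n))
          \<longlonglongrightarrow> 2 / C6 * 0 + 0 + 8 / \<epsilon> * 0"
        by (intro tendsto_add tendsto_mult tendsto_const)
      then have lim: "(\<lambda>n. 2 / (C6 * J n) + exp (- J n / 2) + 8 / \<epsilon> * exp (- J n)) \<longlonglongrightarrow> 0"
        by (simp add: field_simps)
      have \<xi>: "real n powr (- \<gamma> / (1 + 2 * \<alpha> + 2 * \<gamma>)) = J n powr (- \<gamma>)" for n
        by (simp add: J_def powr_powr S_def)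
      show "(\<lambda>n. measure (observation_law P G b \<eta> u0 n)
          {y. measure (posterior G b \<mu> n y) {u. norm (u - u0) > M * real n powr (- \<gamma> / (1 + 2 * \<alpha> + 2 * \<gamma>))} > \<epsilon>})
          \<longlonglongrightarrow> 0"
        unfolding \<xi>
      proof (rule tendsto_sandwich[OF _ _ tendsto_const lim])
        show "\<forall>\<^sub>F n in sequentially. measure (observation_law P G b \<eta> u0 n)
            {y. measure (posterior G b \<mu> n y) {u. norm (u - u0) > M * J n powr (- \<gamma>)} > \<epsilon>}
          \<le> 2 / (C6 * J n) + exp (- J n / 2) + 8 / \<epsilon> * exp (- J n)"
          using eventually_ge_at_top[of 1] by eventually_elim (rule bound[OF _ \<epsilon>])
      qed simp
    qed
  qed
  moreover have "contraction_rate P G b \<eta> \<mu> u0 (\<lambda>n. real n powr (- (2 * \<delta> + 1) / (4 * (1 + \<alpha> + \<delta>))))"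
    if \<gamma>: "2 * \<gamma> > 1 + 2 * \<delta>" and u0: "u0 \<in> smoothness_space \<phi> \<gamma>"
      and R: "\<And>n. n \<ge> 1 \<Longrightarrow> R n = real n powr (1 / (4 * (1 + \<alpha> + \<delta>)))" for \<gamma> u0
  proof -
    \<comment> \<open>The boundary case 2\<gamma>' = 1 + 2\<delta>: then \<gamma>' - \<delta> = 1/2
      and 1 + 2\<alpha> + 2\<gamma>' = 2 (1 + \<alpha> + \<delta>), which reproduces the scale and
      the rate of the second regime.\<close>
    define \<gamma>' where "\<gamma>' = \<delta> + 1 / 2"
    have "\<gamma>' \<le> \<gamma>" using \<gamma> by (simp add: \<gamma>'_def)
    then have u0': "u0 \<in> smoothness_space \<phi> \<gamma>'" using u0 smoothness_space_antimono by blast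
    have eq: "(\<gamma>' - \<delta>) / (1 + 2 * \<alpha> + 2 * \<gamma>') = 1 / (4 * (1 + \<alpha> + \<delta>))"
      "- \<gamma>' / (1 + 2 * \<alpha> + 2 * \<gamma>') = - (2 * \<delta> + 1) / (4 * (1 + \<alpha> + \<delta>))"
      using pos by (simp_all add: \<gamma>'_def divide_simps) (simp_all add: algebra_simps)
    have "\<gamma>' > 0" "2 * \<gamma>' \<le> 1 + 2 * \<delta>" using pos by (auto simp: \<gamma>'_def)
    from rate[OF this u0', unfolded eq] R show ?thesis by blast
  qed
  ultimately show ?thesis by blast
qed

end
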